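(* Let $Q$ be a Dynkin quiver with vertices $1,\dots,n$ and path matrix $(a_{ij})$, and let $A=kQ$ with $k=\mathbb{F}_q$. Let $\mathfrak{K}_0$ be the two-sided ideal of $\mathcal{H}(C_1(\mathscr{P}))$ generated by all $[K_{P_i}]$, $1\le i\le n$, and $\underline{\mathcal{H}}(C_1(\mathscr{P})):=\mathcal{H}(C_1(\mathscr{P}))/\mathfrak{K}_0$, where the image of $[C_{P_i}]$ is again denoted $[C_{P_i}]$. For any $1\leq i\neq j\leq n$, the following hold in $\underline{\mathcal{H}}(C_1(\mathscr{P}))$: (1) if $a_{ij}=0$, then $[C_{P_i}][C_{P_j}]=[C_{P_j}][C_{P_i}]$; (2) if $a_{ij}=1$, then $$[C_{P_i}][C_{P_j}]^2-(q+1)[C_{P_j}][C_{P_i}][C_{P_j}]+q[C_{P_j}]^2[C_{P_i}]=0$$ and $$q[C_{P_j}][C_{P_i}]^2-(q+1)[C_{P_i}][C_{P_j}][C_{P_i}]+[C_{P_i}]^2[C_{P_j}]=0.$$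
   Context: Dynkin means that the underlying graph is of type $\mathbb{A}$, $\mathbb{D}$ or $\mathbb{E}$. Path matrix: if there is a directed path from $i$ to $j$ ($i\ne j$) then $a_{ij}=1$ and $a_{ji}=-1$; if there is no path between $i$ and $j$ in either direction, or $i=j$, then $a_{ij}=0$. $A$-modules are finite dimensional left modules, $\mathscr{P}$ is the category of projective $A$-modules, $S_i$ the simple module at $i$, $P_i$ its projective cover. Conventions are such that if there is a path from $i$ to $j$ ($i\neq j$) then $\operatorname{Hom}_A(P_j,P_i)\cong k$ and $\operatorname{Hom}_A(P_i,P_j)=0$. A 1-cyclic complex is a pair $(M,d)$ with $M$ an $A$-module and $d\in\operatorname{End}_A(M)$, $d^2=0$; morphisms are $A$-homomorphisms commuting with the differentials. $C_1(\mathscr{P})$ is the exact category of 1-cyclic complexes of projective modules (exact sequences: those short exact on underlying modules). For $P\in\mathscr{P}$, $C_P=(P,0)$ and $K_P=\left(P\oplus P,\begin{pmatrix}0&1\\0&0\end{pmatrix}\right)$. Hall algebra: let $W_{XY}^Z$ be the set of pairs $(\varphi,\psi)$ with $0\to Y\xrightarrow{\varphi}Z\xrightarrow{\psi}X\to0$ exact in $C_1(\mathscr{P})$, and $F_{XY}^Z:=|W_{XY}^Z|/(|\operatorname{Aut}X||\operatorname{Aut}Y|)$. $\mathcal{H}(C_1(\mathscr{P}))$ is the $\mathbb{C}$-vector space with basis the isoclasses $[X]$ and multiplication $[X]\cdot[Y]=\sum_{[Z]}F_{XY}^Z[Z]$. *)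

theory Defs
  imports
    Complex_Main
    "HOL-Algebra.Module"
    "HOL-Algebra.QuotRing"
    "Graph_Theory.Arc_Walk"
begin

section \<open>Dynkin quivers and the path matrix\<close>

text \<open>A quiver is a directed multigraph (\<open>pre_digraph\<close>); directed paths are its arc walks.\<close>

definition type_A_edges :: "nat \<Rightarrow> nat set set" where
  "type_A_edges m = {{i, i + 1} | i. 1 \<le> i \<and> i < m}"

text \<open>A chain on \<open>1, \<dots>, m - 1\<close> with the vertex \<open>m\<close> attached to \<open>m - 2\<close> (type D),
  respectively to the vertex 3 (type E, arms of lengths 2, \<open>m - 4\<close> and 1).\<close>

definition type_D_edges :: "nat \<Rightarrow> nat set set" where
  "type_D_edges m = insert {m - 2, m} (type_A_edges (m - 1))"

definition type_E_edges :: "nat \<Rightarrow> nat set set" where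
  "type_E_edges m = insert {3, m} (type_A_edges (m - 1))"

text \<open>The second condition is a bijection between arrows and edges, so it excludes
  multiple arrows and loops.\<close>

definition has_underlying_graph :: "('v, 'e) pre_digraph \<Rightarrow> nat \<Rightarrow> nat set set \<Rightarrow> bool" where
  "has_underlying_graph Q m E \<longleftrightarrow>
     (\<exists>\<sigma>. bij_betw \<sigma> (verts Q) {1..m} \<and>
          bij_betw (\<lambda>e. {\<sigma> (tail Q e), \<sigma> (head Q e)}) (arcs Q) E)"

definition dynkin_quiver :: "('v, 'e) pre_digraph \<Rightarrow> bool" where
  "dynkin_quiver Q \<longleftrightarrow> wf_digraph Q \<and>
     (\<exists>m. (1 \<le> m \<and> has_underlying_graph Q m (type_A_edges m)) \<or>
          (4 \<le> m \<and> has_underlying_graph Q m (type_D_edges m)) \<or>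
          (m \<in> {6, 7, 8} \<and> has_underlying_graph Q m (type_E_edges m)))"

definition has_path :: "('v, 'e) pre_digraph \<Rightarrow> 'v \<Rightarrow> 'v \<Rightarrow> bool" where
  "has_path Q i j \<longleftrightarrow> (\<exists>p. pre_digraph.awalk Q i p j)"

definition path_matrix :: "('v, 'e) pre_digraph \<Rightarrow> 'v \<Rightarrow> 'v \<Rightarrow> int" where
  "path_matrix Q i j =
     (if i \<noteq> j \<and> has_path Q i j then 1
      else if i \<noteq> j \<and> has_path Q j i then - 1
      else 0)"


section \<open>The path algebra\<close>

text \<open>Algebras are encoded by the record type \<open>module\<close>: a ring together with a scalar
  multiplication. A path is a triple (source, arcs, target), so that trivial paths at different
  vertices are distinct.\<close>

type_synonym ('v, 'e) qpath = "'v \<times> 'e list \<times> 'v"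

definition qpaths :: "('v, 'e) pre_digraph \<Rightarrow> ('v, 'e) qpath set" where
  "qpaths Q = {(u, p, v). pre_digraph.awalk Q u p v}"

text \<open>The product of a path \<open>x\<close> from \<open>v\<close> to \<open>w\<close> with a path \<open>y\<close> from \<open>u\<close> to \<open>v\<close> is the path
  \<open>xy\<close> that runs through \<open>y\<close> first. Hence a path from \<open>i\<close> to \<open>j\<close> lies in \<open>e\<^sub>j A e\<^sub>i\<close>, which is
  the space of homomorphisms from \<open>A e\<^sub>j\<close> to \<open>A e\<^sub>i\<close>.\<close>

definition path_algebra ::
  "('v, 'e) pre_digraph \<Rightarrow> ('k::field, ('v, 'e) qpath \<Rightarrow> 'k) module" where
  "path_algebra Q =
     \<lparr>carrier = {f. finite {x. f x \<noteq> 0} \<and> {x. f x \<noteq> 0} \<subseteq> qpaths Q},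
      mult = (\<lambda>f g (u, p, w).
        \<Sum>(v, p1, p2) \<in> {(v, p1, p2).
            (u, p1, v) \<in> qpaths Q \<and> (v, p2, w) \<in> qpaths Q \<and> p = p1 @ p2}.
          f (v, p2, w) * g (u, p1, v)),
      one = (\<lambda>(u, p, w). if u \<in> verts Q \<and> p = [] \<and> w = u then 1 else 0),
      zero = (\<lambda>x. 0),
      add = (\<lambda>f g x. f x + g x),
      smult = (\<lambda>c f x. c * f x)\<rparr>"


section \<open>Finite dimensional left modules\<close>

text \<open>The locale \<open>module\<close> of HOL-Algebra requires a commutative base ring, so the axioms are
  restated over an arbitrary ring. The fields \<open>mult\<close> and \<open>one\<close> of a record that represents a
  module carry no meaning.\<close>

locale left_module = R?: ring R + M?: abelian_group M
  for R (structure) and M (structure) +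
  assumes smult_closed: "\<lbrakk>a \<in> carrier R; x \<in> carrier M\<rbrakk> \<Longrightarrow> a \<odot>\<^bsub>M\<^esub> x \<in> carrier M"
    and smult_l_distr: "\<lbrakk>a \<in> carrier R; b \<in> carrier R; x \<in> carrier M\<rbrakk> \<Longrightarrow>
      (a \<oplus>\<^bsub>R\<^esub> b) \<odot>\<^bsub>M\<^esub> x = a \<odot>\<^bsub>M\<^esub> x \<oplus>\<^bsub>M\<^esub> b \<odot>\<^bsub>M\<^esub> x"
    and smult_r_distr: "\<lbrakk>a \<in> carrier R; x \<in> carrier M; y \<in> carrier M\<rbrakk> \<Longrightarrow>
      a \<odot>\<^bsub>M\<^esub> (x \<oplus>\<^bsub>M\<^esub> y) = a \<odot>\<^bsub>M\<^esub> x \<oplus>\<^bsub>M\<^esub> a \<odot>\<^bsub>M\<^esub> y"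
    and smult_assoc: "\<lbrakk>a \<in> carrier R; b \<in> carrier R; x \<in> carrier M\<rbrakk> \<Longrightarrow>
      (a \<otimes>\<^bsub>R\<^esub> b) \<odot>\<^bsub>M\<^esub> x = a \<odot>\<^bsub>M\<^esub> (b \<odot>\<^bsub>M\<^esub> x)"
    and smult_one: "x \<in> carrier M \<Longrightarrow> \<one>\<^bsub>R\<^esub> \<odot>\<^bsub>M\<^esub> x = x"

text \<open>A scalar \<open>c\<close> of the ground field acts on a module through the element \<open>c \<cdot> 1\<close> of the
  algebra.\<close>

definition fd_module :: "('k::field, 'a) module \<Rightarrow> ('a, 'm) module \<Rightarrow> bool" where
  "fd_module R M \<longleftrightarrow> left_module R M \<and>
     (\<exists>B. finite B \<and> B \<subseteq> carrier M \<and>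
        (\<forall>x\<in>carrier M. \<exists>c::'m \<Rightarrow> 'k.
           x = (\<Oplus>\<^bsub>M\<^esub>b\<in>B. (c b \<odot>\<^bsub>R\<^esub> \<one>\<^bsub>R\<^esub>) \<odot>\<^bsub>M\<^esub> b)))"

text \<open>Homomorphisms are extensional functions, so that homomorphisms that agree on the carrier
  are equal and can be counted.\<close>

definition lmod_hom ::
  "('k, 'a) module \<Rightarrow> ('a, 'm) module \<Rightarrow> ('a, 'n) module \<Rightarrow> ('m \<Rightarrow> 'n) set" where
  "lmod_hom R M N =
     {f \<in> carrier M \<rightarrow>\<^sub>E carrier N.
        (\<forall>x\<in>carrier M. \<forall>y\<in>carrier M. f (x \<oplus>\<^bsub>M\<^esub> y) = f x \<oplus>\<^bsub>N\<^esub> f y) \<and>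
        (\<forall>a\<in>carrier R. \<forall>x\<in>carrier M. f (a \<odot>\<^bsub>M\<^esub> x) = a \<odot>\<^bsub>N\<^esub> f x)}"

text \<open>From here on the ground field is finite. Finite dimensional modules are then finite sets,
  so each of them is isomorphic to one whose carrier consists of natural numbers, and such
  modules serve as the small category of all finite dimensional modules.\<close>

definition projective_module ::
  "('k::{field,finite}, 'a) module \<Rightarrow> ('a, 'm) module \<Rightarrow> bool" where
  "projective_module R P \<longleftrightarrow> fd_module R P \<and>
     (\<forall>(M :: ('a, nat) module) (N :: ('a, nat) module).
        fd_module R M \<longrightarrow> fd_module R N \<longrightarrow>
        (\<forall>g\<in>lmod_hom R M N. \<forall>f\<in>lmod_hom R P N. g ` carrier M = carrier N \<longrightarrow>
           (\<exists>h\<in>lmod_hom R P M. \<forall>x\<in>carrier P. g (h x) = f x)))"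

text \<open>A projective cover is an epimorphism from a projective module whose kernel is
  superfluous.\<close>

definition is_projective_cover ::
  "('k::{field,finite}, 'a) module \<Rightarrow> ('a, 'm) module \<Rightarrow> ('a, 'n) module \<Rightarrow> bool" where
  "is_projective_cover R P S \<longleftrightarrow> projective_module R P \<and>
     (\<exists>\<pi>\<in>lmod_hom R P S. \<pi> ` carrier P = carrier S \<and>
        (\<forall>N. submodule N R P \<and> N <+>\<^bsub>P\<^esub> {x \<in> carrier P. \<pi> x = \<zero>\<^bsub>S\<^esub>} = carrier P
           \<longrightarrow> N = carrier P))"

text \<open>The simple module at \<open>i\<close>: the ground field, on which the trivial path at \<open>i\<close> acts as the
  identity and every other path acts as zero.\<close>

definition simple_module :: "'v \<Rightarrow> (('v, 'e) qpath \<Rightarrow> 'k::field, 'k) module" where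
  "simple_module i =
     \<lparr>carrier = UNIV, mult = (*), one = 1, zero = 0, add = (+),
      smult = (\<lambda>a c. a (i, [], i) * c)\<rparr>"

definition zero_module :: "('a, unit) module" where
  "zero_module =
     \<lparr>carrier = {()}, mult = (\<lambda>x y. ()), one = (), zero = (), add = (\<lambda>x y. ()),
      smult = (\<lambda>a x. ())\<rparr>"

definition direct_sum ::
  "('a, 'm) module \<Rightarrow> ('a, 'n) module \<Rightarrow> ('a, 'm \<times> 'n) module" where
  "direct_sum M N =
     \<lparr>carrier = carrier M \<times> carrier N,
      mult = (\<lambda>(x, y) (x', y'). (x \<otimes>\<^bsub>M\<^esub> x', y \<otimes>\<^bsub>N\<^esub> y')),
      one = (\<one>\<^bsub>M\<^esub>, \<one>\<^bsub>N\<^esub>),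
      zero = (\<zero>\<^bsub>M\<^esub>, \<zero>\<^bsub>N\<^esub>),
      add = (\<lambda>(x, y) (x', y'). (x \<oplus>\<^bsub>M\<^esub> x', y \<oplus>\<^bsub>N\<^esub> y')),
      smult = (\<lambda>a (x, y). (a \<odot>\<^bsub>M\<^esub> x, a \<odot>\<^bsub>N\<^esub> y))\<rparr>"


section \<open>1-cyclic complexes of projectives\<close>

type_synonym ('a, 'm) cyclic_complex = "('a, 'm) module \<times> ('m \<Rightarrow> 'm)"

definition is_cyclic_complex ::
  "('k::field, 'a) module \<Rightarrow> ('a, 'm) cyclic_complex \<Rightarrow> bool" where
  "is_cyclic_complex R X \<longleftrightarrow> fd_module R (fst X) \<and> snd X \<in> lmod_hom R (fst X) (fst X) \<and>
     (\<forall>x\<in>carrier (fst X). snd X (snd X x) = \<zero>\<^bsub>fst X\<^esub>)"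

definition C1_objects ::
  "('k::{field,finite}, 'a) module \<Rightarrow> ('a, nat) cyclic_complex set" where
  "C1_objects R = {X. is_cyclic_complex R X \<and> projective_module R (fst X)}"

definition C1_hom ::
  "('k, 'a) module \<Rightarrow> ('a, 'm) cyclic_complex \<Rightarrow> ('a, 'n) cyclic_complex \<Rightarrow> ('m \<Rightarrow> 'n) set" where
  "C1_hom R X Y =
     {f \<in> lmod_hom R (fst X) (fst Y). \<forall>x\<in>carrier (fst X). f (snd X x) = snd Y (f x)}"

definition C1_isos ::
  "('k, 'a) module \<Rightarrow> ('a, 'm) cyclic_complex \<Rightarrow> ('a, 'n) cyclic_complex \<Rightarrow> ('m \<Rightarrow> 'n) set" where
  "C1_isos R X Y = {f \<in> C1_hom R X Y. bij_betw f (carrier (fst X)) (carrier (fst Y))}"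

text \<open>The complex \<open>X\<close> itself may have a carrier of any type, whereas the members of its class
  have carriers in \<open>nat\<close>.\<close>

definition isoclass ::
  "('k::{field,finite}, 'a) module \<Rightarrow> ('a, 'm) cyclic_complex \<Rightarrow> ('a, nat) cyclic_complex set" where
  "isoclass R X = {Y \<in> C1_objects R. C1_isos R X Y \<noteq> {}}"

definition isoclasses ::
  "('k::{field,finite}, 'a) module \<Rightarrow> ('a, nat) cyclic_complex set set" where
  "isoclasses R = isoclass R ` C1_objects R"

definition C_complex :: "('a, 'm) module \<Rightarrow> ('a, 'm) cyclic_complex" where
  "C_complex P = (P, restrict (\<lambda>x. \<zero>\<^bsub>P\<^esub>) (carrier P))"

text \<open>The matrix with rows \<open>(0, 1)\<close> and \<open>(0, 0)\<close> acts on column vectors.\<close>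

definition K_complex :: "('a, 'm) module \<Rightarrow> ('a, 'm \<times> 'm) cyclic_complex" where
  "K_complex P =
     (direct_sum P P, restrict (\<lambda>(x, y). (y, \<zero>\<^bsub>P\<^esub>)) (carrier P \<times> carrier P))"


section \<open>The Hall algebra and its quotient\<close>

definition hall_W ::
  "('k, 'a) module \<Rightarrow> ('a, 'l) cyclic_complex \<Rightarrow> ('a, 'm) cyclic_complex \<Rightarrow>
   ('a, 'n) cyclic_complex \<Rightarrow> (('m \<Rightarrow> 'n) \<times> ('n \<Rightarrow> 'l)) set" where
  "hall_W R X Y Z =
     {(\<phi>, \<psi>). \<phi> \<in> C1_hom R Y Z \<and> \<psi> \<in> C1_hom R Z X \<and>
        inj_on \<phi> (carrier (fst Y)) \<and>
        \<psi> ` carrier (fst Z) = carrier (fst X) \<and>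
        \<phi> ` carrier (fst Y) = {z \<in> carrier (fst Z). \<psi> z = \<zero>\<^bsub>fst X\<^esub>}}"

definition hall_number ::
  "('k, 'a) module \<Rightarrow> ('a, 'l) cyclic_complex \<Rightarrow> ('a, 'm) cyclic_complex \<Rightarrow>
   ('a, 'n) cyclic_complex \<Rightarrow> complex" where
  "hall_number R X Y Z =
     of_nat (card (hall_W R X Y Z)) /
     (of_nat (card (C1_isos R X X)) * of_nat (card (C1_isos R Y Y)))"

type_synonym 'a hall_vector = "('a, nat) cyclic_complex set \<Rightarrow> complex"

definition hall_basis ::
  "('k::{field,finite}, 'a) module \<Rightarrow> ('a, 'm) cyclic_complex \<Rightarrow> 'a hall_vector" where
  "hall_basis R X = (\<lambda>\<alpha>. if \<alpha> = isoclass R X then 1 else 0)"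

text \<open>Finitely supported functions on the set of isoclasses. The product is the bilinear
  extension of \<open>[X] \<cdot> [Y] = \<Sum>[Z]. F\<^sub>X\<^sub>Y\<^sup>Z [Z]\<close>, evaluated at representatives of the classes; the
  unit is the class of the zero complex.\<close>

definition hall_algebra ::
  "('k::{field,finite}, 'a) module \<Rightarrow> (complex, 'a hall_vector) module" where
  "hall_algebra R =
     \<lparr>carrier = {f. finite {\<alpha>. f \<alpha> \<noteq> 0} \<and> {\<alpha>. f \<alpha> \<noteq> 0} \<subseteq> isoclasses R},
      mult = (\<lambda>f g \<gamma>.
        if \<gamma> \<in> isoclasses R
        then \<Sum>\<alpha> | f \<alpha> \<noteq> 0. \<Sum>\<beta> | g \<beta> \<noteq> 0.
          f \<alpha> * g \<beta> * hall_number R (SOME X. X \<in> \<alpha>) (SOME Y. Y \<in> \<beta>) (SOME Z. Z \<in> \<gamma>)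
        else 0),
      one = hall_basis R (C_complex zero_module),
      zero = (\<lambda>\<alpha>. 0),
      add = (\<lambda>f g \<alpha>. f \<alpha> + g \<alpha>),
      smult = (\<lambda>c f \<alpha>. c * f \<alpha>)\<rparr>"

text \<open>The factor ring by a two-sided ideal, with the induced scalar multiplication.\<close>

definition quotient_algebra :: "('c, 'a) module \<Rightarrow> 'a set \<Rightarrow> ('c, 'a set) module" where
  "quotient_algebra H I =
     ring.extend (H Quot I) \<lparr>smult = (\<lambda>c X. \<Union>x\<in>X. I +>\<^bsub>H\<^esub> (c \<odot>\<^bsub>H\<^esub> x))\<rparr>"

definition K_ideal ::
  "('k::{field,finite}, 'a) module \<Rightarrow> ('i \<Rightarrow> ('a, 'm) module) \<Rightarrow> 'i set \<Rightarrow> 'a hall_vector set" where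
  "K_ideal R P I = genideal (hall_algebra R) ((\<lambda>i. hall_basis R (K_complex (P i))) ` I)"

definition reduced_hall_algebra ::
  "('k::{field,finite}, 'a) module \<Rightarrow> ('i \<Rightarrow> ('a, 'm) module) \<Rightarrow> 'i set \<Rightarrow>
   (complex, 'a hall_vector set) module" where
  "reduced_hall_algebra R P I = quotient_algebra (hall_algebra R) (K_ideal R P I)"

definition reduced_C ::
  "('k::{field,finite}, 'a) module \<Rightarrow> ('i \<Rightarrow> ('a, 'm) module) \<Rightarrow> 'i set \<Rightarrow> 'i \<Rightarrow>
   'a hall_vector set" where
  "reduced_C R P I i = K_ideal R P I +>\<^bsub>hall_algebra R\<^esub> hall_basis R (C_complex (P i))"

end

theory Submission
  imports Defs
begin

text \<open>Put \<open>{X} = |Aut X| [X]\<close>. Every conflation \<open>0 \<rightarrow> Y \<rightarrow> Z \<rightarrow> X \<rightarrow> 0\<close> splits on underlying modules,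
  so \<open>Z\<close> is \<open>Y \<oplus> X\<close> with a differential given by a cocycle \<open>g \<in> Hom\<^sub>A(X, Y)\<close>, and counting splittings
  gives \<open>{X} {Y} = |Hom\<^sub>A(X, Y)|\<^sup>-\<^sup>1 \<Sum>\<^sub>g {Y \<oplus>\<^sub>g X}\<close>, the sum over all cocycles. Since the underlying graph is
  a tree, \<open>Hom\<^sub>A(P\<^sub>j, P\<^sub>i)\<close> is at most one-dimensional and \<open>End\<^sub>A(P\<^sub>i) = k\<close>. If there is no path between \<open>i\<close>
  and \<open>j\<close>, then all cocycles vanish and the two classes commute. If there is a path from \<open>i\<close> to \<open>j\<close>,
  take \<open>f \<noteq> 0\<close> in \<open>Hom\<^sub>A(P\<^sub>j, P\<^sub>i)\<close>, let \<open>W\<close> be the extension defined by \<open>f\<close>, and put \<open>x = {C(P\<^sub>i)}\<close>,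
  \<open>y = {C(P\<^sub>j)}\<close>, \<open>w = {W}\<close>. Then \<open>q y x = x y + (q - 1) w\<close>, while \<open>w y - y w\<close> and \<open>x w - w x\<close> are multiples of
  \<open>x {K(P\<^sub>j)}\<close> and \<open>{K(P\<^sub>i)} y\<close>. So \<open>w\<close> commutes with \<open>x\<close> and \<open>y\<close> modulo the ideal, which is equivalent to
  the two relations.\<close>

section \<open>Walks in Dynkin quivers\<close>

text \<open>The relations are commutators in disguise. Inserting
  \<open>(q - 1) w = q y x - x y\<close> gives
  \<open>x y^2 - (q + 1) y x y + q y^2 x = - (q - 1) (w y - y w)\<close>, which is where the
  coefficients come from; the second relation is \<open>- (q - 1) (x w - w x)\<close>. The products
  \<open>y w\<close> and \<open>w y\<close> both contain the direct sum of \<open>W\<close> and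
  \<open>C(P\<^sub>j)\<close> with coefficient \<open>1 / q\<close>. In \<open>y w\<close> nothing
  else occurs: every cocycle is a coboundary, because each homomorphism from
  \<open>P\<^sub>j\<close> to \<open>P\<^sub>i\<close> factors through \<open>f\<close>. In
  \<open>w y\<close> the cocycles are the endomorphisms of \<open>P\<^sub>j\<close>; zero gives the
  direct sum, while each of the \<open>q - 1\<close> invertible ones ties the two copies of
  \<open>P\<^sub>j\<close> together to a contractible summand \<open>K(P\<^sub>j)\<close> and leaves
  \<open>C(P\<^sub>i)\<close> over. With \<open>x\<close> the roles are mirrored. So only the
  surplus terms have to lie in the ideal, and no classification of complexes is involved. The Dynkin
  condition enters through the uniqueness of walks with given ends: it bounds the spaces of
  homomorphisms and excludes oriented cycles.\<close>

context wf_digraph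
begin

text \<open>Every vertex has at most one neighbour of smaller rank. Hence a vertex of maximal rank on two
  walks with the same end points is a leaf, so that it is one of the end points and both walks use the
  only arc at it.\<close>

lemma cas_unique:
  fixes r :: "'a \<Rightarrow> nat"
  assumes no_loop: "\<And>e. e \<in> arcs G \<Longrightarrow> tail G e \<noteq> head G e"
    and inj: "inj_on (\<lambda>e. max (r (tail G e)) (r (head G e))) (arcs G)"
  shows "\<lbrakk>cas u p v; cas u p' v; set p \<union> set p' \<subseteq> arcs G\<rbrakk> \<Longrightarrow> p = p'"
proof (induction "length p" arbitrary: u p v p' rule: less_induct)
  case less
  let ?S = "set p \<union> set p'"
  define h where "h e = max (r (tail G e)) (r (head G e))" for e
  show ?case
  proof (cases "?S = {}")
    case True
    then show ?thesis by simp
  next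
    case False
    then have "Max (h ` ?S) \<in> h ` ?S"
      by (intro Max_in) simp_all
    then obtain e0 where e0: "e0 \<in> ?S" "h e0 = Max (h ` ?S)"
      by (metis imageE)
    have max: "h e \<le> h e0" if "e \<in> ?S" for e
      unfolding e0(2) using that by (intro Max_ge) simp_all
    \<comment> \<open>\<open>h e0\<close> is the largest rank in sight, so an arc that touches a
      vertex of this rank has it as its maximum and equals \<open>e0\<close> by injectivity.\<close>
    have uniq: "e = e0" if e: "e \<in> ?S" and "r (tail G e) = h e0 \<or> r (head G e) = h e0" for e
    proof -
      have "h e = h e0"
        using max[OF e] that(2) h_def[of e] by linarith
      then show ?thesis
        using e e0(1) less.prems(3) by (intro inj_onD[OF inj]) (auto simp: h_def)
    qed
    have loop: "tail G e0 \<noteq> head G e0"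
      using no_loop e0(1) less.prems(3) by blast
    consider "r (head G e0) = h e0" | "r (tail G e0) = h e0"
      using h_def[of e0] by linarith
    then show ?thesis
    proof cases
      case 1
      \<comment> \<open>\<open>e0\<close> enters its top vertex and is the only arc that touches it,
        so nothing leaves it: a walk through \<open>e0\<close> has to stop there.\<close>
      have no_tail: "tail G e \<noteq> head G e0" if "e \<in> ?S" for e
        using uniq[OF that] loop 1 by metis
      have "v = head G e0" if w: "cas u w v" "e0 \<in> set w" "set w \<subseteq> ?S" for w
      proof -
        obtain w1 w2 where w12: "w = w1 @ e0 # w2"
          using w(2) by (meson split_list)
        then have "cas (head G e0) w2 v"
          using w(1) by simp
        then show ?thesis
          using no_tail w(3) w12 by (cases w2) auto
      qed
      then have v: "v = head G e0"
        using e0(1) less.prems(1,2) by blast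
      have "p \<noteq> []" "p' \<noteq> []"
        using e0(1) less.prems(1,2) no_tail v by (cases p; cases p'; force)+
      then obtain w e w' e' where w: "p = w @ [e]" "p' = w' @ [e']"
        by (metis append_butlast_last_id)
      then have "cas u (w @ [e]) v" "cas u (w' @ [e']) v"
        using less.prems(1,2) by simp_all
      then have c: "head G e = v" "head G e' = v" "cas u w (tail G e)" "cas u w' (tail G e')"
        unfolding cas_append_iff by simp_all
      have "e = e0" "e' = e0"
        using 1 c v w by (auto intro!: uniq)
      then show ?thesis
        using less.hyps[of w u "tail G e0" w'] c w less.prems(3) by simp
    next
      case 2
      have no_head: "head G e \<noteq> tail G e0" if "e \<in> ?S" for e
        using uniq[OF that] loop 2 by metis
      have "u = tail G e0" if w: "cas u w v" "e0 \<in> set w" "set w \<subseteq> ?S" for w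
      proof -
        obtain w1 w2 where w12: "w = w1 @ e0 # w2"
          using w(2) by (meson split_list)
        then have "cas u w1 (tail G e0)"
          using w(1) by simp
        then show ?thesis
          using no_head w(3) w12 by (cases w1 rule: rev_cases) auto
      qed
      then have u: "u = tail G e0"
        using e0(1) less.prems(1,2) by blast
      \<comment> \<open>No arc enters \<open>u\<close>, so a nonempty walk cannot return to it. This
        makes both walks nonempty, and their first arc can be removed.\<close>
      have "v \<noteq> u"
      proof -
        obtain w where w: "cas u w v" "w \<noteq> []" "set w \<subseteq> ?S"
          using less.prems(1,2) False by blast
        then have "cas u (butlast w @ [last w]) v" "last w \<in> ?S"
          using last_in_set[of w] by (simp, blast)
        then show ?thesis
          using no_head u unfolding cas_append_iff by auto
      qed
      then obtain w e w' e' where w: "p = e # w" "p' = e' # w'"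
        using less.prems(1,2) by (cases p; cases p') auto
      then have c: "tail G e = u" "tail G e' = u" "cas (head G e) w v" "cas (head G e') w' v"
        using less.prems(1,2) by simp_all
      have "e = e0" "e' = e0"
        using 2 c u w by (auto intro!: uniq)
      then show ?thesis
        using less.hyps[of w "head G e0" v w'] c w less.prems(3) by simp
    qed
  qed
qed

end

section \<open>Edge sets of the Dynkin diagrams\<close>

lemma inj_on_Max_type_A_edges: "inj_on Max (type_A_edges m)"
proof (rule inj_onI)
  fix x y assume "x \<in> type_A_edges m" "y \<in> type_A_edges m" and eq: "Max x = Max y"
  then obtain i j where "x = {i, i + 1}" "y = {j, j + 1}"
    by (auto simp: type_A_edges_def)
  with eq show "x = y" by simp
qed

lemma Max_type_A_edges_less: "x \<in> type_A_edges (m - 1) \<Longrightarrow> Max x < m"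
  by (auto simp: type_A_edges_def)

text \<open>In these labellings no vertex is joined to two smaller labels: beyond a chain, types D
  and E add just the last vertex \<open>m\<close> with a single edge. So the labels can serve as the
  ranks in \<open>cas_unique\<close>.\<close>

lemma inj_on_Max_edges:
  "inj_on Max (type_A_edges m)"
  "inj_on Max (type_D_edges m)"
  "3 \<le> m \<Longrightarrow> inj_on Max (type_E_edges m)"
proof -
  have *: "inj_on Max (insert {x, m} (type_A_edges (m - 1)))" if "x \<le> m" for x
  proof -
    have m: "Max {x, m} = m"
      using that by simp
    have "Max y \<noteq> m" if "y \<in> type_A_edges (m - 1)" for y
      using Max_type_A_edges_less[OF that] by simp
    then have "Max {x, m} \<notin> Max ` (type_A_edges (m - 1) - {{x, m}})"
      unfolding m by blast
    then show ?thesis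
      using inj_on_Max_type_A_edges by (simp only: inj_on_insert simp_thms)
  qed
  show "inj_on Max (type_A_edges m)"
    by (rule inj_on_Max_type_A_edges)
  show "inj_on Max (type_D_edges m)"
    unfolding type_D_edges_def by (rule *) simp
  show "3 \<le> m \<Longrightarrow> inj_on Max (type_E_edges m)"
    unfolding type_E_edges_def by (rule *)
qed

text \<open>The bounds rule out a degenerate extra edge: truncated subtraction makes
  \<open>{m - 2, m}\<close> a singleton for \<open>m = 0\<close>, and \<open>{3, m}\<close> is one
  for \<open>m = 3\<close>.\<close>

lemma singleton_notin_edges:
  "{x} \<notin> type_A_edges m"
  "0 < m \<Longrightarrow> {x} \<notin> type_D_edges m"
  "3 < m \<Longrightarrow> {x} \<notin> type_E_edges m"
  by (auto simp: type_A_edges_def type_D_edges_def type_E_edges_def)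

text \<open>An arc is determined by its edge and an edge by its larger label, so the larger label of
  the two ends is injective on arcs, whatever the orientation.\<close>

lemma dynkin_awalk_unique:
  assumes Q: "dynkin_quiver Q"
    and p: "pre_digraph.awalk Q u p v" "pre_digraph.awalk Q u p' v"
  shows "p = p'"
proof -
  interpret wf_digraph Q using Q by (simp add: dynkin_quiver_def)
  obtain m where "1 \<le> m \<and> has_underlying_graph Q m (type_A_edges m) \<or>
      4 \<le> m \<and> has_underlying_graph Q m (type_D_edges m) \<or>
      m \<in> {6, 7, 8} \<and> has_underlying_graph Q m (type_E_edges m)"
    using Q unfolding dynkin_quiver_def by (elim conjE exE)
  moreover have "m \<in> {6, 7, 8} \<Longrightarrow> 3 < m"
    by auto
  ultimately consider "has_underlying_graph Q m (type_A_edges m)"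
    | "4 \<le> m" "has_underlying_graph Q m (type_D_edges m)"
    | "3 < m" "has_underlying_graph Q m (type_E_edges m)"
    by argo
  then obtain m E where "has_underlying_graph Q m E" and E: "inj_on Max E" "\<And>x. {x} \<notin> E"
  proof cases
    case 1
    then show thesis
      by (rule that[OF _ inj_on_Max_edges(1) singleton_notin_edges(1)])
  next
    case 2
    show thesis
      using 2(1) that[OF 2(2) inj_on_Max_edges(2) singleton_notin_edges(2)] by simp
  next
    case 3
    show thesis
      using 3(1) that[OF 3(2) inj_on_Max_edges(3) singleton_notin_edges(3)] by simp
  qed
  then obtain r where b: "bij_betw (\<lambda>e. {r (tail Q e), r (head Q e)}) (arcs Q) E"
    by (auto simp: has_underlying_graph_def)
  show ?thesis
  proof (rule cas_unique)
    show "tail Q e \<noteq> head Q e" if "e \<in> arcs Q" for e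
      using bij_betwE[OF b] that E(2) by fastforce
    have "inj_on (Max \<circ> (\<lambda>e. {r (tail Q e), r (head Q e)})) (arcs Q)"
      using b E(1) by (intro comp_inj_on) (auto simp: bij_betw_def)
    then show "inj_on (\<lambda>e. max (r (tail Q e)) (r (head Q e))) (arcs Q)"
      by (simp add: comp_def)
    show "cas u p v" "cas u p' v" "set p \<union> set p' \<subseteq> arcs Q"
      using p by (auto simp: awalk_def)
  qed
qed

text \<open>A path is determined by its two ends, so there are no more paths than pairs of
  vertices.\<close>

lemma finite_qpaths:
  assumes Q: "dynkin_quiver Q" and "finite (verts Q)"
  shows "finite (qpaths Q)"
proof -
  interpret wf_digraph Q using Q by (simp add: dynkin_quiver_def)
  have "inj_on (\<lambda>(u, p, v). (u, v)) (qpaths Q)"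
    using dynkin_awalk_unique[OF Q] by (auto simp: inj_on_def qpaths_def)
  moreover have "(\<lambda>(u, p, v). (u, v)) ` qpaths Q \<subseteq> verts Q \<times> verts Q"
    by (auto simp: qpaths_def dest: awalk_hd_in_verts awalk_last_in_verts)
  ultimately show ?thesis
    using assms(2) by (meson finite_SigmaI finite_subset inj_on_finite)
qed

text \<open>Coefficients matter only on \<open>B\<close>; restricting them leaves finitely many
  families even if the type of all families is infinite.\<close>

lemma finite_fun_image: "finite B \<Longrightarrow> finite ((\<lambda>c :: 'b \<Rightarrow> 'c::finite. restrict c B) ` UNIV)"
  by (rule finite_subset[of _ "B \<rightarrow>\<^sub>E UNIV"]) (auto intro: finite_PiE)

section \<open>Zero and negatives in left modules\<close>

context left_module
begin

lemma smult_M_zero: "a \<in> carrier R \<Longrightarrow> a \<odot>\<^bsub>M\<^esub> \<zero>\<^bsub>M\<^esub> = \<zero>\<^bsub>M\<^esub>"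
  using smult_r_distr[of a "\<zero>\<^bsub>M\<^esub>" "\<zero>\<^bsub>M\<^esub>"] smult_closed[of a "\<zero>\<^bsub>M\<^esub>"]
  by (simp add: M.add.l_cancel_one')

lemma smult_R_zero: "x \<in> carrier M \<Longrightarrow> \<zero>\<^bsub>R\<^esub> \<odot>\<^bsub>M\<^esub> x = \<zero>\<^bsub>M\<^esub>"
  using smult_l_distr[of "\<zero>\<^bsub>R\<^esub>" "\<zero>\<^bsub>R\<^esub>" x] smult_closed[of "\<zero>\<^bsub>R\<^esub>" x]
  by (simp add: M.add.l_cancel_one')

lemma smult_uminus:
  assumes "a \<in> carrier R" "x \<in> carrier M"
  shows "a \<odot>\<^bsub>M\<^esub> (\<ominus>\<^bsub>M\<^esub> x) = \<ominus>\<^bsub>M\<^esub> (a \<odot>\<^bsub>M\<^esub> x)"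
  using smult_r_distr[of a "\<ominus>\<^bsub>M\<^esub> x" x] assms
  by (simp add: M.l_neg smult_M_zero smult_closed M.minus_equality)

end

section \<open>Homomorphisms of modules\<close>

lemma lmod_homI:
  assumes "\<And>x. x \<in> carrier M \<Longrightarrow> f x \<in> carrier N"
    and "f \<in> extensional (carrier M)"
    and "\<And>x y. \<lbrakk>x \<in> carrier M; y \<in> carrier M\<rbrakk> \<Longrightarrow> f (x \<oplus>\<^bsub>M\<^esub> y) = f x \<oplus>\<^bsub>N\<^esub> f y"
    and "\<And>a x. \<lbrakk>a \<in> carrier R; x \<in> carrier M\<rbrakk> \<Longrightarrow> f (a \<odot>\<^bsub>M\<^esub> x) = a \<odot>\<^bsub>N\<^esub> f x"
  shows "f \<in> lmod_hom R M N"
  using assms by (auto simp: lmod_hom_def PiE_def)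

lemma lmod_hom_closed: "\<lbrakk>f \<in> lmod_hom R M N; x \<in> carrier M\<rbrakk> \<Longrightarrow> f x \<in> carrier N"
  by (auto simp: lmod_hom_def)

lemma lmod_hom_add:
  "\<lbrakk>f \<in> lmod_hom R M N; x \<in> carrier M; y \<in> carrier M\<rbrakk> \<Longrightarrow> f (x \<oplus>\<^bsub>M\<^esub> y) = f x \<oplus>\<^bsub>N\<^esub> f y"
  by (auto simp: lmod_hom_def)

lemma lmod_hom_smult:
  "\<lbrakk>f \<in> lmod_hom R M N; a \<in> carrier R; x \<in> carrier M\<rbrakk> \<Longrightarrow> f (a \<odot>\<^bsub>M\<^esub> x) = a \<odot>\<^bsub>N\<^esub> f x"
  by (auto simp: lmod_hom_def)

lemma lmod_hom_extensional: "f \<in> lmod_hom R M N \<Longrightarrow> f \<in> extensional (carrier M)"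
  by (auto simp: lmod_hom_def PiE_def)

lemma lmod_hom_eqI:
  assumes "f \<in> lmod_hom R M N" "g \<in> lmod_hom R M N'"
    and "\<And>x. x \<in> carrier M \<Longrightarrow> f x = g x"
  shows "f = g"
  using assms by (meson extensionalityI lmod_hom_extensional)

lemma lmod_hom_zero:
  assumes "left_module R M" "left_module R N" "f \<in> lmod_hom R M N"
  shows "f \<zero>\<^bsub>M\<^esub> = \<zero>\<^bsub>N\<^esub>"
proof -
  interpret M: left_module R M by fact
  interpret N: left_module R N by fact
  show ?thesis
    using lmod_hom_add[OF assms(3), of "\<zero>\<^bsub>M\<^esub>" "\<zero>\<^bsub>M\<^esub>"] lmod_hom_closed[OF assms(3), of "\<zero>\<^bsub>M\<^esub>"]
    by (simp add: N.M.add.l_cancel_one')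
qed

lemma lmod_hom_uminus:
  assumes "left_module R M" "left_module R N" "f \<in> lmod_hom R M N" "x \<in> carrier M"
  shows "f (\<ominus>\<^bsub>M\<^esub> x) = \<ominus>\<^bsub>N\<^esub> f x"
proof -
  interpret M: left_module R M by fact
  interpret N: left_module R N by fact
  have "f (\<ominus>\<^bsub>M\<^esub> x) \<oplus>\<^bsub>N\<^esub> f x = \<zero>\<^bsub>N\<^esub>"
    using assms by (simp add: lmod_hom_add[symmetric] lmod_hom_zero M.M.l_neg)
  then show ?thesis
    using assms lmod_hom_closed by (metis M.M.a_inv_closed N.M.minus_equality)
qed

lemma lmod_hom_comp:
  assumes "f \<in> lmod_hom R M N" "g \<in> lmod_hom R N L" "left_module R M"
  shows "compose (carrier M) g f \<in> lmod_hom R M L"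
proof -
  interpret M: left_module R M by fact
  show ?thesis
    using assms by (intro lmod_homI)
      (auto simp: compose_def lmod_hom_add lmod_hom_smult lmod_hom_closed M.smult_closed)
qed

lemma lmod_hom_id:
  assumes "left_module R M"
  shows "restrict (\<lambda>x. x) (carrier M) \<in> lmod_hom R M M"
proof -
  interpret M: left_module R M by fact
  show ?thesis
    by (intro lmod_homI) (auto simp: M.smult_closed)
qed

lemma lmod_hom_const_zero:
  assumes "left_module R M" "left_module R N"
  shows "restrict (\<lambda>x. \<zero>\<^bsub>N\<^esub>) (carrier M) \<in> lmod_hom R M N"
proof -
  interpret M: left_module R M by fact
  interpret N: left_module R N by fact
  show ?thesis
    by (intro lmod_homI) (auto simp: M.smult_closed N.smult_M_zero)
qed

lemma lmod_hom_inverse: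
  assumes "f \<in> lmod_hom R M N" "bij_betw f (carrier M) (carrier N)" "left_module R M"
    "left_module R N"
  shows "restrict (inv_into (carrier M) f) (carrier N) \<in> lmod_hom R N M"
proof -
  interpret M: left_module R M by fact
  interpret N: left_module R N by fact
  let ?g = "inv_into (carrier M) f"
  have g: "?g y \<in> carrier M" "f (?g y) = y" if "y \<in> carrier N" for y
    using assms(2) that by (auto simp: bij_betw_def inv_into_into f_inv_into_f)
  have gI: "?g y = x" if "x \<in> carrier M" "f x = y" for x y
    using assms(2) that by (auto simp: bij_betw_def inv_into_f_f)
  show ?thesis
  proof (intro lmod_homI)
    show "restrict ?g (carrier N) (x \<oplus>\<^bsub>N\<^esub> y)
        = restrict ?g (carrier N) x \<oplus>\<^bsub>M\<^esub> restrict ?g (carrier N) y"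
      if "x \<in> carrier N" "y \<in> carrier N" for x y
      using that g by (auto intro!: gI simp: lmod_hom_add[OF assms(1)])
    show "restrict ?g (carrier N) (a \<odot>\<^bsub>N\<^esub> x) = a \<odot>\<^bsub>M\<^esub> restrict ?g (carrier N) x"
      if "a \<in> carrier R" "x \<in> carrier N" for a x
      using that g by (auto intro!: gI simp: lmod_hom_smult[OF assms(1)] M.smult_closed N.smult_closed)
  qed (auto simp: g)
qed

lemma finite_lmod_hom:
  assumes "finite (carrier M)" "finite (carrier N)"
  shows "finite (lmod_hom R M N)"
  by (rule finite_subset[of _ "carrier M \<rightarrow>\<^sub>E carrier N"])
    (auto simp: lmod_hom_def assms intro: finite_PiE)

section \<open>Finite modules\<close>

text \<open>Isolates what the Hall algebra computations ask of the ground field: it acts through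
  elements of the algebra, 0 and 1 acting as they should. As the field is finite, the finite
  dimensional modules are then exactly those with a finite carrier.\<close>

locale scalar_algebra = ring R for R :: "('k::{field,finite}, 'a) module" (structure) +
  assumes scalar_closed: "c \<odot> \<one> \<in> carrier R"
    and scalar_0: "0 \<odot> \<one> = \<zero>"
    and scalar_1: "1 \<odot> \<one> = \<one>"
begin

lemma fd_module_finite:
  assumes "fd_module R M"
  shows "left_module R M" "finite (carrier M)"
proof -
  show L: "left_module R M"
    using assms by (simp add: fd_module_def)
  interpret M: left_module R M by (rule L)
  obtain B where B: "finite B" "B \<subseteq> carrier M"
    and span: "\<forall>x\<in>carrier M. \<exists>c::'b \<Rightarrow> 'k. x = (\<Oplus>\<^bsub>M\<^esub>b\<in>B. (c b \<odot>\<^bsub>R\<^esub> \<one>\<^bsub>R\<^esub>) \<odot>\<^bsub>M\<^esub> b)"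
    using assms unfolding fd_module_def by (elim conjE exE)
  let ?F = "\<lambda>c. \<Oplus>\<^bsub>M\<^esub>b\<in>B. (c b \<odot>\<^bsub>R\<^esub> \<one>\<^bsub>R\<^esub>) \<odot>\<^bsub>M\<^esub> b"
  have F: "?F c = ?F (restrict c B)" for c :: "'b \<Rightarrow> 'k"
    using B by (intro M.M.finsum_cong') (auto intro!: M.smult_closed scalar_closed)
  have "carrier M \<subseteq> ?F ` ((\<lambda>c. restrict c B) ` UNIV)"
  proof
    fix x assume "x \<in> carrier M"
    then obtain c :: "'b \<Rightarrow> 'k" where "x = ?F c" using span by blast
    then show "x \<in> ?F ` ((\<lambda>c. restrict c B) ` UNIV)" using F by blast
  qed
  then show "finite (carrier M)"
    using B(1) finite_fun_image finite_subset by blast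
qed

text \<open>The whole carrier is taken as spanning set, with the indicator of \<open>x\<close> as
  coefficient family for \<open>x\<close>.\<close>

lemma fd_moduleI:
  assumes "left_module R M" "finite (carrier M)"
  shows "fd_module R M"
proof -
  interpret M: left_module R M by fact
  have "\<exists>c::'b \<Rightarrow> 'k. x = (\<Oplus>\<^bsub>M\<^esub>b\<in>carrier M. (c b \<odot>\<^bsub>R\<^esub> \<one>\<^bsub>R\<^esub>) \<odot>\<^bsub>M\<^esub> b)"
    if x: "x \<in> carrier M" for x
  proof
    have "(\<Oplus>\<^bsub>M\<^esub>b\<in>carrier M. ((if b = x then 1 else 0 :: 'k) \<odot>\<^bsub>R\<^esub> \<one>\<^bsub>R\<^esub>) \<odot>\<^bsub>M\<^esub> b)
        = (\<Oplus>\<^bsub>M\<^esub>b\<in>carrier M. if x = b then b else \<zero>\<^bsub>M\<^esub>)"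
      using x by (intro M.M.finsum_cong') (auto simp: scalar_0 scalar_1 M.smult_one M.smult_R_zero)
    also have "\<dots> = x"
      using M.M.finsum_singleton[OF x assms(2), of "\<lambda>b. b"] by auto
    finally show "x = (\<Oplus>\<^bsub>M\<^esub>b\<in>carrier M. ((if b = x then 1 else 0 :: 'k) \<odot>\<^bsub>R\<^esub> \<one>\<^bsub>R\<^esub>) \<odot>\<^bsub>M\<^esub> b)"
      by (rule sym)
  qed
  then show ?thesis
    unfolding fd_module_def using assms(1,2) by (intro conjI exI[of _ "carrier M"] ballI subset_refl)
qed

end

section \<open>Transport of structure\<close>

text \<open>The lifting property of projectives and the members of isoclasses only concern modules
  on \<open>nat\<close>. Carrying the structure along an injection provides such a copy of any
  finite module.\<close>

definition transport_module :: "('m \<Rightarrow> 'n) \<Rightarrow> ('a, 'm) module \<Rightarrow> ('a, 'n) module" where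
  "transport_module h M =
     \<lparr>carrier = h ` carrier M, mult = (\<lambda>x y. undefined), one = undefined, zero = h \<zero>\<^bsub>M\<^esub>,
      add = (\<lambda>x y. h (inv_into (carrier M) h x \<oplus>\<^bsub>M\<^esub> inv_into (carrier M) h y)),
      smult = (\<lambda>a x. h (a \<odot>\<^bsub>M\<^esub> inv_into (carrier M) h x))\<rparr>"

lemma transport_module:
  assumes M: "left_module R M" and h: "inj_on h (carrier M)"
  shows "left_module R (transport_module h M)"
    and "restrict h (carrier M) \<in> lmod_hom R M (transport_module h M)"
    and "bij_betw (restrict h (carrier M)) (carrier M) (carrier (transport_module h M))"
proof -
  interpret M: left_module R M by fact
  let ?T = "transport_module h M"
  have c: "carrier ?T = h ` carrier M" and z: "\<zero>\<^bsub>?T\<^esub> = h \<zero>\<^bsub>M\<^esub>"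
    by (simp_all add: transport_module_def)
  have a: "h x \<oplus>\<^bsub>?T\<^esub> h y = h (x \<oplus>\<^bsub>M\<^esub> y)" if "x \<in> carrier M" "y \<in> carrier M" for x y
    using that h by (simp add: transport_module_def)
  have s: "a \<odot>\<^bsub>?T\<^esub> h x = h (a \<odot>\<^bsub>M\<^esub> x)" if "x \<in> carrier M" for a x
    using that h by (simp add: transport_module_def)
  have "abelian_group ?T"
  proof (rule abelian_groupI)
    fix x assume "x \<in> carrier ?T"
    then obtain x' where "x' \<in> carrier M" "x = h x'"
      by (auto simp: c)
    then show "\<exists>y\<in>carrier ?T. y \<oplus>\<^bsub>?T\<^esub> x = \<zero>\<^bsub>?T\<^esub>"
      by (intro bexI[of _ "h (\<ominus>\<^bsub>M\<^esub> x')"]) (auto simp: c z a M.M.l_neg)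
  qed (auto simp: c z a M.M.a_ac)
  then show "left_module R ?T"
    by (intro left_module.intro left_module_axioms.intro M.ring_axioms)
      (auto simp: c a s M.smult_closed M.smult_l_distr M.smult_r_distr M.smult_assoc M.smult_one)
  show "restrict h (carrier M) \<in> lmod_hom R M ?T"
    by (intro lmod_homI) (auto simp: c a s M.smult_closed)
  show "bij_betw (restrict h (carrier M)) (carrier M) (carrier ?T)"
    using h by (simp add: bij_betw_def c inj_on_restrict_eq)
qed

lemma nat_copy:
  fixes M :: "('a, 'm) module"
  assumes M: "left_module R M" "finite (carrier M)"
  obtains M' :: "('a, nat) module" and h
  where "left_module R M'" "finite (carrier M')" "h \<in> lmod_hom R M M'"
    "bij_betw h (carrier M) (carrier M')"
proof -
  obtain h :: "'m \<Rightarrow> nat" where "inj_on h (carrier M)"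
    using finite_imp_inj_to_nat_seg[OF M(2)] by blast
  note T = transport_module[OF M(1) this]
  show thesis
    using that[OF T(1) _ T(2,3)] M(2) by (simp add: transport_module_def)
qed

section \<open>Direct sums\<close>

lemma direct_sum_simps:
  "carrier (direct_sum M N) = carrier M \<times> carrier N"
  "\<zero>\<^bsub>direct_sum M N\<^esub> = (\<zero>\<^bsub>M\<^esub>, \<zero>\<^bsub>N\<^esub>)"
  "(x, y) \<oplus>\<^bsub>direct_sum M N\<^esub> (x', y') = (x \<oplus>\<^bsub>M\<^esub> x', y \<oplus>\<^bsub>N\<^esub> y')"
  "a \<odot>\<^bsub>direct_sum M N\<^esub> (x, y) = (a \<odot>\<^bsub>M\<^esub> x, a \<odot>\<^bsub>N\<^esub> y)"
  by (simp_all add: direct_sum_def)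

lemma left_module_direct_sum:
  assumes "left_module R M" "left_module R N"
  shows "left_module R (direct_sum M N)"
proof -
  interpret M: left_module R M by fact
  interpret N: left_module R N by fact
  have "abelian_group (direct_sum M N)"
  proof (rule abelian_groupI)
    fix x assume "x \<in> carrier (direct_sum M N)"
    then show "\<exists>y\<in>carrier (direct_sum M N). y \<oplus>\<^bsub>direct_sum M N\<^esub> x = \<zero>\<^bsub>direct_sum M N\<^esub>"
      by (intro bexI[of _ "(\<ominus>\<^bsub>M\<^esub> fst x, \<ominus>\<^bsub>N\<^esub> snd x)"])
        (auto simp: direct_sum_simps M.M.l_neg N.M.l_neg)
  qed (auto simp: direct_sum_simps M.M.a_ac N.M.a_ac)
  then show ?thesis
    by (intro left_module.intro left_module_axioms.intro M.ring_axioms)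
      (auto simp: direct_sum_simps M.smult_closed M.smult_l_distr M.smult_r_distr M.smult_assoc
        M.smult_one N.smult_closed N.smult_l_distr N.smult_r_distr N.smult_assoc N.smult_one)
qed

lemma direct_sum_homs:
  assumes "left_module R M" "left_module R N"
  shows "restrict fst (carrier (direct_sum M N)) \<in> lmod_hom R (direct_sum M N) M"
    and "restrict snd (carrier (direct_sum M N)) \<in> lmod_hom R (direct_sum M N) N"
    and "restrict (\<lambda>x. (x, \<zero>\<^bsub>N\<^esub>)) (carrier M) \<in> lmod_hom R M (direct_sum M N)"
    and "restrict (\<lambda>y. (\<zero>\<^bsub>M\<^esub>, y)) (carrier N) \<in> lmod_hom R N (direct_sum M N)"
proof -
  interpret M: left_module R M by fact
  interpret N: left_module R N by fact
  show "restrict fst (carrier (direct_sum M N)) \<in> lmod_hom R (direct_sum M N) M"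
    "restrict snd (carrier (direct_sum M N)) \<in> lmod_hom R (direct_sum M N) N"
    by (auto intro!: lmod_homI simp: direct_sum_simps M.smult_closed N.smult_closed)
  show "restrict (\<lambda>x. (x, \<zero>\<^bsub>N\<^esub>)) (carrier M) \<in> lmod_hom R M (direct_sum M N)"
    "restrict (\<lambda>y. (\<zero>\<^bsub>M\<^esub>, y)) (carrier N) \<in> lmod_hom R N (direct_sum M N)"
    by (auto intro!: lmod_homI
        simp: direct_sum_simps M.smult_closed N.smult_closed M.smult_M_zero N.smult_M_zero)
qed

lemma card_lmod_hom_direct_sum_codomain:
  assumes "left_module R L" "left_module R M" "left_module R N"
  shows "card (lmod_hom R L (direct_sum M N)) = card (lmod_hom R L M) * card (lmod_hom R L N)"
proof -
  interpret L: left_module R L by fact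
  let ?S = "direct_sum M N"
  have "bij_betw (\<lambda>(f, g). restrict (\<lambda>x. (f x, g x)) (carrier L))
      (lmod_hom R L M \<times> lmod_hom R L N) (lmod_hom R L ?S)"
  proof (rule bij_betwI[where g = "\<lambda>h. (restrict (fst \<circ> h) (carrier L), restrict (snd \<circ> h) (carrier L))"])
    show "(\<lambda>(f, g). restrict (\<lambda>x. (f x, g x)) (carrier L)) \<in>
        lmod_hom R L M \<times> lmod_hom R L N \<rightarrow> lmod_hom R L ?S"
      by (auto intro!: lmod_homI simp: direct_sum_simps lmod_hom_closed lmod_hom_add lmod_hom_smult L.smult_closed)
    show "(\<lambda>h. (restrict (fst \<circ> h) (carrier L), restrict (snd \<circ> h) (carrier L))) \<in>
        lmod_hom R L ?S \<rightarrow> lmod_hom R L M \<times> lmod_hom R L N"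
    proof (rule Pi_I)
      fix h assume h: "h \<in> lmod_hom R L ?S"
      have "fst (h x) \<in> carrier M" "snd (h x) \<in> carrier N" if "x \<in> carrier L" for x
        using lmod_hom_closed[OF h that] by (auto simp: direct_sum_simps)
      then show "(restrict (fst \<circ> h) (carrier L), restrict (snd \<circ> h) (carrier L))
          \<in> lmod_hom R L M \<times> lmod_hom R L N"
        by (auto intro!: lmod_homI simp: lmod_hom_add[OF h] lmod_hom_smult[OF h] L.smult_closed
            direct_sum_def split: prod.splits)
    qed
    show "(\<lambda>h. (restrict (fst \<circ> h) (carrier L), restrict (snd \<circ> h) (carrier L)))
        ((\<lambda>(f, g). restrict (\<lambda>x. (f x, g x)) (carrier L)) p) = p"
      if p: "p \<in> lmod_hom R L M \<times> lmod_hom R L N" for p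
    proof -
      obtain f g where p: "p = (f, g)" "f \<in> lmod_hom R L M" "g \<in> lmod_hom R L N"
        using p by blast
      have "restrict (fst \<circ> restrict (\<lambda>x. (f x, g x)) (carrier L)) (carrier L) = f"
        using lmod_hom_extensional[OF p(2)] by (intro extensionalityI[of _ "carrier L"]) simp_all
      moreover have "restrict (snd \<circ> restrict (\<lambda>x. (f x, g x)) (carrier L)) (carrier L) = g"
        using lmod_hom_extensional[OF p(3)] by (intro extensionalityI[of _ "carrier L"]) simp_all
      ultimately show ?thesis using p(1) by simp
    qed
    show "(\<lambda>(f, g). restrict (\<lambda>x. (f x, g x)) (carrier L))
        ((\<lambda>h. (restrict (fst \<circ> h) (carrier L), restrict (snd \<circ> h) (carrier L))) h) = h"
      if "h \<in> lmod_hom R L ?S" for h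
      using lmod_hom_extensional[OF that] by (intro extensionalityI[of _ "carrier L"]) simp_all
  qed
  from bij_betw_same_card[OF this] show ?thesis
    by (simp add: card_cartesian_product)
qed

lemma lmod_hom_direct_sum_eq:
  assumes "left_module R M" "left_module R N" "left_module R L" "f \<in> lmod_hom R (direct_sum M N) L"
    "x \<in> carrier M" "y \<in> carrier N"
  shows "f (x, y) = f (x, \<zero>\<^bsub>N\<^esub>) \<oplus>\<^bsub>L\<^esub> f (\<zero>\<^bsub>M\<^esub>, y)"
proof -
  interpret M: left_module R M by fact
  interpret N: left_module R N by fact
  show ?thesis
    using assms(5,6) by (subst lmod_hom_add[OF assms(4), symmetric]) (auto simp: direct_sum_simps)
qed

lemma lmod_hom_copair:
  assumes "left_module R M" "left_module R N" "left_module R L" "f \<in> lmod_hom R M L" "g \<in> lmod_hom R N L"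
  shows "restrict (\<lambda>(x, y). f x \<oplus>\<^bsub>L\<^esub> g y) (carrier (direct_sum M N)) \<in> lmod_hom R (direct_sum M N) L"
proof -
  interpret M: left_module R M by fact
  interpret N: left_module R N by fact
  interpret L: left_module R L by fact
  note f = assms(4) and g = assms(5)
  show ?thesis
    by (intro lmod_homI)
      (auto simp: direct_sum_simps lmod_hom_closed[OF f] lmod_hom_closed[OF g] lmod_hom_add[OF f]
        lmod_hom_add[OF g] lmod_hom_smult[OF f] lmod_hom_smult[OF g] M.smult_closed N.smult_closed
        L.smult_r_distr L.M.a_ac)
qed

lemma card_lmod_hom_direct_sum_domain:
  assumes "left_module R L" "left_module R M" "left_module R N"
  shows "card (lmod_hom R (direct_sum M N) L) = card (lmod_hom R M L) * card (lmod_hom R N L)"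
proof -
  interpret L: left_module R L by fact
  interpret M: left_module R M by fact
  interpret N: left_module R N by fact
  let ?S = "direct_sum M N"
  let ?F = "\<lambda>(f, g). restrict (\<lambda>(x, y). f x \<oplus>\<^bsub>L\<^esub> g y) (carrier ?S)"
  let ?G = "\<lambda>h. (restrict (\<lambda>x. h (x, \<zero>\<^bsub>N\<^esub>)) (carrier M), restrict (\<lambda>y. h (\<zero>\<^bsub>M\<^esub>, y)) (carrier N))"
  have "bij_betw ?F (lmod_hom R M L \<times> lmod_hom R N L) (lmod_hom R ?S L)"
  proof (rule bij_betwI[where g = ?G])
    show "?F \<in> lmod_hom R M L \<times> lmod_hom R N L \<rightarrow> lmod_hom R ?S L"
      using lmod_hom_copair[OF assms(2,3,1)] by auto
    show "?G \<in> lmod_hom R ?S L \<rightarrow> lmod_hom R M L \<times> lmod_hom R N L"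
    proof (rule Pi_I)
      fix h assume h: "h \<in> lmod_hom R ?S L"
      show "?G h \<in> lmod_hom R M L \<times> lmod_hom R N L"
        by (auto intro!: lmod_homI lmod_hom_closed[OF h] simp: M.smult_closed N.smult_closed
            lmod_hom_add[OF h, symmetric] lmod_hom_smult[OF h, symmetric] direct_sum_simps
            M.smult_M_zero N.smult_M_zero)
    qed
    show "?G (?F p) = p" if p: "p \<in> lmod_hom R M L \<times> lmod_hom R N L" for p
    proof -
      obtain f g where p: "p = (f, g)" "f \<in> lmod_hom R M L" "g \<in> lmod_hom R N L"
        using p by blast
      have "restrict (\<lambda>x. ?F (f, g) (x, \<zero>\<^bsub>N\<^esub>)) (carrier M) = f"
        using lmod_hom_extensional[OF p(2)]
        by (auto intro!: extensionalityI[of _ "carrier M"] simp: direct_sum_simps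
            lmod_hom_zero[OF assms(3,1) p(3)] lmod_hom_closed[OF p(2)])
      moreover have "restrict (\<lambda>y. ?F (f, g) (\<zero>\<^bsub>M\<^esub>, y)) (carrier N) = g"
        using lmod_hom_extensional[OF p(3)]
        by (auto intro!: extensionalityI[of _ "carrier N"] simp: direct_sum_simps
            lmod_hom_zero[OF assms(2,1) p(2)] lmod_hom_closed[OF p(3)])
      ultimately show ?thesis using p by simp
    qed
    show "?F (?G h) = h" if h: "h \<in> lmod_hom R ?S L" for h
    proof (rule extensionalityI[OF _ lmod_hom_extensional[OF h]])
      show "?F (?G h) \<in> extensional (carrier ?S)"
        by simp
      show "?F (?G h) x = h x" if "x \<in> carrier ?S" for x
        using that lmod_hom_direct_sum_eq[OF assms(2,3,1) h, of "fst x" "snd x"]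
        by (cases x) (simp add: direct_sum_simps)
    qed
  qed
  from bij_betw_same_card[OF this] show ?thesis
    by (simp add: card_cartesian_product)
qed

text \<open>The universal property of a kernel with inclusion \<open>f\<close>. It turns differences
  of sections, and the defect of a section, into homomorphisms to the subobject.\<close>

lemma lmod_hom_factor:
  assumes "left_module R L" "left_module R M" "left_module R N"
    and f: "f \<in> lmod_hom R M N" "inj_on f (carrier M)"
    and t: "t \<in> lmod_hom R L N" "\<And>x. x \<in> carrier L \<Longrightarrow> t x \<in> f ` carrier M"
  obtains h where "h \<in> lmod_hom R L M" "\<And>x. x \<in> carrier L \<Longrightarrow> f (h x) = t x"
proof -
  interpret L: left_module R L by fact
  interpret M: left_module R M by fact
  define h where "h = restrict (\<lambda>x. inv_into (carrier M) f (t x)) (carrier L)"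
  have h: "h x \<in> carrier M" "f (h x) = t x" if "x \<in> carrier L" for x
    using t(2)[OF that] that by (simp_all add: h_def inv_into_into f_inv_into_f)
  have "h \<in> lmod_hom R L M"
  proof (rule lmod_homI)
    show "h (x \<oplus>\<^bsub>L\<^esub> y) = h x \<oplus>\<^bsub>M\<^esub> h y" if "x \<in> carrier L" "y \<in> carrier L" for x y
      using that h by (intro inj_onD[OF f(2)]) (simp_all add: lmod_hom_add[OF f(1)] lmod_hom_add[OF t(1)])
    show "h (a \<odot>\<^bsub>L\<^esub> x) = a \<odot>\<^bsub>M\<^esub> h x" if "a \<in> carrier R" "x \<in> carrier L" for a x
      using that h by (intro inj_onD[OF f(2)])
        (simp_all add: lmod_hom_smult[OF f(1)] lmod_hom_smult[OF t(1)] L.smult_closed M.smult_closed)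
  qed (use h in \<open>auto simp: h_def\<close>)
  with h show thesis using that by blast
qed

section \<open>Projective modules\<close>

context scalar_algebra
begin

lemma projective_fd: "projective_module R P \<Longrightarrow> fd_module R P"
  by (simp add: projective_module_def)

lemma projective_moduleD:
  fixes M N :: "('a, nat) module"
  assumes "projective_module R P" "fd_module R M" "fd_module R N" "g \<in> lmod_hom R M N"
    "f \<in> lmod_hom R P N" "g ` carrier M = carrier N"
  obtains h where "h \<in> lmod_hom R P M" "\<And>x. x \<in> carrier P \<Longrightarrow> g (h x) = f x"
proof -
  from assms(1) have "\<forall>(M :: ('a, nat) module) (N :: ('a, nat) module).
        fd_module R M \<longrightarrow> fd_module R N \<longrightarrow>
        (\<forall>g\<in>lmod_hom R M N. \<forall>f\<in>lmod_hom R P N. g ` carrier M = carrier N \<longrightarrow>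
           (\<exists>h\<in>lmod_hom R P M. \<forall>x\<in>carrier P. g (h x) = f x))"
    unfolding projective_module_def by (rule conjunct2)
  with assms have "\<exists>h\<in>lmod_hom R P M. \<forall>x\<in>carrier P. g (h x) = f x"
    by blast
  then show thesis using that by blast
qed

text \<open>Lifts the identity of \<open>P\<close>. As the lifting property accepts only targets on
  \<open>nat\<close>, the identity is composed with an isomorphism \<open>h\<close> onto a copy of
  \<open>P\<close>, which is cancelled afterwards.\<close>

lemma projective_section:
  fixes P :: "('a, 'm) module" and Z :: "('a, nat) module"
  assumes P: "projective_module R P" and Z: "fd_module R Z"
    and g: "g \<in> lmod_hom R Z P" "g ` carrier Z = carrier P"
  obtains s where "s \<in> lmod_hom R P Z" "\<And>x. x \<in> carrier P \<Longrightarrow> g (s x) = x"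
proof -
  note LP = fd_module_finite[OF projective_fd[OF P]] and LZ = fd_module_finite[OF Z]
  obtain P' :: "('a, nat) module" and h
    where P': "left_module R P'" "finite (carrier P')"
      and h: "h \<in> lmod_hom R P P'" "bij_betw h (carrier P) (carrier P')"
    by (rule nat_copy[OF LP])
  have "compose (carrier Z) h g ` carrier Z = h ` (g ` carrier Z)"
    by (auto simp: compose_def)
  then have "compose (carrier Z) h g ` carrier Z = carrier P'"
    using g(2) h(2) by (simp add: bij_betw_def)
  then obtain s where s: "s \<in> lmod_hom R P Z" "\<And>x. x \<in> carrier P \<Longrightarrow> compose (carrier Z) h g (s x) = h x"
    using projective_moduleD[OF P Z fd_moduleI[OF P'] lmod_hom_comp[OF g(1) h(1) LZ(1)] h(1)] by blast
  have "g (s x) = x" if x: "x \<in> carrier P" for x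
  proof -
    have "s x \<in> carrier Z"
      using s(1) x by (rule lmod_hom_closed)
    then have "h (g (s x)) = h x" "g (s x) \<in> carrier P"
      using s(2)[OF x] g(1) by (simp_all add: compose_def lmod_hom_closed)
    then show ?thesis
      using h(2) x by (auto simp: bij_betw_def dest: inj_onD)
  qed
  with s(1) show thesis using that by blast
qed

lemma projective_module_iso:
  assumes P: "projective_module R P" and k: "k \<in> lmod_hom R P P'" "bij_betw k (carrier P) (carrier P')"
    and P': "left_module R P'"
  shows "projective_module R P'"
  unfolding projective_module_def
proof (intro conjI allI impI ballI)
  note LP = fd_module_finite[OF projective_fd[OF P]]
  show "fd_module R P'"
    using LP(2) k(2) by (intro fd_moduleI[OF P']) (auto simp: bij_betw_finite)
  fix M N :: "('a, nat) module" and g f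
  assume M: "fd_module R M" and N: "fd_module R N" and g: "g \<in> lmod_hom R M N" "g ` carrier M = carrier N"
    and f: "f \<in> lmod_hom R P' N"
  let ?k' = "restrict (inv_into (carrier P) k) (carrier P')"
  have k': "?k' \<in> lmod_hom R P' P"
    by (rule lmod_hom_inverse[OF k LP(1) P'])
  obtain h where h: "h \<in> lmod_hom R P M" "\<And>x. x \<in> carrier P \<Longrightarrow> g (h x) = compose (carrier P) f k x"
    using projective_moduleD[OF P M N g(1) lmod_hom_comp[OF k(1) f LP(1)] g(2)] by blast
  have "g (compose (carrier P') h ?k' x) = f x" if x: "x \<in> carrier P'" for x
    using h(2)[of "?k' x"] lmod_hom_closed[OF k' x] x k(2)
    by (simp add: compose_def bij_betw_def f_inv_into_f)
  then show "\<exists>h\<in>lmod_hom R P' M. \<forall>x\<in>carrier P'. g (h x) = f x"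
    using lmod_hom_comp[OF k' h(1) P'] by blast
qed

lemma fd_module_direct_sum:
  assumes "fd_module R M" "fd_module R N"
  shows "fd_module R (direct_sum M N)"
  using fd_module_finite[OF assms(1)] fd_module_finite[OF assms(2)]
  by (intro fd_moduleI left_module_direct_sum) (simp_all add: direct_sum_simps)

lemma projective_direct_sum:
  assumes P: "projective_module R P" and P': "projective_module R P'"
  shows "projective_module R (direct_sum P P')"
  unfolding projective_module_def
proof (intro conjI allI impI ballI)
  note fdP = projective_fd[OF P] and fdP' = projective_fd[OF P']
  note LP = fd_module_finite[OF fdP] and LP' = fd_module_finite[OF fdP']
  let ?S = "direct_sum P P'"
  show "fd_module R ?S"
    using fdP fdP' by (rule fd_module_direct_sum)
  fix M N :: "('a, nat) module" and g f
  assume M: "fd_module R M" and N: "fd_module R N" and g: "g \<in> lmod_hom R M N" "g ` carrier M = carrier N"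
    and f: "f \<in> lmod_hom R ?S N"
  note LM = fd_module_finite(1)[OF M] and LN = fd_module_finite(1)[OF N]
  interpret P: left_module R P by (rule LP)
  interpret P': left_module R P' by (rule LP')
  note i = direct_sum_homs(3)[OF LP(1) LP'(1)] and i' = direct_sum_homs(4)[OF LP(1) LP'(1)]
  obtain h where h: "h \<in> lmod_hom R P M"
    "\<And>x. x \<in> carrier P \<Longrightarrow> g (h x) = compose (carrier P) f (restrict (\<lambda>x. (x, \<zero>\<^bsub>P'\<^esub>)) (carrier P)) x"
    using projective_moduleD[OF P M N g(1) lmod_hom_comp[OF i f LP(1)] g(2)] by blast
  obtain h' where h': "h' \<in> lmod_hom R P' M"
    "\<And>x. x \<in> carrier P' \<Longrightarrow> g (h' x) = compose (carrier P') f (restrict (\<lambda>x. (\<zero>\<^bsub>P\<^esub>, x)) (carrier P')) x"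
    using projective_moduleD[OF P' M N g(1) lmod_hom_comp[OF i' f LP'(1)] g(2)] by blast
  let ?h = "restrict (\<lambda>(x, y). h x \<oplus>\<^bsub>M\<^esub> h' y) (carrier ?S)"
  have "?h \<in> lmod_hom R ?S M"
    by (rule lmod_hom_copair[OF LP(1) LP'(1) LM h(1) h'(1)])
  moreover have "g (?h p) = f p" if p: "p \<in> carrier ?S" for p
  proof -
    obtain x y where "p = (x, y)" "x \<in> carrier P" "y \<in> carrier P'"
      using p by (auto simp: direct_sum_simps)
    then show ?thesis
      using h(2)[of x] h'(2)[of y] lmod_hom_direct_sum_eq[OF LP(1) LP'(1) LN f, of x y]
      by (simp add: direct_sum_simps compose_def lmod_hom_add[OF g(1)] lmod_hom_closed[OF h(1)]
          lmod_hom_closed[OF h'(1)])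
  qed
  ultimately show "\<exists>h\<in>lmod_hom R ?S M. \<forall>x\<in>carrier ?S. g (h x) = f x"
    by blast
qed

end

section \<open>Complexes and their isomorphisms\<close>

text \<open>\<open>C1_objects\<close> is confined to carriers in \<open>nat\<close>, whereas
  extensions and \<open>K_complex P\<close> have carriers of product type; this is the same notion
  over any carrier type.\<close>

definition projective_complex ::
  "('k::{field,finite}, 'a) module \<Rightarrow> ('a, 'm) cyclic_complex \<Rightarrow> bool" where
  "projective_complex R X \<longleftrightarrow> is_cyclic_complex R X \<and> projective_module R (fst X)"

lemma C1_objects_iff: "X \<in> C1_objects R \<longleftrightarrow> projective_complex R X"
  by (simp add: C1_objects_def projective_complex_def)

context scalar_algebra
begin

lemma projective_complexD:
  assumes "projective_complex R X"
  shows "left_module R (fst X)" "finite (carrier (fst X))" "projective_module R (fst X)"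
    "snd X \<in> lmod_hom R (fst X) (fst X)" "\<And>x. x \<in> carrier (fst X) \<Longrightarrow> snd X (snd X x) = \<zero>\<^bsub>fst X\<^esub>"
  using assms fd_module_finite by (auto simp: projective_complex_def is_cyclic_complex_def)

lemma projective_complexI:
  assumes "projective_module R M" "d \<in> lmod_hom R M M" "\<And>x. x \<in> carrier M \<Longrightarrow> d (d x) = \<zero>\<^bsub>M\<^esub>"
  shows "projective_complex R (M, d)"
  using assms projective_fd by (simp add: projective_complex_def is_cyclic_complex_def)

lemma C1_isosD:
  assumes "f \<in> C1_isos R X Y"
  shows "f \<in> lmod_hom R (fst X) (fst Y)" "bij_betw f (carrier (fst X)) (carrier (fst Y))"
    "\<And>x. x \<in> carrier (fst X) \<Longrightarrow> f (snd X x) = snd Y (f x)"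
  using assms by (auto simp: C1_isos_def C1_hom_def)

lemma C1_isosI:
  assumes "f \<in> lmod_hom R (fst X) (fst Y)" "bij_betw f (carrier (fst X)) (carrier (fst Y))"
    "\<And>x. x \<in> carrier (fst X) \<Longrightarrow> f (snd X x) = snd Y (f x)"
  shows "f \<in> C1_isos R X Y"
  using assms by (auto simp: C1_isos_def C1_hom_def)

lemma C1_isos_id:
  assumes X: "projective_complex R X"
  shows "restrict (\<lambda>x. x) (carrier (fst X)) \<in> C1_isos R X X"
  using lmod_hom_closed[OF projective_complexD(4)[OF X]]
  by (intro C1_isosI lmod_hom_id[OF projective_complexD(1)[OF X]]) (auto simp: bij_betw_def inj_on_def)

lemma C1_isos_comp:
  assumes "projective_complex R X" and f: "f \<in> C1_isos R X Y" and g: "g \<in> C1_isos R Y Z"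
  shows "compose (carrier (fst X)) g f \<in> C1_isos R X Z"
proof (rule C1_isosI)
  note X = projective_complexD[OF assms(1)]
  show "compose (carrier (fst X)) g f \<in> lmod_hom R (fst X) (fst Z)"
    by (rule lmod_hom_comp[OF C1_isosD(1)[OF f] C1_isosD(1)[OF g] X(1)])
  show "bij_betw (compose (carrier (fst X)) g f) (carrier (fst X)) (carrier (fst Z))"
    by (rule bij_betw_compose[OF C1_isosD(2)[OF f] C1_isosD(2)[OF g]])
  show "compose (carrier (fst X)) g f (snd X x) = snd Z (compose (carrier (fst X)) g f x)"
    if "x \<in> carrier (fst X)" for x
    using that lmod_hom_closed[OF X(4) that] lmod_hom_closed[OF C1_isosD(1)[OF f] that]
    by (simp add: compose_def C1_isosD(3)[OF f] C1_isosD(3)[OF g])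
qed

lemma C1_isos_inverse:
  assumes "projective_complex R X" "projective_complex R Y" and f: "f \<in> C1_isos R X Y"
  shows "restrict (inv_into (carrier (fst X)) f) (carrier (fst Y)) \<in> C1_isos R Y X"
    (is "?g \<in> _")
proof (rule C1_isosI)
  note X = projective_complexD[OF assms(1)] and Y = projective_complexD[OF assms(2)]
    and f = C1_isosD[OF f]
  show g: "?g \<in> lmod_hom R (fst Y) (fst X)"
    by (rule lmod_hom_inverse[OF f(1,2) X(1) Y(1)])
  show "bij_betw ?g (carrier (fst Y)) (carrier (fst X))"
    using bij_betw_inv_into[OF f(2)] by (rule bij_betw_cong[THEN iffD1, rotated]) simp
  show "?g (snd Y y) = snd X (?g y)" if y: "y \<in> carrier (fst Y)" for y
  proof -
    have gy: "?g y \<in> carrier (fst X)" "f (?g y) = y"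
      using lmod_hom_closed[OF g y] f(2) y by (simp_all add: bij_betw_def f_inv_into_f)
    have "?g (f (snd X (?g y))) = snd X (?g y)"
      using lmod_hom_closed[OF X(4) gy(1)] f(1,2) by (simp add: bij_betw_def inv_into_f_f lmod_hom_closed)
    then show ?thesis
      by (simp only: f(3)[OF gy(1)] gy(2))
  qed
qed

lemma finite_C1_isos:
  assumes "projective_complex R X" "projective_complex R Y"
  shows "finite (C1_isos R X Y)"
  using finite_lmod_hom[OF projective_complexD(2)[OF assms(1)] projective_complexD(2)[OF assms(2)]]
  by (rule rev_finite_subset) (auto simp: C1_isos_def C1_hom_def)

lemma C1_isos_sym:
  assumes "projective_complex R X" "projective_complex R Y" "C1_isos R X Y \<noteq> {}"
  shows "C1_isos R Y X \<noteq> {}"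
  using C1_isos_inverse[OF assms(1,2)] assms(3) by blast

lemma C1_isos_trans:
  assumes "projective_complex R X" "C1_isos R X Y \<noteq> {}" "C1_isos R Y Z \<noteq> {}"
  shows "C1_isos R X Z \<noteq> {}"
  using C1_isos_comp[OF assms(1)] assms(2,3) by blast

lemma card_C1_isos_le:
  assumes X: "projective_complex R X" and X': "projective_complex R X'" and Z: "projective_complex R Z"
    and "C1_isos R X' X \<noteq> {}"
  shows "card (C1_isos R X Z) \<le> card (C1_isos R X' Z)"
proof -
  obtain h where h: "h \<in> C1_isos R X' X"
    using assms(4) by blast
  show ?thesis
  proof (rule card_inj_on_le)
    show "inj_on (\<lambda>f. compose (carrier (fst X')) f h) (C1_isos R X Z)"
    proof (rule inj_onI)
      fix f f' assume f: "f \<in> C1_isos R X Z" and f': "f' \<in> C1_isos R X Z"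
        and eq: "compose (carrier (fst X')) f h = compose (carrier (fst X')) f' h"
      show "f = f'"
      proof (rule lmod_hom_eqI[OF C1_isosD(1)[OF f] C1_isosD(1)[OF f']])
        fix x assume "x \<in> carrier (fst X)"
        then obtain y where y: "y \<in> carrier (fst X')" "x = h y"
          using C1_isosD(2)[OF h] by (auto simp: bij_betw_def)
        show "f x = f' x"
          using fun_cong[OF eq, of y] y by (simp add: compose_def)
      qed
    qed
    show "(\<lambda>f. compose (carrier (fst X')) f h) ` C1_isos R X Z \<subseteq> C1_isos R X' Z"
      using C1_isos_comp[OF X' h] by blast
    show "finite (C1_isos R X' Z)"
      by (rule finite_C1_isos[OF X' Z])
  qed
qed

lemma card_C1_isos_cong:
  assumes "projective_complex R X" "projective_complex R X'" "projective_complex R Z"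
    and "C1_isos R X X' \<noteq> {}"
  shows "card (C1_isos R X Z) = card (C1_isos R X' Z)"
  using card_C1_isos_le[OF assms(1,2,3)] card_C1_isos_le[OF assms(2,1,3)] assms C1_isos_sym
  by (meson le_antisym)

section \<open>Isomorphism classes\<close>

lemma isoclass_cong:
  assumes "projective_complex R X" "projective_complex R Y" "C1_isos R X Y \<noteq> {}"
  shows "isoclass R X = isoclass R Y"
  unfolding isoclass_def
  using C1_isos_trans[OF assms(1,3)] C1_isos_trans[OF assms(2) C1_isos_sym[OF assms]]
  by blast

text \<open>Uses a copy on \<open>nat\<close>. Otherwise the class of a complex over another type
  could be empty, and its basis vector would not belong to the Hall algebra.\<close>

lemma isoclass_nonempty:
  fixes X :: "('a, 'm) cyclic_complex"
  assumes "projective_complex R X"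
  shows "\<exists>Y\<in>C1_objects R. C1_isos R X Y \<noteq> {}"
proof -
  note X = projective_complexD[OF assms]
  obtain M' :: "('a, nat) module" and h
    where M': "left_module R M'" "finite (carrier M')"
      and h: "h \<in> lmod_hom R (fst X) M'" "bij_betw h (carrier (fst X)) (carrier M')"
    by (rule nat_copy[OF X(1,2)])
  let ?h' = "restrict (inv_into (carrier (fst X)) h) (carrier M')"
  have h': "?h' \<in> lmod_hom R M' (fst X)"
    by (rule lmod_hom_inverse[OF h X(1) M'(1)])
  have h'h: "?h' (h x) = x" if "x \<in> carrier (fst X)" for x
    using that h lmod_hom_closed[OF h(1)] by (simp add: bij_betw_def inv_into_f_f)
  define d where "d = compose (carrier M') (compose (carrier (fst X)) h (snd X)) ?h'"
  have d: "d \<in> lmod_hom R M' M'"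
    unfolding d_def by (rule lmod_hom_comp[OF h' lmod_hom_comp[OF X(4) h(1) X(1)] M'(1)])
  have dh: "d (h x) = h (snd X x)" if "x \<in> carrier (fst X)" for x
    using that h'h[OF that] lmod_hom_closed[OF h(1) that] by (simp add: d_def compose_def)
  have "d (d y) = \<zero>\<^bsub>M'\<^esub>" if "y \<in> carrier M'" for y
  proof -
    have "y \<in> h ` carrier (fst X)"
      using that h(2) by (simp add: bij_betw_def)
    then obtain x where x: "x \<in> carrier (fst X)" "y = h x"
      by (rule imageE)
    then have "d (d y) = h (snd X (snd X x))"
      using lmod_hom_closed[OF X(4) x(1)] by (simp add: dh)
    then show ?thesis
      using x(1) by (simp add: X(5) lmod_hom_zero[OF X(1) M'(1) h(1)])
  qed
  with d have "projective_complex R (M', d)"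
    by (intro projective_complexI projective_module_iso[OF X(3) h M'(1)])
  moreover have "h \<in> C1_isos R X (M', d)"
    using h by (intro C1_isosI) (simp_all add: dh)
  ultimately show ?thesis
    by (auto simp: C1_objects_iff)
qed

lemma isoclass_in_isoclasses:
  assumes "projective_complex R X"
  shows "isoclass R X \<in> isoclasses R"
proof -
  obtain Y where "Y \<in> C1_objects R" "C1_isos R X Y \<noteq> {}"
    using isoclass_nonempty[OF assms] by blast
  then show ?thesis
    using isoclass_cong[OF assms, of Y] by (auto simp: isoclasses_def C1_objects_iff)
qed

lemma isoclass_representative:
  assumes "\<gamma> \<in> isoclasses R"
  shows "projective_complex R (SOME Z. Z \<in> \<gamma>)" "(SOME Z. Z \<in> \<gamma>) \<in> \<gamma>" "isoclass R (SOME Z. Z \<in> \<gamma>) = \<gamma>"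
proof -
  obtain X :: "('a, nat) cyclic_complex" where X: "projective_complex R X" "\<gamma> = isoclass R X"
    using assms by (auto simp: isoclasses_def C1_objects_iff)
  then have "X \<in> \<gamma>"
    using C1_isos_id[OF X(1)] by (auto simp: isoclass_def C1_objects_iff)
  then show *: "(SOME Z. Z \<in> \<gamma>) \<in> \<gamma>"
    by (rule someI)
  then show **: "projective_complex R (SOME Z. Z \<in> \<gamma>)"
    using X(2) by (simp add: isoclass_def C1_objects_iff)
  show "isoclass R (SOME Z. Z \<in> \<gamma>) = \<gamma>"
    using * isoclass_cong[OF X(1) **] unfolding X(2) isoclass_def[of R X] by blast
qed

text \<open>Structure constants are evaluated at representatives chosen by \<open>SOME\<close>; this
  translates counts at such a representative into equality of classes.\<close>

lemma C1_isos_representative_iff: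
  assumes "projective_complex R X" "\<gamma> \<in> isoclasses R"
  shows "C1_isos R X (SOME Z. Z \<in> \<gamma>) \<noteq> {} \<longleftrightarrow> \<gamma> = isoclass R X"
proof
  note g = isoclass_representative[OF assms(2)]
  show "C1_isos R X (SOME Z. Z \<in> \<gamma>) \<noteq> {} \<Longrightarrow> \<gamma> = isoclass R X"
    using isoclass_cong[OF assms(1) g(1)] g(3) by simp
  show "\<gamma> = isoclass R X \<Longrightarrow> C1_isos R X (SOME Z. Z \<in> \<gamma>) \<noteq> {}"
    using g(2) by (simp add: isoclass_def)
qed

end

section \<open>Extensions of complexes\<close>

text \<open>The condition under which the block matrix with diagonal \<open>snd Y\<close>,
  \<open>snd X\<close> and upper right entry \<open>g\<close> squares to zero.\<close>

definition cocycles ::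
  "('k, 'a) module \<Rightarrow> ('a, 'm) cyclic_complex \<Rightarrow> ('a, 'n) cyclic_complex \<Rightarrow> ('m \<Rightarrow> 'n) set" where
  "cocycles R X Y =
     {g \<in> lmod_hom R (fst X) (fst Y).
        \<forall>x\<in>carrier (fst X). snd Y (g x) \<oplus>\<^bsub>fst Y\<^esub> g (snd X x) = \<zero>\<^bsub>fst Y\<^esub>}"

text \<open>The subobject \<open>Y\<close> is the first summand and the quotient \<open>X\<close>
  the second, so these are the middle terms for the product of the class of \<open>X\<close> with
  that of \<open>Y\<close>, in this order.\<close>

definition ext_complex ::
  "('a, 'm) cyclic_complex \<Rightarrow> ('a, 'n) cyclic_complex \<Rightarrow> ('m \<Rightarrow> 'n) \<Rightarrow> ('a, 'n \<times> 'm) cyclic_complex" where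
  "ext_complex X Y g =
     (direct_sum (fst Y) (fst X),
      restrict (\<lambda>(y, x). (snd Y y \<oplus>\<^bsub>fst Y\<^esub> g x, snd X x)) (carrier (direct_sum (fst Y) (fst X))))"

lemma fst_ext_complex: "fst (ext_complex X Y g) = direct_sum (fst Y) (fst X)"
  by (simp add: ext_complex_def)

lemma snd_ext_complex:
  "\<lbrakk>y \<in> carrier (fst Y); x \<in> carrier (fst X)\<rbrakk>
    \<Longrightarrow> snd (ext_complex X Y g) (y, x) = (snd Y y \<oplus>\<^bsub>fst Y\<^esub> g x, snd X x)"
  by (simp add: ext_complex_def direct_sum_simps)

lemmas ext_complex_simps = fst_ext_complex snd_ext_complex direct_sum_simps

context scalar_algebra
begin

lemma cocyclesD:
  assumes "g \<in> cocycles R X Y"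
  shows "g \<in> lmod_hom R (fst X) (fst Y)"
    "\<And>x. x \<in> carrier (fst X) \<Longrightarrow> snd Y (g x) \<oplus>\<^bsub>fst Y\<^esub> g (snd X x) = \<zero>\<^bsub>fst Y\<^esub>"
  using assms by (auto simp: cocycles_def)

lemma projective_complex_ext:
  assumes X: "projective_complex R X" and Y: "projective_complex R Y" and g: "g \<in> cocycles R X Y"
  shows "projective_complex R (ext_complex X Y g)"
  unfolding ext_complex_def
proof (rule projective_complexI)
  note X = projective_complexD[OF X] and Y = projective_complexD[OF Y] and g = cocyclesD[OF g]
  interpret X: left_module R "fst X" by (rule X)
  interpret Y: left_module R "fst Y" by (rule Y)
  show "projective_module R (direct_sum (fst Y) (fst X))"
    by (rule projective_direct_sum[OF Y(3) X(3)])
  let ?S = "direct_sum (fst Y) (fst X)"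
  let ?d = "restrict (\<lambda>(y, x). (snd Y y \<oplus>\<^bsub>fst Y\<^esub> g x, snd X x)) (carrier ?S)"
  note cl = lmod_hom_closed[OF X(4)] lmod_hom_closed[OF Y(4)] lmod_hom_closed[OF g(1)]
  show "?d \<in> lmod_hom R ?S ?S"
    by (rule lmod_homI)
      (auto simp: direct_sum_simps cl lmod_hom_add[OF X(4)] lmod_hom_add[OF Y(4)] lmod_hom_add[OF g(1)]
        lmod_hom_smult[OF X(4)] lmod_hom_smult[OF Y(4)] lmod_hom_smult[OF g(1)]
        X.smult_closed Y.smult_closed Y.smult_r_distr Y.M.a_ac)
  show "?d (?d p) = \<zero>\<^bsub>?S\<^esub>" if "p \<in> carrier ?S" for p
    using that by (auto simp: direct_sum_simps cl lmod_hom_add[OF Y(4)] X(5) Y(5) g(2))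
qed

section \<open>Counting short exact sequences\<close>

text \<open>A complex \<open>Z\<close> with a short exact sequence \<open>0 \<rightarrow> Y \<rightarrow> Z \<rightarrow> X \<rightarrow> 0\<close> and a section of the underlying
  module homomorphism \<open>Z \<rightarrow> X\<close> is the same as an isomorphism from an \<open>ext_complex X Y g\<close> to \<open>Z\<close>.\<close>

definition split_hall_W where
  "split_hall_W X Y Z =
     (SIGMA p:hall_W R X Y Z. {s \<in> lmod_hom R (fst X) (fst Z). \<forall>x\<in>carrier (fst X). snd p (s x) = x})"

lemma hall_WD:
  assumes "(f, p) \<in> hall_W R X Y Z"
  shows "f \<in> lmod_hom R (fst Y) (fst Z)" "p \<in> lmod_hom R (fst Z) (fst X)"
    "\<And>y. y \<in> carrier (fst Y) \<Longrightarrow> f (snd Y y) = snd Z (f y)"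
    "\<And>z. z \<in> carrier (fst Z) \<Longrightarrow> p (snd Z z) = snd X (p z)"
    "inj_on f (carrier (fst Y))" "p ` carrier (fst Z) = carrier (fst X)"
    "f ` carrier (fst Y) = {z \<in> carrier (fst Z). p z = \<zero>\<^bsub>fst X\<^esub>}"
    "\<And>y. y \<in> carrier (fst Y) \<Longrightarrow> p (f y) = \<zero>\<^bsub>fst X\<^esub>"
  using assms by (auto simp: hall_W_def C1_hom_def)

lemma finite_hall_W:
  assumes "projective_complex R X" "projective_complex R Y" "projective_complex R Z"
  shows "finite (hall_W R X Y Z)"
proof (rule finite_subset)
  show "hall_W R X Y Z \<subseteq> lmod_hom R (fst Y) (fst Z) \<times> lmod_hom R (fst Z) (fst X)"
    by (auto simp: hall_W_def C1_hom_def)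
qed (use assms in \<open>auto intro!: finite_lmod_hom dest: projective_complexD(2)\<close>)

text \<open>A section \<open>s0\<close> exists because \<open>X\<close> has a projective underlying
  module. Any other section differs from it by a map into the kernel of \<open>p\<close>, that is,
  by \<open>f h\<close> for a unique \<open>h\<close>.\<close>

lemma card_sections:
  fixes Z :: "('a, nat) cyclic_complex"
  assumes X: "projective_complex R X" and Y: "projective_complex R Y" and Z: "projective_complex R Z"
    and W: "(f, p) \<in> hall_W R X Y Z"
  shows "card {s \<in> lmod_hom R (fst X) (fst Z). \<forall>x\<in>carrier (fst X). p (s x) = x}
    = card (lmod_hom R (fst X) (fst Y))"
proof -
  note X = projective_complexD[OF X] and Y = projective_complexD[OF Y] and Z' = projective_complexD[OF Z]
    and W = hall_WD[OF W]
  interpret X: left_module R "fst X" by (rule X)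
  interpret Y: left_module R "fst Y" by (rule Y)
  interpret Z: left_module R "fst Z" by (rule Z')
  have "fd_module R (fst Z)"
    using Z by (simp add: projective_complex_def is_cyclic_complex_def)
  then obtain s0 where s0: "s0 \<in> lmod_hom R (fst X) (fst Z)" "\<And>x. x \<in> carrier (fst X) \<Longrightarrow> p (s0 x) = x"
    using projective_section[OF X(3) _ W(2,6)] by blast
  let ?A = "\<lambda>h. restrict (\<lambda>x. s0 x \<oplus>\<^bsub>fst Z\<^esub> f (h x)) (carrier (fst X))"
  let ?S = "{s \<in> lmod_hom R (fst X) (fst Z). \<forall>x\<in>carrier (fst X). p (s x) = x}"
  have "bij_betw ?A (lmod_hom R (fst X) (fst Y)) ?S"
    unfolding bij_betw_def
  proof (intro conjI inj_onI equalityI subsetI)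
    fix h h' assume h: "h \<in> lmod_hom R (fst X) (fst Y)" and h': "h' \<in> lmod_hom R (fst X) (fst Y)"
      and eq: "?A h = ?A h'"
    show "h = h'"
    proof (rule lmod_hom_eqI[OF h h'])
      fix x assume x: "x \<in> carrier (fst X)"
      then have "f (h x) = f (h' x)"
        using fun_cong[OF eq, of x] by (simp add: lmod_hom_closed[OF s0(1)] lmod_hom_closed[OF W(1)]
            lmod_hom_closed[OF h] lmod_hom_closed[OF h'])
      then show "h x = h' x"
        using W(5) lmod_hom_closed[OF h x] lmod_hom_closed[OF h' x] by (auto dest: inj_onD)
    qed
  next
    fix s assume "s \<in> ?A ` lmod_hom R (fst X) (fst Y)"
    then obtain h where h: "h \<in> lmod_hom R (fst X) (fst Y)" "s = ?A h"
      by blast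
    note cl = lmod_hom_closed[OF s0(1)] lmod_hom_closed[OF W(1)] lmod_hom_closed[OF h(1)]
    have "?A h \<in> lmod_hom R (fst X) (fst Z)"
      by (rule lmod_homI) (simp_all add: cl lmod_hom_add[OF s0(1)] lmod_hom_add[OF W(1)]
          lmod_hom_add[OF h(1)] lmod_hom_smult[OF s0(1)] lmod_hom_smult[OF W(1)]
          lmod_hom_smult[OF h(1)] X.smult_closed Z.smult_r_distr Z.M.a_ac)
    moreover have "p (?A h x) = x" if "x \<in> carrier (fst X)" for x
      using that by (simp add: cl lmod_hom_add[OF W(2)] s0(2) W(8))
    ultimately show "s \<in> ?S"
      using h(2) by blast
  next
    fix s assume "s \<in> ?S"
    then have s: "s \<in> lmod_hom R (fst X) (fst Z)" "\<And>x. x \<in> carrier (fst X) \<Longrightarrow> p (s x) = x"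
      by blast+
    note cl = lmod_hom_closed[OF s0(1)] lmod_hom_closed[OF s(1)]
    let ?t = "restrict (\<lambda>x. s x \<ominus>\<^bsub>fst Z\<^esub> s0 x) (carrier (fst X))"
    have "?t \<in> lmod_hom R (fst X) (fst Z)"
      by (rule lmod_homI) (simp_all add: cl lmod_hom_add[OF s0(1)] lmod_hom_add[OF s(1)]
          lmod_hom_smult[OF s0(1)] lmod_hom_smult[OF s(1)] X.smult_closed Z.smult_r_distr Z.smult_uminus
          a_minus_def Z.M.a_ac Z.M.minus_add)
    moreover have "?t x \<in> f ` carrier (fst Y)" if "x \<in> carrier (fst X)" for x
      unfolding W(7) using that
      by (simp add: cl a_minus_def lmod_hom_add[OF W(2)] lmod_hom_uminus[OF Z'(1) X(1) W(2)] s s0 X.M.r_neg)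
    ultimately obtain h where h: "h \<in> lmod_hom R (fst X) (fst Y)" "\<And>x. x \<in> carrier (fst X) \<Longrightarrow> f (h x) = ?t x"
      using lmod_hom_factor[OF X(1) Y(1) Z'(1) W(1,5)] by blast
    have "s = ?A h"
    proof (rule extensionalityI[OF lmod_hom_extensional[OF s(1)]])
      show "s x = ?A h x" if "x \<in> carrier (fst X)" for x
        using that h(2)[OF that] cl[OF that] Z.M.a_lcomm[of "s0 x" "s x" "\<ominus>\<^bsub>fst Z\<^esub> s0 x"]
        by (simp add: a_minus_def Z.M.r_neg)
    qed simp
    then show "s \<in> ?A ` lmod_hom R (fst X) (fst Y)"
      using h(1) by blast
  qed
  then show ?thesis
    by (simp add: bij_betw_same_card)
qed

lemma ext_iso_split:
  assumes X: "projective_complex R X" and Y: "projective_complex R Y" and Z: "projective_complex R Z"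
    and g: "g \<in> cocycles R X Y" and t: "t \<in> C1_isos R (ext_complex X Y g) Z"
  shows "((restrict (\<lambda>y. t (y, \<zero>\<^bsub>fst X\<^esub>)) (carrier (fst Y)),
      restrict (\<lambda>z. snd (inv_into (carrier (direct_sum (fst Y) (fst X))) t z)) (carrier (fst Z))),
      restrict (\<lambda>x. t (\<zero>\<^bsub>fst Y\<^esub>, x)) (carrier (fst X))) \<in> split_hall_W X Y Z"
    (is "((?f, ?p), ?s) \<in> _")
proof -
  let ?S = "direct_sum (fst Y) (fst X)"
  note E = projective_complex_ext[OF X Y g]
  note X = projective_complexD[OF X] and Y = projective_complexD[OF Y] and Z' = projective_complexD[OF Z]
    and g = cocyclesD[OF g]
  note ti = C1_isosD[OF C1_isos_inverse[OF E Z t], unfolded fst_ext_complex]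
  note t = C1_isosD[OF t, unfolded fst_ext_complex]
  note S = left_module_direct_sum[OF Y(1) X(1)]
  interpret X: left_module R "fst X" by (rule X)
  interpret Y: left_module R "fst Y" by (rule Y)
  interpret Z: left_module R "fst Z" by (rule Z')
  have f: "?f \<in> lmod_hom R (fst Y) (fst Z)"
    using lmod_hom_comp[OF direct_sum_homs(3)[OF Y(1) X(1)] t(1) Y(1)] by (simp add: compose_def cong: restrict_cong)
  have s: "?s \<in> lmod_hom R (fst X) (fst Z)"
    using lmod_hom_comp[OF direct_sum_homs(4)[OF Y(1) X(1)] t(1) X(1)] by (simp add: compose_def cong: restrict_cong)
  have "compose (carrier (fst Z)) (restrict snd (carrier ?S)) (restrict (inv_into (carrier ?S) t) (carrier (fst Z))) = ?p"
    using lmod_hom_closed[OF ti(1)] by (auto simp: compose_def fun_eq_iff)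
  then have p: "?p \<in> lmod_hom R (fst Z) (fst X)"
    using lmod_hom_comp[OF ti(1) direct_sum_homs(2)[OF Y(1) X(1)] Z'(1)] by simp
  have cl: "t (y, x) \<in> carrier (fst Z)" if "y \<in> carrier (fst Y)" "x \<in> carrier (fst X)" for x y
    using that by (intro lmod_hom_closed[OF t(1)]) (simp add: direct_sum_simps)
  have pt: "?p (t (y, x)) = x" if "y \<in> carrier (fst Y)" "x \<in> carrier (fst X)" for x y
    using that cl[OF that] t(2) by (simp add: bij_betw_def inv_into_f_f direct_sum_simps)
  have ex: "\<exists>y\<in>carrier (fst Y). \<exists>x\<in>carrier (fst X). z = t (y, x)" if "z \<in> carrier (fst Z)" for z
    using that bij_betw_imp_surj_on[OF t(2)] unfolding direct_sum_simps by blast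
  have d: "snd Z (t (y, x)) = t (snd Y y \<oplus>\<^bsub>fst Y\<^esub> g x, snd X x)"
    if "y \<in> carrier (fst Y)" "x \<in> carrier (fst X)" for x y
    using t(3)[of "(y, x)"] that by (simp add: ext_complex_simps)
  have inj: "inj_on ?f (carrier (fst Y))"
  proof (rule inj_onI)
    fix y y' assume y: "y \<in> carrier (fst Y)" "y' \<in> carrier (fst Y)" and "?f y = ?f y'"
    then have "t (y, \<zero>\<^bsub>fst X\<^esub>) = t (y', \<zero>\<^bsub>fst X\<^esub>)"
      by simp
    then have "(y, \<zero>\<^bsub>fst X\<^esub>) = (y', \<zero>\<^bsub>fst X\<^esub>)"
      by (rule inj_onD[OF bij_betw_imp_inj_on[OF t(2)]]) (simp_all add: y direct_sum_simps)
    then show "y = y'" by simp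
  qed
  have img: "?p ` carrier (fst Z) = carrier (fst X)"
  proof (intro equalityI subsetI)
    fix x assume "x \<in> carrier (fst X)"
    then have "x = ?p (t (\<zero>\<^bsub>fst Y\<^esub>, x))" "t (\<zero>\<^bsub>fst Y\<^esub>, x) \<in> carrier (fst Z)"
      by (simp_all only: pt cl Y.M.zero_closed)
    then show "x \<in> ?p ` carrier (fst Z)" by (rule image_eqI)
  qed (use lmod_hom_closed[OF p] in blast)
  have ker: "?f ` carrier (fst Y) = {z \<in> carrier (fst Z). ?p z = \<zero>\<^bsub>fst X\<^esub>}"
  proof (intro equalityI subsetI)
    fix z assume "z \<in> ?f ` carrier (fst Y)"
    then obtain y where "y \<in> carrier (fst Y)" "z = t (y, \<zero>\<^bsub>fst X\<^esub>)"
      by auto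
    then show "z \<in> {z \<in> carrier (fst Z). ?p z = \<zero>\<^bsub>fst X\<^esub>}"
      using cl pt by blast
  next
    fix z assume z: "z \<in> {z \<in> carrier (fst Z). ?p z = \<zero>\<^bsub>fst X\<^esub>}"
    then obtain y x where yx: "y \<in> carrier (fst Y)" "x \<in> carrier (fst X)" "z = t (y, x)"
      using ex by blast
    have "?p z = x"
      by (simp only: yx(3) pt[OF yx(1,2)])
    moreover have "?p z = \<zero>\<^bsub>fst X\<^esub>"
      using z by blast
    ultimately have "x = \<zero>\<^bsub>fst X\<^esub>"
      by (rule subst)
    then have "z = ?f y"
      using yx by simp
    then show "z \<in> ?f ` carrier (fst Y)"
      using yx(1) by blast
  qed
  have fd: "?f (snd Y y) = snd Z (?f y)" if y: "y \<in> carrier (fst Y)" for y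
    using d[OF y X.M.zero_closed] lmod_hom_closed[OF Y(4) y] y
    by (simp add: lmod_hom_zero[OF X(1) Y(1) g(1)] lmod_hom_zero[OF X(1) X(1) X(4)])
  have pd: "?p (snd Z z) = snd X (?p z)" if z: "z \<in> carrier (fst Z)" for z
  proof -
    obtain y x where yx: "y \<in> carrier (fst Y)" "x \<in> carrier (fst X)" "z = t (y, x)"
      using ex[OF z] by blast
    have "?p (snd Z z) = ?p (t (snd Y y \<oplus>\<^bsub>fst Y\<^esub> g x, snd X x))"
      by (simp only: yx(3) d[OF yx(1,2)])
    also have "\<dots> = snd X x"
      using yx by (intro pt Y.M.a_closed lmod_hom_closed[OF Y(4)] lmod_hom_closed[OF X(4)] lmod_hom_closed[OF g(1)])
    also have "\<dots> = snd X (?p z)"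
      by (simp only: yx(3) pt[OF yx(1,2)])
    finally show ?thesis .
  qed
  have "\<forall>x\<in>carrier (fst X). ?p (?s x) = x"
    using pt[OF Y.M.zero_closed] by simp
  moreover have "(?f, ?p) \<in> hall_W R X Y Z"
    using f p fd pd inj img ker unfolding hall_W_def C1_hom_def by blast
  ultimately show ?thesis
    using s unfolding split_hall_W_def by (intro SigmaI) (simp_all only: mem_Collect_eq snd_conv simp_thms)
qed

text \<open>Converse of \<open>ext_iso_split\<close>. Exactness and the section make
  \<open>(y, x)\<close> correspond to \<open>f y + s x\<close>, and the differential of
  \<open>Z\<close> becomes triangular in these coordinates.\<close>

lemma split_ext_iso:
  assumes X: "projective_complex R X" and Y: "projective_complex R Y" and Z: "projective_complex R Z"
    and "((f, p), s) \<in> split_hall_W X Y Z"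
  obtains g t where "g \<in> cocycles R X Y" "t \<in> C1_isos R (ext_complex X Y g) Z"
    "\<And>y x. \<lbrakk>y \<in> carrier (fst Y); x \<in> carrier (fst X)\<rbrakk> \<Longrightarrow> t (y, x) = f y \<oplus>\<^bsub>fst Z\<^esub> s x"
proof -
  let ?S = "direct_sum (fst Y) (fst X)"
  note X = projective_complexD[OF X] and Y = projective_complexD[OF Y] and Z' = projective_complexD[OF Z]
  interpret X: left_module R "fst X" by (rule X)
  interpret Y: left_module R "fst Y" by (rule Y)
  interpret Z: left_module R "fst Z" by (rule Z')
  have W: "(f, p) \<in> hall_W R X Y Z" and s: "s \<in> lmod_hom R (fst X) (fst Z)"
    and ps: "\<And>x. x \<in> carrier (fst X) \<Longrightarrow> p (s x) = x"
    using assms(4) by (auto simp: split_hall_W_def)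
  note W = hall_WD[OF W]
  note cl = lmod_hom_closed[OF X(4)] lmod_hom_closed[OF Y(4)] lmod_hom_closed[OF Z'(4)]
    lmod_hom_closed[OF W(1)] lmod_hom_closed[OF W(2)] lmod_hom_closed[OF s]
  \<comment> \<open>The defect of the section against the differentials. Since \<open>p\<close>
    commutes with them and \<open>p s\<close> is the identity, the defect lies in the kernel of
    \<open>p\<close>, so it is \<open>f g\<close>.\<close>
  let ?u = "restrict (\<lambda>x. snd Z (s x) \<ominus>\<^bsub>fst Z\<^esub> s (snd X x)) (carrier (fst X))"
  have "?u \<in> lmod_hom R (fst X) (fst Z)"
    by (rule lmod_homI) (simp_all add: cl lmod_hom_add[OF s] lmod_hom_add[OF X(4)] lmod_hom_add[OF Z'(4)]
        lmod_hom_smult[OF s] lmod_hom_smult[OF X(4)] lmod_hom_smult[OF Z'(4)]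
        X.smult_closed Z.smult_r_distr Z.smult_uminus a_minus_def Z.M.a_ac Z.M.minus_add)
  moreover have "?u x \<in> f ` carrier (fst Y)" if "x \<in> carrier (fst X)" for x
    unfolding W(7) using that
    by (simp add: cl a_minus_def lmod_hom_add[OF W(2)] lmod_hom_uminus[OF Z'(1) X(1) W(2)] W(4) ps X.M.r_neg)
  ultimately obtain g where g: "g \<in> lmod_hom R (fst X) (fst Y)"
    "\<And>x. x \<in> carrier (fst X) \<Longrightarrow> f (g x) = ?u x"
    using lmod_hom_factor[OF X(1) Y(1) Z'(1) W(1,5)] by blast
  note cl = cl lmod_hom_closed[OF g(1)]
  have ds: "snd Z (s x) = f (g x) \<oplus>\<^bsub>fst Z\<^esub> s (snd X x)" if "x \<in> carrier (fst X)" for x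
    using that g(2)[OF that] by (simp add: cl a_minus_def Z.M.a_assoc Z.M.l_neg)
  have coc: "g \<in> cocycles R X Y"
    unfolding cocycles_def
  proof (intro CollectI conjI ballI g(1))
    \<comment> \<open>The cocycle condition is \<open>d (d (s x)) = 0\<close> in \<open>Z\<close>,
      expanded by \<open>ds\<close> and pulled back along the injective \<open>f\<close>.\<close>
    fix x assume x: "x \<in> carrier (fst X)"
    have "\<zero>\<^bsub>fst Z\<^esub> = snd Z (snd Z (s x))"
      using x by (simp add: cl Z'(5))
    also have "\<dots> = f (snd Y (g x)) \<oplus>\<^bsub>fst Z\<^esub> f (g (snd X x))"
      using x by (simp add: ds cl lmod_hom_add[OF Z'(4)] W(3) X(5) lmod_hom_zero[OF X(1) Z'(1) s])
    also have "\<dots> = f (snd Y (g x) \<oplus>\<^bsub>fst Y\<^esub> g (snd X x))"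
      using x by (simp add: cl lmod_hom_add[OF W(1)])
    finally have "f (snd Y (g x) \<oplus>\<^bsub>fst Y\<^esub> g (snd X x)) = f \<zero>\<^bsub>fst Y\<^esub>"
      using lmod_hom_zero[OF Y(1) Z'(1) W(1)] by simp
    then show "snd Y (g x) \<oplus>\<^bsub>fst Y\<^esub> g (snd X x) = \<zero>\<^bsub>fst Y\<^esub>"
      by (rule inj_onD[OF W(5)]) (simp_all add: cl x)
  qed
  let ?t = "restrict (\<lambda>(y, x). f y \<oplus>\<^bsub>fst Z\<^esub> s x) (carrier ?S)"
  have t: "?t \<in> lmod_hom R ?S (fst Z)"
    by (rule lmod_hom_copair[OF Y(1) X(1) Z'(1) W(1) s])
  have tv: "?t (y, x) = f y \<oplus>\<^bsub>fst Z\<^esub> s x" if "y \<in> carrier (fst Y)" "x \<in> carrier (fst X)" for y x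
    using that by (simp add: direct_sum_simps)
  have pt: "p (f y \<oplus>\<^bsub>fst Z\<^esub> s x) = x" if "y \<in> carrier (fst Y)" "x \<in> carrier (fst X)" for y x
    using that by (simp add: cl lmod_hom_add[OF W(2)] W(8) ps)
  have "bij_betw ?t (carrier ?S) (carrier (fst Z))"
    unfolding bij_betw_def
  proof (intro conjI inj_onI equalityI subsetI)
    fix a b assume ab: "a \<in> carrier ?S" "b \<in> carrier ?S" and eq: "?t a = ?t b"
    obtain y x y' x' where a: "a = (y, x)" "y \<in> carrier (fst Y)" "x \<in> carrier (fst X)"
      and b: "b = (y', x')" "y' \<in> carrier (fst Y)" "x' \<in> carrier (fst X)"
      using ab by (auto simp: direct_sum_simps)
    have eq': "f y \<oplus>\<^bsub>fst Z\<^esub> s x = f y' \<oplus>\<^bsub>fst Z\<^esub> s x'"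
      using eq by (simp only: a(1) b(1) tv[OF a(2,3)] tv[OF b(2,3)])
    then have x: "x = x'"
      using pt[OF a(2,3)] pt[OF b(2,3)] by simp
    then have "f y = f y'"
      using eq' a b by (simp add: cl)
    then have "y = y'"
      using W(5) a b by (auto dest: inj_onD)
    with x show "a = b" using a b by simp
  next
    fix z assume "z \<in> ?t ` carrier ?S"
    then show "z \<in> carrier (fst Z)"
      using lmod_hom_closed[OF t] by blast
  next
    fix z assume z: "z \<in> carrier (fst Z)"
    have "z \<ominus>\<^bsub>fst Z\<^esub> s (p z) \<in> f ` carrier (fst Y)"
      unfolding W(7) using z
      by (simp add: cl a_minus_def lmod_hom_add[OF W(2)] lmod_hom_uminus[OF Z'(1) X(1) W(2)] ps X.M.r_neg)
    then obtain y where y: "y \<in> carrier (fst Y)" "f y = z \<ominus>\<^bsub>fst Z\<^esub> s (p z)"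
      by (metis imageE)
    have "?t (y, p z) = z"
      using y z by (simp only: tv[OF y(1) cl(5)[OF z]]) (simp add: cl a_minus_def Z.M.a_assoc Z.M.l_neg)
    moreover have "(y, p z) \<in> carrier ?S"
      using y z by (simp add: direct_sum_simps cl)
    ultimately show "z \<in> ?t ` carrier ?S"
      by (rule image_eqI[OF sym])
  qed
  moreover have "?t (snd (ext_complex X Y g) a) = snd Z (?t a)" if "a \<in> carrier ?S" for a
  proof -
    obtain y x where a: "a = (y, x)" "y \<in> carrier (fst Y)" "x \<in> carrier (fst X)"
      using \<open>a \<in> carrier ?S\<close> by (auto simp: direct_sum_simps)
    then have "?t (snd (ext_complex X Y g) a) = f (snd Y y \<oplus>\<^bsub>fst Y\<^esub> g x) \<oplus>\<^bsub>fst Z\<^esub> s (snd X x)"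
      by (simp add: ext_complex_simps cl)
    also have "\<dots> = snd Z (f y \<oplus>\<^bsub>fst Z\<^esub> s x)"
      using a by (simp add: cl lmod_hom_add[OF Z'(4)] lmod_hom_add[OF W(1)] W(3) ds Z.M.a_assoc)
    also have "\<dots> = snd Z (?t a)"
      by (simp only: a(1) tv[OF a(2,3)])
    finally show ?thesis .
  qed
  ultimately have "?t \<in> C1_isos R (ext_complex X Y g) Z"
    using t by (intro C1_isosI) (simp_all only: fst_ext_complex)
  with coc tv show thesis using that by blast
qed

text \<open>The pair of a cocycle and an isomorphism carries the same data as an exact sequence with
  a section; the fibre over each cocycle is counted separately.\<close>

lemma card_split_hall_W:
  assumes X: "projective_complex R X" and Y: "projective_complex R Y" and Z: "projective_complex R Z"
  shows "card (split_hall_W X Y Z) = (\<Sum>g\<in>cocycles R X Y. card (C1_isos R (ext_complex X Y g) Z))"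
proof -
  let ?S = "direct_sum (fst Y) (fst X)"
  let ?f = "\<lambda>t. restrict (\<lambda>y. t (y, \<zero>\<^bsub>fst X\<^esub>)) (carrier (fst Y))"
  let ?p = "\<lambda>t. restrict (\<lambda>z. snd (inv_into (carrier ?S) t z)) (carrier (fst Z))"
  let ?s = "\<lambda>t. restrict (\<lambda>x. t (\<zero>\<^bsub>fst Y\<^esub>, x)) (carrier (fst X))"
  let ?G = "\<lambda>(g :: 'b \<Rightarrow> 'c, t). ((?f t, ?p t), ?s t)"
  let ?R = "SIGMA g:cocycles R X Y. C1_isos R (ext_complex X Y g) Z"
  note X' = projective_complexD[OF X] and Y' = projective_complexD[OF Y] and Z' = projective_complexD[OF Z]
  note S = left_module_direct_sum[OF Y'(1) X'(1)]
  interpret X: left_module R "fst X" by (rule X')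
  interpret Y: left_module R "fst Y" by (rule Y')
  interpret Z: left_module R "fst Z" by (rule Z')
  have "bij_betw ?G ?R (split_hall_W X Y Z)"
    unfolding bij_betw_def
  proof (intro conjI inj_onI equalityI subsetI)
    fix a b assume "a \<in> ?R" "b \<in> ?R" and eq: "?G a = ?G b"
    then obtain g t g' t' where a: "a = (g, t)" "g \<in> cocycles R X Y" "t \<in> C1_isos R (ext_complex X Y g) Z"
      and b: "b = (g', t')" "g' \<in> cocycles R X Y" "t' \<in> C1_isos R (ext_complex X Y g') Z"
      by auto
    note t = C1_isosD[OF a(3), unfolded fst_ext_complex] and t' = C1_isosD[OF b(3), unfolded fst_ext_complex]
      and g = cocyclesD[OF a(2)] and g' = cocyclesD[OF b(2)]
    have eqs: "?f t = ?f t'" "?s t = ?s t'"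
      using eq a(1) b(1) by simp_all
    have "t = t'"
    proof (rule lmod_hom_eqI[OF t(1) t'(1)])
      fix c assume "c \<in> carrier ?S"
      then obtain y x where c: "c = (y, x)" "y \<in> carrier (fst Y)" "x \<in> carrier (fst X)"
        by (auto simp: direct_sum_simps)
      have "t (y, \<zero>\<^bsub>fst X\<^esub>) = t' (y, \<zero>\<^bsub>fst X\<^esub>)" "t (\<zero>\<^bsub>fst Y\<^esub>, x) = t' (\<zero>\<^bsub>fst Y\<^esub>, x)"
        using fun_cong[OF eqs(1), of y] fun_cong[OF eqs(2), of x] c(2,3) by simp_all
      then show "t c = t' c"
        using lmod_hom_direct_sum_eq[OF Y'(1) X'(1) Z'(1) t(1) c(2,3)]
          lmod_hom_direct_sum_eq[OF Y'(1) X'(1) Z'(1) t'(1) c(2,3)] c(1) by simp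
    qed
    \<comment> \<open>The isomorphism determines the cocycle: \<open>t\<close> carries the
      differential of the extension to that of \<open>Z\<close>, and \<open>g x\<close> is a
      component of it at \<open>(0, x)\<close>.\<close>
    moreover have "g = g'"
    proof (rule lmod_hom_eqI[OF g(1) g'(1)])
      fix x assume x: "x \<in> carrier (fst X)"
      note cl = lmod_hom_closed[OF g(1) x] lmod_hom_closed[OF g'(1) x] lmod_hom_closed[OF X'(4) x]
      have "t (g x, snd X x) = t (g' x, snd X x)"
        using t(3)[of "(\<zero>\<^bsub>fst Y\<^esub>, x)"] t'(3)[of "(\<zero>\<^bsub>fst Y\<^esub>, x)"] x cl \<open>t = t'\<close>
        by (simp add: ext_complex_simps lmod_hom_zero[OF Y'(1) Y'(1) Y'(4)])
      then have "(g x, snd X x) = (g' x, snd X x)"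
        by (rule inj_onD[OF bij_betw_imp_inj_on[OF t(2)]]) (simp_all add: cl direct_sum_simps)
      then show "g x = g' x" by simp
    qed
    ultimately show "a = b" using a b by simp
  next
    fix w assume "w \<in> ?G ` ?R"
    then show "w \<in> split_hall_W X Y Z"
      using ext_iso_split[OF X Y Z] by auto
  next
    fix w assume w: "w \<in> split_hall_W X Y Z"
    obtain f p s where w': "w = ((f, p), s)"
      by (metis prod.collapse)
    obtain g t where g: "g \<in> cocycles R X Y" and t: "t \<in> C1_isos R (ext_complex X Y g) Z"
      and tv: "\<And>y x. \<lbrakk>y \<in> carrier (fst Y); x \<in> carrier (fst X)\<rbrakk> \<Longrightarrow> t (y, x) = f y \<oplus>\<^bsub>fst Z\<^esub> s x"
      using split_ext_iso[OF X Y Z w[unfolded w']] by blast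
    have W: "(f, p) \<in> hall_W R X Y Z" and s: "s \<in> lmod_hom R (fst X) (fst Z)"
      and ps: "\<And>x. x \<in> carrier (fst X) \<Longrightarrow> p (s x) = x"
      using w w' by (auto simp: split_hall_W_def)
    note W = hall_WD[OF W]
    note cl = lmod_hom_closed[OF W(1)] lmod_hom_closed[OF s]
    note t' = C1_isosD[OF t, unfolded fst_ext_complex]
    have "?f t = f"
      using lmod_hom_extensional[OF W(1)]
      by (intro extensionalityI[of _ "carrier (fst Y)"])
        (simp_all add: tv cl lmod_hom_zero[OF X'(1) Z'(1) s])
    moreover have "?s t = s"
      using lmod_hom_extensional[OF s]
      by (intro extensionalityI[of _ "carrier (fst X)"])
        (simp_all add: tv cl lmod_hom_zero[OF Y'(1) Z'(1) W(1)])
    moreover have "?p t = p"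
    proof (rule extensionalityI[OF _ lmod_hom_extensional[OF W(2)]])
      fix z assume z: "z \<in> carrier (fst Z)"
      then obtain y x where yx: "y \<in> carrier (fst Y)" "x \<in> carrier (fst X)" "z = t (y, x)"
        using bij_betw_imp_surj_on[OF t'(2)] unfolding direct_sum_simps by blast
      have "inv_into (carrier ?S) t z = (y, x)"
        using yx bij_betw_imp_inj_on[OF t'(2)] by (simp add: inv_into_f_f direct_sum_simps)
      moreover have "p z = x"
        using yx by (simp add: tv cl lmod_hom_add[OF W(2)] W(8) ps)
      ultimately show "?p t z = p z"
        using z by simp
    qed simp
    ultimately have "w = ?G (g, t)"
      using w' by simp
    then show "w \<in> ?G ` ?R"
      using g t by (intro image_eqI[of _ _ "(g, t)"]) simp_all
  qed
  then have "card (split_hall_W X Y Z) = card ?R"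
    by (simp add: bij_betw_same_card)
  also have "\<dots> = (\<Sum>g\<in>cocycles R X Y. card (C1_isos R (ext_complex X Y g) Z))"
  proof (rule card_SigmaI)
    show "finite (cocycles R X Y)"
      using finite_lmod_hom[OF X'(2) Y'(2)] by (rule rev_finite_subset) (auto simp: cocycles_def)
    show "\<forall>g\<in>cocycles R X Y. finite (C1_isos R (ext_complex X Y g) Z)"
      using finite_C1_isos[OF projective_complex_ext[OF X Y] Z] by blast
  qed
  finally show ?thesis .
qed

text \<open>Double counting of exact sequences with a section: each sequence has as many sections as
  there are homomorphisms from \<open>fst X\<close> to \<open>fst Y\<close>.\<close>

lemma card_hall_W:
  fixes Z :: "('a, nat) cyclic_complex"
  assumes X: "projective_complex R X" and Y: "projective_complex R Y" and Z: "projective_complex R Z"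
  shows "card (hall_W R X Y Z) * card (lmod_hom R (fst X) (fst Y))
    = (\<Sum>g\<in>cocycles R X Y. card (C1_isos R (ext_complex X Y g) Z))"
proof -
  let ?sec = "\<lambda>q. {s \<in> lmod_hom R (fst X) (fst Z). \<forall>x\<in>carrier (fst X). snd q (s x) = x}"
  have fin: "finite (lmod_hom R (fst X) (fst Z))"
    by (rule finite_lmod_hom[OF projective_complexD(2)[OF X] projective_complexD(2)[OF Z]])
  have "card (split_hall_W X Y Z) = (\<Sum>q\<in>hall_W R X Y Z. card (?sec q))"
    unfolding split_hall_W_def
  proof (rule card_SigmaI)
    show "\<forall>q\<in>hall_W R X Y Z. finite (?sec q)"
      using fin by simp
  qed (rule finite_hall_W[OF X Y Z])
  also have "\<dots> = (\<Sum>q\<in>hall_W R X Y Z. card (lmod_hom R (fst X) (fst Y)))"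
  proof (rule sum.cong[OF refl])
    fix q assume "q \<in> hall_W R X Y Z"
    then have "(fst q, snd q) \<in> hall_W R X Y Z"
      by (simp only: prod.collapse)
    then show "card (?sec q) = card (lmod_hom R (fst X) (fst Y))"
      by (rule card_sections[OF X Y Z])
  qed
  also have "\<dots> = card (hall_W R X Y Z) * card (lmod_hom R (fst X) (fst Y))"
    by simp
  finally show ?thesis
    using card_split_hall_W[OF X Y Z] by simp
qed

text \<open>Composing with isomorphisms at both ends embeds one set of exact sequences into the
  other. This allows the representatives in the product to be exchanged for \<open>X\<close> and
  \<open>Y\<close>.\<close>

lemma card_hall_W_le:
  assumes X: "projective_complex R X" and Y: "projective_complex R Y" and Z: "projective_complex R Z"
    and X': "projective_complex R X'" and Y': "projective_complex R Y'"
    and a: "a \<in> C1_isos R X X'" and b: "b \<in> C1_isos R Y' Y"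
  shows "card (hall_W R X Y Z) \<le> card (hall_W R X' Y' Z)"
proof (rule card_inj_on_le)
  let ?F = "\<lambda>(f, p). (compose (carrier (fst Y')) f b, compose (carrier (fst Z)) a p)"
  note PX = projective_complexD[OF X] and PX' = projective_complexD[OF X']
    and PY = projective_complexD[OF Y] and PY' = projective_complexD[OF Y'] and PZ = projective_complexD[OF Z]
  note a = C1_isosD[OF a] and b = C1_isosD[OF b]
  interpret X: left_module R "fst X" by (rule PX)
  show "finite (hall_W R X' Y' Z)"
    by (rule finite_hall_W[OF X' Y' Z])
  show "inj_on ?F (hall_W R X Y Z)"
  proof (rule inj_onI)
    fix u v assume u: "u \<in> hall_W R X Y Z" and v: "v \<in> hall_W R X Y Z" and eq: "?F u = ?F v"
    obtain f p f' p' where fp: "u = (f, p)" "v = (f', p')"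
      by (metis prod.collapse)
    note W = hall_WD[OF u[unfolded fp]] and W' = hall_WD[OF v[unfolded fp]]
    have eqs: "compose (carrier (fst Y')) f b = compose (carrier (fst Y')) f' b"
      "compose (carrier (fst Z)) a p = compose (carrier (fst Z)) a p'"
      using eq by (simp_all add: fp)
    have "f = f'"
    proof (rule lmod_hom_eqI[OF W(1) W'(1)])
      fix y assume "y \<in> carrier (fst Y)"
      then obtain y' where "y' \<in> carrier (fst Y')" "y = b y'"
        using bij_betw_imp_surj_on[OF b(2)] by blast
      then show "f y = f' y"
        using fun_cong[OF eqs(1), of y'] by (simp add: compose_def)
    qed
    moreover have "p = p'"
    proof (rule lmod_hom_eqI[OF W(2) W'(2)])
      fix z assume z: "z \<in> carrier (fst Z)"
      then have "a (p z) = a (p' z)"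
        using fun_cong[OF eqs(2), of z] by (simp add: compose_def)
      then show "p z = p' z"
        by (rule inj_onD[OF bij_betw_imp_inj_on[OF a(2)]])
          (simp_all add: z lmod_hom_closed[OF W(2)] lmod_hom_closed[OF W'(2)])
    qed
    ultimately show "u = v" by (simp add: fp)
  qed
  show "?F ` hall_W R X Y Z \<subseteq> hall_W R X' Y' Z"
  proof
    fix w assume "w \<in> ?F ` hall_W R X Y Z"
    then obtain f p where fp: "(f, p) \<in> hall_W R X Y Z"
      and w: "w = (compose (carrier (fst Y')) f b, compose (carrier (fst Z)) a p)"
      by auto
    note W = hall_WD[OF fp]
    note cl = lmod_hom_closed[OF W(1)] lmod_hom_closed[OF W(2)] lmod_hom_closed[OF b(1)]
      lmod_hom_closed[OF a(1)] lmod_hom_closed[OF PZ(4)] lmod_hom_closed[OF PY'(4)]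
    let ?f = "compose (carrier (fst Y')) f b" and ?p = "compose (carrier (fst Z)) a p"
    have f: "?f \<in> C1_hom R Y' Z"
      using lmod_hom_comp[OF b(1) W(1) PY'(1)] unfolding C1_hom_def
      by (simp add: compose_def cl b(3) W(3))
    have p: "?p \<in> C1_hom R Z X'"
      using lmod_hom_comp[OF W(2) a(1) PZ(1)] unfolding C1_hom_def
      by (simp add: compose_def cl a(3) W(4))
    have im: "?f ` carrier (fst Y') = f ` carrier (fst Y)"
      using bij_betw_imp_surj_on[OF b(2)] by (simp add: compose_def image_image[symmetric])
    have inj: "inj_on ?f (carrier (fst Y'))"
    proof (rule inj_onI)
      fix y y' assume y: "y \<in> carrier (fst Y')" "y' \<in> carrier (fst Y')" and "?f y = ?f y'"
      then have "f (b y) = f (b y')"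
        by (simp add: compose_def)
      then have "b y = b y'"
        by (rule inj_onD[OF W(5)]) (simp_all add: y cl)
      then show "y = y'"
        by (rule inj_onD[OF bij_betw_imp_inj_on[OF b(2)]]) (simp_all add: y)
    qed
    have sur: "?p ` carrier (fst Z) = carrier (fst X')"
    proof -
      have "?p ` carrier (fst Z) = a ` (p ` carrier (fst Z))"
        by (auto simp: compose_def)
      then show ?thesis
        using W(6) bij_betw_imp_surj_on[OF a(2)] by simp
    qed
    have "a x = \<zero>\<^bsub>fst X'\<^esub> \<longleftrightarrow> x = \<zero>\<^bsub>fst X\<^esub>" if "x \<in> carrier (fst X)" for x
      using lmod_hom_zero[OF PX(1) PX'(1) a(1)] inj_onD[OF bij_betw_imp_inj_on[OF a(2)], of x "\<zero>\<^bsub>fst X\<^esub>"]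
        that X.M.zero_closed by metis
    then have ker: "{z \<in> carrier (fst Z). ?p z = \<zero>\<^bsub>fst X'\<^esub>} = {z \<in> carrier (fst Z). p z = \<zero>\<^bsub>fst X\<^esub>}"
      by (auto simp: compose_def cl)
    show "w \<in> hall_W R X' Y' Z"
      unfolding w hall_W_def using f p inj sur im ker W(7) by simp
  qed
qed

lemma card_hall_W_cong:
  assumes "projective_complex R X" "projective_complex R Y" "projective_complex R Z"
    and "projective_complex R X'" "projective_complex R Y'"
    and "C1_isos R X X' \<noteq> {}" "C1_isos R Y Y' \<noteq> {}"
  shows "card (hall_W R X Y Z) = card (hall_W R X' Y' Z)"
proof (rule le_antisym)
  have "C1_isos R X' X \<noteq> {}" "C1_isos R Y' Y \<noteq> {}"
    using assms C1_isos_sym by blast+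
  then show "card (hall_W R X Y Z) \<le> card (hall_W R X' Y' Z)"
    "card (hall_W R X' Y' Z) \<le> card (hall_W R X Y Z)"
    using assms card_hall_W_le by blast+
qed

end

section \<open>Products in the Hall algebra\<close>

text \<open>With this normalization the structure constants of the Hall algebra no longer involve
  automorphism groups.\<close>

definition weighted_class ::
  "('k::{field,finite}, 'a) module \<Rightarrow> ('a, 'm) cyclic_complex \<Rightarrow> 'a hall_vector" where
  "weighted_class R X = (\<lambda>\<gamma>. of_nat (card (C1_isos R X X)) * hall_basis R X \<gamma>)"

context scalar_algebra
begin

lemma card_C1_isos_pos: "projective_complex R X \<Longrightarrow> card (C1_isos R X X) > 0"
  using C1_isos_id finite_C1_isos by (metis card_gt_0_iff empty_iff)

lemma representative_iso:
  assumes "projective_complex R X"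
  shows "C1_isos R X (SOME Y. Y \<in> isoclass R X) \<noteq> {}"
  using C1_isos_representative_iff[OF assms isoclass_in_isoclasses[OF assms]] by blast

lemma card_C1_isos_inverse_le:
  assumes X: "projective_complex R X" and Y: "projective_complex R Y"
  shows "card (C1_isos R X Y) \<le> card (C1_isos R Y X)"
proof (rule card_inj_on_le)
  let ?I = "\<lambda>f. restrict (inv_into (carrier (fst X)) f) (carrier (fst Y))"
  show "inj_on ?I (C1_isos R X Y)"
  proof (rule inj_onI)
    fix f f' assume f: "f \<in> C1_isos R X Y" and f': "f' \<in> C1_isos R X Y" and eq: "?I f = ?I f'"
    note f = C1_isosD[OF f] and f' = C1_isosD[OF f']
    show "f = f'"
    proof (rule lmod_hom_eqI[OF f(1) f'(1)])
      fix x assume x: "x \<in> carrier (fst X)"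
      have y: "f x \<in> carrier (fst Y)"
        by (rule lmod_hom_closed[OF f(1) x])
      have "x = inv_into (carrier (fst X)) f (f x)"
        using x f(2) by (simp add: bij_betw_def inv_into_f_f)
      also have "\<dots> = inv_into (carrier (fst X)) f' (f x)"
        using fun_cong[OF eq, of "f x"] y by simp
      finally show "f x = f' x"
        using y f'(2) by (metis bij_betw_inv_into_right)
    qed
  qed
  show "?I ` C1_isos R X Y \<subseteq> C1_isos R Y X"
    using C1_isos_inverse[OF X Y] by blast
qed (rule finite_C1_isos[OF Y X])

lemma card_aut_cong:
  assumes X: "projective_complex R X" and Y: "projective_complex R Y" and iso: "C1_isos R X Y \<noteq> {}"
  shows "card (C1_isos R X Y) = card (C1_isos R X X)" "card (C1_isos R Y Y) = card (C1_isos R X X)"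
  using card_C1_isos_cong[OF X Y X iso] card_C1_isos_cong[OF X Y Y iso]
    card_C1_isos_inverse_le[OF X Y] card_C1_isos_inverse_le[OF Y X]
  by linarith+

text \<open>There are \<open>|Aut X|\<close> isomorphisms from \<open>X\<close> to an isomorphic
  complex and none to any other. In this form the weighted class matches the right hand side of
  \<open>card_hall_W\<close>.\<close>

lemma weighted_class_apply:
  assumes X: "projective_complex R X" and "\<gamma> \<in> isoclasses R"
  shows "weighted_class R X \<gamma> = of_nat (card (C1_isos R X (SOME Z. Z \<in> \<gamma>)))"
proof (cases "\<gamma> = isoclass R X")
  case True
  have "C1_isos R X (SOME Z. Z \<in> \<gamma>) \<noteq> {}"
    using C1_isos_representative_iff[OF assms] True by blast
  then have "card (C1_isos R X (SOME Z. Z \<in> \<gamma>)) = card (C1_isos R X X)"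
    by (rule card_aut_cong(1)[OF X isoclass_representative(1)[OF assms(2)]])
  then show ?thesis
    using True by (simp add: weighted_class_def hall_basis_def)
next
  case False
  then have "C1_isos R X (SOME Z. Z \<in> \<gamma>) = {}"
    using C1_isos_representative_iff[OF assms] by blast
  then show ?thesis
    using False by (simp add: weighted_class_def hall_basis_def)
qed

lemma weighted_class_cong:
  assumes "projective_complex R X" "projective_complex R Y" "C1_isos R X Y \<noteq> {}"
  shows "weighted_class R X = weighted_class R Y"
  using isoclass_cong[OF assms] card_aut_cong(2)[OF assms]
  by (simp add: weighted_class_def hall_basis_def)

lemma weighted_class_outside:
  assumes "projective_complex R X" "\<gamma> \<notin> isoclasses R"
  shows "weighted_class R X \<gamma> = 0"
  using isoclass_in_isoclasses[OF assms(1)] assms(2)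
  by (auto simp: weighted_class_def hall_basis_def)

lemma weighted_class_support:
  assumes "projective_complex R X"
  shows "{\<gamma>. weighted_class R X \<gamma> \<noteq> 0} = {isoclass R X}"
  using card_C1_isos_pos[OF assms] by (auto simp: weighted_class_def hall_basis_def)

lemma weighted_class_closed:
  assumes "projective_complex R X"
  shows "weighted_class R X \<in> carrier (hall_algebra R)"
  using weighted_class_support[OF assms] isoclass_in_isoclasses[OF assms]
  by (simp add: hall_algebra_def)

text \<open>The weights cancel the denominator of \<open>hall_number\<close>, which leaves the
  number of exact sequences; by \<open>card_hall_W\<close> it is a sum of isomorphism counts out of
  the extensions.\<close>

lemma weighted_class_mult:
  assumes X: "projective_complex R X" and Y: "projective_complex R Y"
  shows "weighted_class R X \<otimes>\<^bsub>hall_algebra R\<^esub> weighted_class R Y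
    = (\<lambda>\<gamma>. (\<Sum>g\<in>cocycles R X Y. weighted_class R (ext_complex X Y g) \<gamma>)
        / of_nat (card (lmod_hom R (fst X) (fst Y))))"
proof
  fix \<gamma> :: "('a, nat) cyclic_complex set"
  let ?X = "SOME Z. Z \<in> isoclass R X" and ?Y = "SOME Z. Z \<in> isoclass R Y" and ?Z = "SOME Z. Z \<in> \<gamma>"
  let ?h = "card (lmod_hom R (fst X) (fst Y))"
  have E: "projective_complex R (ext_complex X Y g)" if "g \<in> cocycles R X Y" for g
    by (rule projective_complex_ext[OF X Y that])
  show "(weighted_class R X \<otimes>\<^bsub>hall_algebra R\<^esub> weighted_class R Y) \<gamma>
    = (\<Sum>g\<in>cocycles R X Y. weighted_class R (ext_complex X Y g) \<gamma>) / of_nat ?h"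
  proof (cases "\<gamma> \<in> isoclasses R")
    case False
    then show ?thesis
      using weighted_class_outside[OF E False] by (simp add: hall_algebra_def)
  next
    case True
    note rX = isoclass_representative[OF isoclass_in_isoclasses[OF X]]
      and rY = isoclass_representative[OF isoclass_in_isoclasses[OF Y]]
      and rZ = isoclass_representative[OF True]
    have "(weighted_class R X \<otimes>\<^bsub>hall_algebra R\<^esub> weighted_class R Y) \<gamma>
      = weighted_class R X (isoclass R X) * weighted_class R Y (isoclass R Y) * hall_number R ?X ?Y ?Z"
      using True by (simp add: hall_algebra_def weighted_class_support[OF X] weighted_class_support[OF Y])
    also have "\<dots> = of_nat (card (C1_isos R X X)) * of_nat (card (C1_isos R Y Y)) * hall_number R ?X ?Y ?Z"
      by (simp add: weighted_class_def hall_basis_def)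
    also have "\<dots> = of_nat (card (hall_W R X Y ?Z))"
      using card_aut_cong(2)[OF X rX(1) representative_iso[OF X]]
        card_aut_cong(2)[OF Y rY(1) representative_iso[OF Y]]
        card_C1_isos_pos[OF X] card_C1_isos_pos[OF Y]
        card_hall_W_cong[OF X Y rZ(1) rX(1) rY(1) representative_iso[OF X] representative_iso[OF Y]]
      by (simp add: hall_number_def)
    finally have *: "(weighted_class R X \<otimes>\<^bsub>hall_algebra R\<^esub> weighted_class R Y) \<gamma>
      = of_nat (card (hall_W R X Y ?Z))" .
    have "restrict (\<lambda>x. \<zero>\<^bsub>fst Y\<^esub>) (carrier (fst X)) \<in> lmod_hom R (fst X) (fst Y)"
      by (rule lmod_hom_const_zero[OF projective_complexD(1)[OF X] projective_complexD(1)[OF Y]])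
    then have h: "?h > 0"
      using finite_lmod_hom[OF projective_complexD(2)[OF X] projective_complexD(2)[OF Y]]
      by (metis card_gt_0_iff empty_iff)
    have "(of_nat (card (hall_W R X Y ?Z) * ?h) :: complex)
      = (\<Sum>g\<in>cocycles R X Y. of_nat (card (C1_isos R (ext_complex X Y g) ?Z)))"
      by (simp only: card_hall_W[OF X Y rZ(1)] of_nat_sum)
    also have "\<dots> = (\<Sum>g\<in>cocycles R X Y. weighted_class R (ext_complex X Y g) \<gamma>)"
      using weighted_class_apply[OF E True] by simp
    finally show ?thesis
      using h by (simp add: * field_simps)
  qed
qed

end

context scalar_algebra
begin

section \<open>Isomorphisms between extensions\<close>

text \<open>By finiteness an injection between carriers of equal size is onto, so for the explicit
  matrices below no inverse has to be written down.\<close>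

lemma C1_isosI_inj:
  assumes X: "projective_complex R X" and Y: "projective_complex R Y"
    and f: "f \<in> lmod_hom R (fst X) (fst Y)"
    and d: "\<And>x. x \<in> carrier (fst X) \<Longrightarrow> f (snd X x) = snd Y (f x)"
    and inj: "inj_on f (carrier (fst X))" and card: "card (carrier (fst X)) = card (carrier (fst Y))"
  shows "C1_isos R X Y \<noteq> {}"
proof -
  have "f ` carrier (fst X) \<subseteq> carrier (fst Y)"
    using lmod_hom_closed[OF f] by blast
  then have "f ` carrier (fst X) = carrier (fst Y)"
    using card_subset_eq[OF projective_complexD(2)[OF Y]] card_image[OF inj] card by metis
  then have "f \<in> C1_isos R X Y"
    using f d inj by (intro C1_isosI) (simp_all add: bij_betw_def)
  then show ?thesis by blast
qed

text \<open>Cocycles that differ by the coboundary of \<open>h\<close> give isomorphic extensions,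
  through the unipotent matrix with upper right entry \<open>h\<close>. The condition is arranged to
  avoid subtraction.\<close>

lemma ext_complex_shear:
  assumes X: "projective_complex R X" and Y: "projective_complex R Y"
    and g: "g \<in> cocycles R X Y" and g': "g' \<in> cocycles R X Y" and h: "h \<in> lmod_hom R (fst X) (fst Y)"
    and eq: "\<And>x. x \<in> carrier (fst X) \<Longrightarrow> g' x \<oplus>\<^bsub>fst Y\<^esub> h (snd X x) = g x \<oplus>\<^bsub>fst Y\<^esub> snd Y (h x)"
  shows "C1_isos R (ext_complex X Y g') (ext_complex X Y g) \<noteq> {}"
proof (rule C1_isosI_inj[OF projective_complex_ext[OF X Y g'] projective_complex_ext[OF X Y g]])
  note X = projective_complexD[OF X] and Y = projective_complexD[OF Y]
    and g = cocyclesD(1)[OF g] and g' = cocyclesD(1)[OF g']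
  interpret X: left_module R "fst X" by (rule X)
  interpret Y: left_module R "fst Y" by (rule Y)
  note cl = lmod_hom_closed[OF X(4)] lmod_hom_closed[OF Y(4)] lmod_hom_closed[OF g]
    lmod_hom_closed[OF g'] lmod_hom_closed[OF h]
  let ?S = "direct_sum (fst Y) (fst X)"
  let ?t = "restrict (\<lambda>(y, x). (y \<oplus>\<^bsub>fst Y\<^esub> h x, x)) (carrier ?S)"
  show "?t \<in> lmod_hom R (fst (ext_complex X Y g')) (fst (ext_complex X Y g))"
    unfolding fst_ext_complex
    by (rule lmod_homI) (auto simp: direct_sum_simps cl lmod_hom_add[OF h] lmod_hom_smult[OF h]
        X.smult_closed Y.smult_closed Y.smult_r_distr Y.M.a_ac)
  show "?t (snd (ext_complex X Y g') p) = snd (ext_complex X Y g) (?t p)"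
    if p: "p \<in> carrier (fst (ext_complex X Y g'))" for p
  proof -
    obtain y x where yx: "p = (y, x)" "y \<in> carrier (fst Y)" "x \<in> carrier (fst X)"
      using p by (auto simp: ext_complex_simps)
    have "snd Y (h x) \<oplus>\<^bsub>fst Y\<^esub> g x = g x \<oplus>\<^bsub>fst Y\<^esub> snd Y (h x)"
      using yx(3) by (intro Y.M.a_comm) (simp_all add: cl)
    then show ?thesis
      using yx eq[OF yx(3)] by (simp add: ext_complex_simps cl lmod_hom_add[OF Y(4)] Y.M.a_assoc)
  qed
  show "inj_on ?t (carrier (fst (ext_complex X Y g')))"
    unfolding fst_ext_complex by (rule inj_onI) (auto simp: direct_sum_simps cl)
  show "card (carrier (fst (ext_complex X Y g'))) = card (carrier (fst (ext_complex X Y g)))"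
    by (simp add: fst_ext_complex)
qed

abbreviation zero_hom :: "('a, 'm) module \<Rightarrow> ('a, 'n) module \<Rightarrow> 'm \<Rightarrow> 'n" where
  "zero_hom M N \<equiv> restrict (\<lambda>x. \<zero>\<^bsub>N\<^esub>) (carrier M)"

lemma zero_hom_cocycle:
  assumes X: "projective_complex R X" and Y: "projective_complex R Y"
  shows "zero_hom (fst X) (fst Y) \<in> cocycles R X Y"
proof -
  note X = projective_complexD[OF X] and Y = projective_complexD[OF Y]
  interpret Y: left_module R "fst Y" by (rule Y)
  show ?thesis
    using lmod_hom_const_zero[OF X(1) Y(1)]
    by (simp add: cocycles_def lmod_hom_zero[OF Y(1) Y(1) Y(4)] lmod_hom_closed[OF X(4)])
qed

text \<open>The split extension is a direct sum, so the split terms of products in opposite order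
  agree.\<close>

lemma ext_complex_swap:
  assumes X: "projective_complex R X" and Y: "projective_complex R Y"
  shows "C1_isos R (ext_complex X Y (zero_hom (fst X) (fst Y)))
    (ext_complex Y X (zero_hom (fst Y) (fst X))) \<noteq> {}"
proof (rule C1_isosI_inj[OF projective_complex_ext[OF X Y zero_hom_cocycle[OF X Y]]
      projective_complex_ext[OF Y X zero_hom_cocycle[OF Y X]]])
  note X = projective_complexD[OF X] and Y = projective_complexD[OF Y]
  interpret X: left_module R "fst X" by (rule X)
  interpret Y: left_module R "fst Y" by (rule Y)
  note cl = lmod_hom_closed[OF X(4)] lmod_hom_closed[OF Y(4)]
  let ?t = "restrict (\<lambda>(y, x). (x, y)) (carrier (direct_sum (fst Y) (fst X)))"
  show "?t \<in> lmod_hom R (fst (ext_complex X Y (zero_hom (fst X) (fst Y))))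
      (fst (ext_complex Y X (zero_hom (fst Y) (fst X))))"
    unfolding fst_ext_complex
    by (rule lmod_homI) (auto simp: direct_sum_simps X.smult_closed Y.smult_closed)
  show "?t (snd (ext_complex X Y (zero_hom (fst X) (fst Y))) p)
      = snd (ext_complex Y X (zero_hom (fst Y) (fst X))) (?t p)"
    if "p \<in> carrier (fst (ext_complex X Y (zero_hom (fst X) (fst Y))))" for p
    using that by (auto simp: ext_complex_simps cl)
  show "inj_on ?t (carrier (fst (ext_complex X Y (zero_hom (fst X) (fst Y)))))"
    unfolding fst_ext_complex by (rule inj_onI) (auto simp: direct_sum_simps)
  show "card (carrier (fst (ext_complex X Y (zero_hom (fst X) (fst Y)))))
      = card (carrier (fst (ext_complex Y X (zero_hom (fst Y) (fst X)))))"
    by (simp add: fst_ext_complex direct_sum_simps card_cartesian_product)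
qed

section \<open>The complexes \<open>C\<^sub>P\<close> and \<open>K\<^sub>P\<close>\<close>

lemma fst_C_complex: "fst (C_complex P) = P"
  by (simp add: C_complex_def)

lemma snd_C_complex: "x \<in> carrier P \<Longrightarrow> snd (C_complex P) x = \<zero>\<^bsub>P\<^esub>"
  by (simp add: C_complex_def)

lemma projective_complex_C:
  assumes P: "projective_module R P"
  shows "projective_complex R (C_complex P)"
proof -
  note LP = fd_module_finite(1)[OF projective_fd[OF P]]
  interpret P: left_module R P by (rule LP)
  show ?thesis
    unfolding C_complex_def using lmod_hom_const_zero[OF LP LP]
    by (intro projective_complexI P) simp_all
qed

lemma cocycles_C:
  assumes P: "projective_module R P" and P': "projective_module R P'"
  shows "cocycles R (C_complex P) (C_complex P') = lmod_hom R P P'"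
proof -
  note LP = fd_module_finite(1)[OF projective_fd[OF P]] and LP' = fd_module_finite(1)[OF projective_fd[OF P']]
  interpret P': left_module R P' by (rule LP')
  show ?thesis
    by (auto simp: cocycles_def C_complex_def lmod_hom_closed lmod_hom_zero[OF LP LP'])
qed

text \<open>Exhibits the contractible complex as an extension of \<open>C_complex P\<close> by
  itself, so that the general results on extensions apply to it.\<close>

lemma K_complex_eq:
  assumes P: "projective_module R P"
  shows "K_complex P = ext_complex (C_complex P) (C_complex P) (restrict (\<lambda>x. x) (carrier P))"
proof -
  interpret P: left_module R P by (rule fd_module_finite(1)[OF projective_fd[OF P]])
  show ?thesis
    by (auto simp: K_complex_def ext_complex_def C_complex_def direct_sum_simps fun_eq_iff)
qed

lemma projective_complex_K:
  assumes P: "projective_module R P"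
  shows "projective_complex R (K_complex P)"
  unfolding K_complex_eq[OF P]
  using lmod_hom_id[OF fd_module_finite(1)[OF projective_fd[OF P]]]
  by (intro projective_complex_ext projective_complex_C P) (simp add: cocycles_C P)

lemma fst_K_complex: "fst (K_complex P) = direct_sum P P"
  by (simp add: K_complex_def)

lemma snd_K_complex:
  "\<lbrakk>x \<in> carrier P; y \<in> carrier P\<rbrakk> \<Longrightarrow> snd (K_complex P) (x, y) = (y, \<zero>\<^bsub>P\<^esub>)"
  by (simp add: K_complex_def)

lemma lmod_hom_direct_sum_codomain_trivial:
  assumes "left_module R L" "left_module R M" "left_module R N"
    and "lmod_hom R L M = {zero_hom L M}" "lmod_hom R L N = {zero_hom L N}"
  shows "lmod_hom R L (direct_sum M N) = {zero_hom L (direct_sum M N)}"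
proof -
  have "card (lmod_hom R L (direct_sum M N)) = 1"
    using card_lmod_hom_direct_sum_codomain[OF assms(1-3)] assms(4,5) by simp
  then show ?thesis
    using lmod_hom_const_zero[OF assms(1) left_module_direct_sum[OF assms(2,3)]]
    by (metis card_1_singletonE singletonD)
qed

lemma lmod_hom_direct_sum_domain_trivial:
  assumes "left_module R L" "left_module R M" "left_module R N"
    and "lmod_hom R M L = {zero_hom M L}" "lmod_hom R N L = {zero_hom N L}"
  shows "lmod_hom R (direct_sum M N) L = {zero_hom (direct_sum M N) L}"
proof -
  have "card (lmod_hom R (direct_sum M N) L) = 1"
    using card_lmod_hom_direct_sum_domain[OF assms(1-3)] assms(4,5) by simp
  then show ?thesis
    using lmod_hom_const_zero[OF left_module_direct_sum[OF assms(2,3)] assms(1)]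
    by (metis card_1_singletonE singletonD)
qed

text \<open>Only the zero cocycle is left and the denominator is 1, so the product is the class of
  the direct sum.\<close>

lemma weighted_class_mult_trivial:
  assumes X: "projective_complex R X" and Y: "projective_complex R Y"
    and hom: "lmod_hom R (fst X) (fst Y) = {zero_hom (fst X) (fst Y)}"
  shows "weighted_class R X \<otimes>\<^bsub>hall_algebra R\<^esub> weighted_class R Y
    = weighted_class R (ext_complex X Y (zero_hom (fst X) (fst Y)))"
proof -
  have "cocycles R X Y = {zero_hom (fst X) (fst Y)}"
    using zero_hom_cocycle[OF X Y] hom by (auto simp: cocycles_def)
  then show ?thesis
    by (simp add: weighted_class_mult[OF X Y] hom)
qed

end

section \<open>A pair of projectives with a single homomorphism between them\<close>

text \<open>\<open>M\<close> and \<open>N\<close> stand for \<open>P\<^sub>i\<close> and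
  \<open>P\<^sub>j\<close> with a path from \<open>i\<close> to \<open>j\<close>, and
  \<open>q\<close> for the order of the field. The last two assumptions say that \<open>f\<close>
  generates the homomorphisms from \<open>N\<close> to \<open>M\<close> over the endomorphisms on
  either side; they are what makes the cocycles in \<open>mult_W_X\<close> and
  \<open>mult_Y_W\<close> coboundaries.\<close>

locale linked_projectives = scalar_algebra R
  for R :: "('k::{field,finite}, 'a) module" (structure) +
  fixes M :: "('a, 'm) module" and N :: "('a, 'n) module" and f :: "'n \<Rightarrow> 'm" and q :: nat
  assumes M: "projective_module R M" and N: "projective_module R N"
    and hom_MN: "lmod_hom R M N = {zero_hom M N}"
    and card_hom_NM: "card (lmod_hom R N M) = q"
    and card_end: "card (lmod_hom R M M) = q" "card (lmod_hom R N N) = q"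
    and end_bij: "\<lbrakk>a \<in> lmod_hom R M M; a \<noteq> zero_hom M M\<rbrakk> \<Longrightarrow> bij_betw a (carrier M) (carrier M)"
      "\<lbrakk>b \<in> lmod_hom R N N; b \<noteq> zero_hom N N\<rbrakk> \<Longrightarrow> bij_betw b (carrier N) (carrier N)"
    and f: "f \<in> lmod_hom R N M" "f \<noteq> zero_hom N M"
    and f_post: "g \<in> lmod_hom R N M \<Longrightarrow> \<exists>a\<in>lmod_hom R M M. \<forall>x\<in>carrier N. g x = a (f x)"
    and f_pre: "g \<in> lmod_hom R N M \<Longrightarrow> \<exists>b\<in>lmod_hom R N N. \<forall>x\<in>carrier N. g x = f (b x)"
begin

lemma LM: "left_module R M" and LN: "left_module R N" and finM: "finite (carrier M)" and finN: "finite (carrier N)"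
  using fd_module_finite[OF projective_fd[OF M]] fd_module_finite[OF projective_fd[OF N]] by simp_all

sublocale M: left_module R M by (rule LM)
sublocale N: left_module R N by (rule LN)

abbreviation "X \<equiv> C_complex M"
abbreviation "Y \<equiv> C_complex N"
abbreviation "W \<equiv> ext_complex Y X f"
abbreviation "H \<equiv> hall_algebra R"
abbreviation "wc \<equiv> weighted_class R"

lemmas pc_X = projective_complex_C[OF M]
lemmas pc_Y = projective_complex_C[OF N]

lemma f_cocycle: "f \<in> cocycles R Y X"
  using f(1) by (simp add: cocycles_C[OF N M])

lemmas pc_W = projective_complex_ext[OF pc_Y pc_X f_cocycle]

lemma fst_W: "fst W = direct_sum M N"
  by (simp add: ext_complex_simps fst_C_complex)

lemma snd_W: "\<lbrakk>m \<in> carrier M; x \<in> carrier N\<rbrakk> \<Longrightarrow> snd W (m, x) = (f x, \<zero>\<^bsub>N\<^esub>)"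
  by (simp add: ext_complex_simps fst_C_complex snd_C_complex lmod_hom_closed[OF f(1)])

lemma zero_homI: "\<lbrakk>g \<in> lmod_hom R L L'; \<And>x. x \<in> carrier L \<Longrightarrow> g x = \<zero>\<^bsub>L'\<^esub>\<rbrakk> \<Longrightarrow> g = zero_hom L L'"
  by (rule extensionalityI[of _ "carrier L"]) (simp_all add: lmod_hom_extensional)

text \<open>A nonzero endomorphism of \<open>M\<close> is injective and so cannot kill the nonzero
  \<open>f\<close>. This is the hypothesis \<open>zero\<close> of \<open>cocycles_from_W\<close> for
  \<open>P = M\<close>.\<close>

lemma post_zero: "\<forall>a\<in>lmod_hom R M M. (\<forall>x\<in>carrier N. a (f x) = \<zero>\<^bsub>M\<^esub>) \<longrightarrow> a = zero_hom M M"
proof (intro ballI impI, rule ccontr)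
  fix a assume a: "a \<in> lmod_hom R M M" and af: "\<forall>x\<in>carrier N. a (f x) = \<zero>\<^bsub>M\<^esub>"
  assume "a \<noteq> zero_hom M M"
  then have inj: "inj_on a (carrier M)"
    using end_bij(1)[OF a] by (simp add: bij_betw_def)
  have "f x = \<zero>\<^bsub>M\<^esub>" if x: "x \<in> carrier N" for x
  proof -
    have "a (f x) = a \<zero>\<^bsub>M\<^esub>"
      using af x lmod_hom_zero[OF LM LM a] by simp
    then show ?thesis
      by (rule inj_onD[OF inj]) (simp_all add: x lmod_hom_closed[OF f(1)])
  qed
  then show False
    using zero_homI[OF f(1)] f(2) by simp
qed

text \<open>A nonzero endomorphism of \<open>N\<close> is onto, so \<open>f\<close> after it is
  still nonzero. This is the hypothesis \<open>zero\<close> of \<open>cocycles_into_W\<close> for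
  \<open>P = N\<close>.\<close>

lemma pre_zero: "\<forall>b\<in>lmod_hom R N N. (\<forall>x\<in>carrier N. f (b x) = \<zero>\<^bsub>M\<^esub>) \<longrightarrow> b = zero_hom N N"
proof (intro ballI impI, rule ccontr)
  fix b assume b: "b \<in> lmod_hom R N N" and fb: "\<forall>x\<in>carrier N. f (b x) = \<zero>\<^bsub>M\<^esub>"
  assume "b \<noteq> zero_hom N N"
  then have sur: "b ` carrier N = carrier N"
    using end_bij(2)[OF b] by (simp add: bij_betw_def)
  have "f x = \<zero>\<^bsub>M\<^esub>" if x: "x \<in> carrier N" for x
  proof -
    from x sur have "x \<in> b ` carrier N" by simp
    then show ?thesis using fb by auto
  qed
  then show False
    using zero_homI[OF f(1)] f(2) by simp
qed

section \<open>Cocycles between \<open>W\<close> and complexes with zero differential\<close>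

abbreviation inl :: "('a, 'p) module \<Rightarrow> ('p \<Rightarrow> 'm) \<Rightarrow> 'p \<Rightarrow> 'm \<times> 'n" where
  "inl P g \<equiv> restrict (\<lambda>x. (g x, \<zero>\<^bsub>N\<^esub>)) (carrier P)"

abbreviation on_snd :: "('n \<Rightarrow> 'p) \<Rightarrow> 'm \<times> 'n \<Rightarrow> 'p" where
  "on_snd h \<equiv> restrict (\<lambda>(m, x). h x) (carrier (direct_sum M N))"

text \<open>A homomorphism \<open>(g, h)\<close> into \<open>W\<close> is a cocycle iff
  \<open>f h = 0\<close>. By hypothesis this forces \<open>h = 0\<close>, and \<open>g\<close> stays
  free.\<close>

lemma cocycles_into_W:
  assumes P: "projective_module R P"
    and zero: "\<forall>h\<in>lmod_hom R P N. (\<forall>x\<in>carrier P. f (h x) = \<zero>\<^bsub>M\<^esub>) \<longrightarrow> h = zero_hom P N"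
  shows "bij_betw (inl P) (lmod_hom R P M) (cocycles R (C_complex P) W)"
  unfolding bij_betw_def
proof (intro conjI inj_onI equalityI subsetI)
  note LP = fd_module_finite(1)[OF projective_fd[OF P]]
  interpret P: left_module R P by (rule LP)
  {
    fix g g' assume g: "g \<in> lmod_hom R P M" and g': "g' \<in> lmod_hom R P M" and eq: "inl P g = inl P g'"
    show "g = g'"
    proof (rule lmod_hom_eqI[OF g g'])
      show "g x = g' x" if "x \<in> carrier P" for x
        using fun_cong[OF eq, of x] that by simp
    qed
  next
    fix c assume "c \<in> inl P ` lmod_hom R P M"
    then obtain g where g: "g \<in> lmod_hom R P M" "c = inl P g"
      by blast
    have "compose (carrier P) (restrict (\<lambda>x. (x, \<zero>\<^bsub>N\<^esub>)) (carrier M)) g = c"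
      using lmod_hom_closed[OF g(1)] by (auto simp: g(2) compose_def fun_eq_iff)
    then have "c \<in> lmod_hom R P (direct_sum M N)"
      using lmod_hom_comp[OF g(1) direct_sum_homs(3)[OF LM LN] LP] by simp
    then show "c \<in> cocycles R (C_complex P) W"
      using lmod_hom_closed[OF g(1)]
      by (simp add: cocycles_def fst_C_complex fst_W snd_C_complex snd_W g(2) lmod_hom_zero[OF LN LM f(1)]
          lmod_hom_zero[OF LP LM g(1)] direct_sum_simps)
  next
    fix c assume c: "c \<in> cocycles R (C_complex P) W"
    have c1: "c \<in> lmod_hom R P (direct_sum M N)"
      using cocyclesD(1)[OF c] by (simp only: fst_C_complex fst_W)
    have cl: "fst (c x) \<in> carrier M" "snd (c x) \<in> carrier N" if "x \<in> carrier P" for x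
      using lmod_hom_closed[OF c1 that] by (auto simp: direct_sum_simps)
    let ?g = "restrict (\<lambda>x. fst (c x)) (carrier P)" and ?h = "restrict (\<lambda>x. snd (c x)) (carrier P)"
    have g: "?g \<in> lmod_hom R P M"
      using lmod_hom_comp[OF c1 direct_sum_homs(1)[OF LM LN] LP] lmod_hom_closed[OF c1]
      by (simp add: compose_def cong: restrict_cong)
    have h: "?h \<in> lmod_hom R P N"
      using lmod_hom_comp[OF c1 direct_sum_homs(2)[OF LM LN] LP] lmod_hom_closed[OF c1]
      by (simp add: compose_def cong: restrict_cong)
    have c0: "c \<zero>\<^bsub>P\<^esub> = (\<zero>\<^bsub>M\<^esub>, \<zero>\<^bsub>N\<^esub>)"
      using lmod_hom_zero[OF LP left_module_direct_sum[OF LM LN] c1] by (simp add: direct_sum_simps)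
    have "f (snd (c x)) = \<zero>\<^bsub>M\<^esub>" if x: "x \<in> carrier P" for x
    proof -
      have "snd W (fst (c x), snd (c x)) \<oplus>\<^bsub>direct_sum M N\<^esub> (\<zero>\<^bsub>M\<^esub>, \<zero>\<^bsub>N\<^esub>) = (\<zero>\<^bsub>M\<^esub>, \<zero>\<^bsub>N\<^esub>)"
        using cocyclesD(2)[OF c, of x] x c0 by (simp add: fst_C_complex snd_C_complex fst_W direct_sum_simps)
      then show ?thesis
        using cl[OF x] by (cases "c x") (simp add: snd_W direct_sum_simps lmod_hom_closed[OF f(1)])
    qed
    then have h0: "?h = zero_hom P N"
      by (intro zero[rule_format, OF h]) simp
    have "snd (c x) = \<zero>\<^bsub>N\<^esub>" if "x \<in> carrier P" for x
      using fun_cong[OF h0, of x] that by simp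
    then have "c = inl P ?g"
      using lmod_hom_extensional[OF c1]
      by (intro extensionalityI[of _ "carrier P"]) (simp_all add: prod_eq_iff)
    then show "c \<in> inl P ` lmod_hom R P M"
      using g by blast
  }
qed

text \<open>A cocycle out of \<open>W\<close> has to kill the image of the differential, which lies
  in \<open>M\<close>; its restriction \<open>h\<close> to \<open>M\<close> thus satisfies
  \<open>h f = 0\<close> and vanishes, and the restriction to \<open>N\<close> stays free.\<close>

lemma cocycles_from_W:
  assumes P: "projective_module R P"
    and zero: "\<forall>h\<in>lmod_hom R M P. (\<forall>x\<in>carrier N. h (f x) = \<zero>\<^bsub>P\<^esub>) \<longrightarrow> h = zero_hom M P"
  shows "bij_betw on_snd (lmod_hom R N P) (cocycles R W (C_complex P))"
  unfolding bij_betw_def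
proof (intro conjI inj_onI equalityI subsetI)
  note LP = fd_module_finite(1)[OF projective_fd[OF P]]
  interpret P: left_module R P by (rule LP)
  {
    fix g g' assume g: "g \<in> lmod_hom R N P" and g': "g' \<in> lmod_hom R N P" and eq: "on_snd g = on_snd g'"
    show "g = g'"
    proof (rule lmod_hom_eqI[OF g g'])
      show "g x = g' x" if "x \<in> carrier N" for x
        using fun_cong[OF eq, of "(\<zero>\<^bsub>M\<^esub>, x)"] that by (simp add: direct_sum_simps)
    qed
  next
    fix c assume "c \<in> on_snd ` lmod_hom R N P"
    then obtain g where g: "g \<in> lmod_hom R N P" "c = on_snd g"
      by blast
    have "compose (carrier (direct_sum M N)) g (restrict snd (carrier (direct_sum M N))) = c"
      by (auto simp: g(2) compose_def fun_eq_iff)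
    then have c: "c \<in> lmod_hom R (direct_sum M N) P"
      using lmod_hom_comp[OF direct_sum_homs(2)[OF LM LN] g(1) left_module_direct_sum[OF LM LN]] by simp
    have "c (snd W p) = \<zero>\<^bsub>P\<^esub>" if "p \<in> carrier (direct_sum M N)" for p
      using that by (auto simp: snd_W g(2) direct_sum_simps lmod_hom_zero[OF LN LP g(1)] lmod_hom_closed[OF f(1)])
    then show "c \<in> cocycles R W (C_complex P)"
      using c by (simp add: cocycles_def fst_C_complex fst_W snd_C_complex lmod_hom_closed[OF c])
  next
    fix c assume c: "c \<in> cocycles R W (C_complex P)"
    have c1: "c \<in> lmod_hom R (direct_sum M N) P"
      using cocyclesD(1)[OF c] by (simp only: fst_C_complex fst_W)
    let ?h = "restrict (\<lambda>x. c (x, \<zero>\<^bsub>N\<^esub>)) (carrier M)" and ?g = "restrict (\<lambda>x. c (\<zero>\<^bsub>M\<^esub>, x)) (carrier N)"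
    have h: "?h \<in> lmod_hom R M P"
      using lmod_hom_comp[OF direct_sum_homs(3)[OF LM LN] c1 LM] by (simp add: compose_def cong: restrict_cong)
    have g: "?g \<in> lmod_hom R N P"
      using lmod_hom_comp[OF direct_sum_homs(4)[OF LM LN] c1 LN] by (simp add: compose_def cong: restrict_cong)
    have "?h (f x) = \<zero>\<^bsub>P\<^esub>" if x: "x \<in> carrier N" for x
      using cocyclesD(2)[OF c, of "(\<zero>\<^bsub>M\<^esub>, x)"] x lmod_hom_closed[OF c1, of "(\<zero>\<^bsub>M\<^esub>, x)"]
        lmod_hom_closed[OF c1, of "(f x, \<zero>\<^bsub>N\<^esub>)"] lmod_hom_closed[OF f(1) x]
      by (simp add: fst_W fst_C_complex snd_C_complex snd_W direct_sum_simps)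
    then have h0: "?h = zero_hom M P"
      by (rule zero[rule_format, OF h])
    have "c (x, \<zero>\<^bsub>N\<^esub>) = \<zero>\<^bsub>P\<^esub>" if "x \<in> carrier M" for x
      using fun_cong[OF h0, of x] that by simp
    moreover have "c (\<zero>\<^bsub>M\<^esub>, y) \<in> carrier P" if "y \<in> carrier N" for y
      using that by (intro lmod_hom_closed[OF c1]) (simp add: direct_sum_simps)
    ultimately have cg: "c (x, y) = ?g y" if "x \<in> carrier M" "y \<in> carrier N" for x y
      using lmod_hom_direct_sum_eq[OF LM LN LP c1 that] that by simp
    have "c = on_snd ?g"
    proof (rule extensionalityI[OF lmod_hom_extensional[OF c1]])
      show "c p = on_snd ?g p" if "p \<in> carrier (direct_sum M N)" for p
        using that cg[of "fst p" "snd p"] by (cases p) (simp add: direct_sum_simps)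
    qed simp
    then show "c \<in> on_snd ` lmod_hom R N P"
      using g by blast
  }
qed

section \<open>Products of the classes at a linked pair\<close>

lemma card_hom_MN: "card (lmod_hom R M N) = 1"
  by (simp add: hom_MN)

lemma q_pos: "q > 0"
  using f(1) finite_lmod_hom[OF finN finM] card_hom_NM card_gt_0_iff by fastforce

lemma sum_zero_nonzero:
  fixes F :: "'x \<Rightarrow> complex"
  assumes "finite S" "z \<in> S" "card S = q" "\<And>g. \<lbrakk>g \<in> S; g \<noteq> z\<rbrakk> \<Longrightarrow> F g = B"
  shows "sum F S = F z + (of_nat q - 1) * B"
proof -
  have "sum F S = F z + sum F (S - {z})"
    using assms(1,2) by (rule sum.remove)
  also have "sum F (S - {z}) = (\<Sum>g\<in>S - {z}. B)"
    using assms(4) by (intro sum.cong) auto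
  also have "\<dots> = (of_nat q - 1) * B"
    using assms(1-3) q_pos by (simp add: card_Diff_singleton of_nat_diff)
  finally show ?thesis .
qed

lemma mult_X_Y: "wc X \<otimes>\<^bsub>H\<^esub> wc Y = wc (ext_complex X Y (zero_hom M N))"
  using weighted_class_mult_trivial[OF pc_X pc_Y] by (simp only: fst_C_complex hom_MN)

text \<open>A nonzero cocycle is \<open>a f\<close> with an automorphism \<open>a\<close> of
  \<open>M\<close>, and \<open>a\<close> on \<open>M\<close> together with the identity on
  \<open>N\<close> maps \<open>W\<close> onto its extension. The zero cocycle gives the direct sum,
  the only term of the product in the other order.\<close>

lemma mult_Y_X:
  "wc Y \<otimes>\<^bsub>H\<^esub> wc X = (\<lambda>\<gamma>. ((wc X \<otimes>\<^bsub>H\<^esub> wc Y) \<gamma> + (of_nat q - 1) * wc W \<gamma>) / of_nat q)"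
proof
  fix \<gamma>
  let ?Z = "zero_hom N M"
  have Z: "?Z \<in> lmod_hom R N M"
    by (rule lmod_hom_const_zero[OF LN LM])
  have "wc (ext_complex Y X g) = wc W" if g: "g \<in> lmod_hom R N M" "g \<noteq> ?Z" for g
  proof (rule weighted_class_cong[OF _ pc_W])
    show pc: "projective_complex R (ext_complex Y X g)"
      using g by (intro projective_complex_ext[OF pc_Y pc_X]) (simp add: cocycles_C[OF N M])
    obtain a where a: "a \<in> lmod_hom R M M" "\<And>x. x \<in> carrier N \<Longrightarrow> g x = a (f x)"
      using f_post[OF g(1)] by blast
    have "a \<noteq> zero_hom M M"
    proof
      assume "a = zero_hom M M"
      then have "g = ?Z"
        using a(2) lmod_hom_closed[OF f(1)] by (intro zero_homI[OF g(1)]) simp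
      with g(2) show False ..
    qed
    then have bij: "bij_betw a (carrier M) (carrier M)"
      by (rule end_bij(1)[OF a(1)])
    show "C1_isos R (ext_complex Y X g) W \<noteq> {}"
    proof (rule C1_isos_sym[OF pc_W pc], rule C1_isosI_inj[OF pc_W pc])
      let ?t = "restrict (\<lambda>(m, x). (a m, x)) (carrier (direct_sum M N))"
      show "?t \<in> lmod_hom R (fst W) (fst (ext_complex Y X g))"
        unfolding fst_W fst_ext_complex fst_C_complex
        by (rule lmod_homI) (auto simp: direct_sum_simps lmod_hom_closed[OF a(1)] lmod_hom_add[OF a(1)]
            lmod_hom_smult[OF a(1)] M.smult_closed N.smult_closed)
      show "?t (snd W p) = snd (ext_complex Y X g) (?t p)" if "p \<in> carrier (fst W)" for p
        using that a by (auto simp: fst_W snd_W direct_sum_simps ext_complex_simps fst_C_complex snd_C_complex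
            lmod_hom_closed[OF f(1)] lmod_hom_closed[OF a(1)])
      show "inj_on ?t (carrier (fst W))"
        using bij by (auto intro!: inj_onI simp: fst_W direct_sum_simps bij_betw_def dest: inj_onD)
      show "card (carrier (fst W)) = card (carrier (fst (ext_complex Y X g)))"
        by (simp add: fst_ext_complex)
    qed
  qed
  then have "(\<Sum>g\<in>lmod_hom R N M. wc (ext_complex Y X g) \<gamma>)
      = wc (ext_complex Y X ?Z) \<gamma> + (of_nat q - 1) * wc W \<gamma>"
    using finite_lmod_hom[OF finN finM] Z card_hom_NM by (intro sum_zero_nonzero) simp_all
  moreover have "wc (ext_complex Y X ?Z) = wc X \<otimes>\<^bsub>H\<^esub> wc Y"
    unfolding mult_X_Y
    using weighted_class_cong[OF _ _ ext_complex_swap[OF pc_Y pc_X]]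
      projective_complex_ext[OF pc_Y pc_X zero_hom_cocycle[OF pc_Y pc_X]]
      projective_complex_ext[OF pc_X pc_Y zero_hom_cocycle[OF pc_X pc_Y]]
    by (simp only: fst_C_complex)
  ultimately show "(wc Y \<otimes>\<^bsub>H\<^esub> wc X) \<gamma> = ((wc X \<otimes>\<^bsub>H\<^esub> wc Y) \<gamma> + (of_nat q - 1) * wc W \<gamma>) / of_nat q"
    by (simp add: weighted_class_mult[OF pc_Y pc_X] cocycles_C[OF N M] fst_C_complex card_hom_NM)
qed

lemma zero_hom_inl: "inl P (zero_hom P M) = zero_hom P (direct_sum M N)"
  by (auto simp: direct_sum_simps fun_eq_iff)

lemma zero_hom_on_snd: "on_snd (zero_hom N P) = zero_hom (direct_sum M N) P"
  by (auto simp: direct_sum_simps fun_eq_iff)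

lemma pc_ext_inl:
  assumes P: "projective_module R P"
    and zero: "\<forall>h\<in>lmod_hom R P N. (\<forall>x\<in>carrier P. f (h x) = \<zero>\<^bsub>M\<^esub>) \<longrightarrow> h = zero_hom P N"
    and g: "g \<in> lmod_hom R P M"
  shows "inl P g \<in> cocycles R (C_complex P) W" "projective_complex R (ext_complex (C_complex P) W (inl P g))"
proof -
  show "inl P g \<in> cocycles R (C_complex P) W"
    using bij_betwE[OF cocycles_into_W[OF P zero]] g by blast
  then show "projective_complex R (ext_complex (C_complex P) W (inl P g))"
    by (rule projective_complex_ext[OF projective_complex_C[OF P] pc_W])
qed

lemma pc_ext_on_snd:
  assumes P: "projective_module R P"
    and zero: "\<forall>h\<in>lmod_hom R M P. (\<forall>x\<in>carrier N. h (f x) = \<zero>\<^bsub>P\<^esub>) \<longrightarrow> h = zero_hom M P"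
    and g: "g \<in> lmod_hom R N P"
  shows "on_snd g \<in> cocycles R W (C_complex P)" "projective_complex R (ext_complex W (C_complex P) (on_snd g))"
proof -
  show "on_snd g \<in> cocycles R W (C_complex P)"
    using bij_betwE[OF cocycles_from_W[OF P zero]] g by blast
  then show "projective_complex R (ext_complex W (C_complex P) (on_snd g))"
    by (rule projective_complex_ext[OF pc_W projective_complex_C[OF P]])
qed

lemma MN_zero:
  "\<forall>h\<in>lmod_hom R M N. (\<forall>x\<in>carrier M. f (h x) = \<zero>\<^bsub>M\<^esub>) \<longrightarrow> h = zero_hom M N"
  "\<forall>h\<in>lmod_hom R M N. (\<forall>x\<in>carrier N. h (f x) = \<zero>\<^bsub>N\<^esub>) \<longrightarrow> h = zero_hom M N"
  using hom_MN by blast+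

lemma ext_W_swap:
  assumes P: "projective_module R P"
  shows "wc (ext_complex (C_complex P) W (zero_hom P (direct_sum M N)))
    = wc (ext_complex W (C_complex P) (zero_hom (direct_sum M N) P))"
proof -
  note C = projective_complex_C[OF P]
  show ?thesis
    using weighted_class_cong[OF projective_complex_ext[OF C pc_W zero_hom_cocycle[OF C pc_W]]
        projective_complex_ext[OF pc_W C zero_hom_cocycle[OF pc_W C]] ext_complex_swap[OF C pc_W]]
    by (simp only: fst_C_complex fst_W)
qed

lemma mult_into_W:
  assumes P: "projective_module R P"
    and zero: "\<forall>h\<in>lmod_hom R P N. (\<forall>x\<in>carrier P. f (h x) = \<zero>\<^bsub>M\<^esub>) \<longrightarrow> h = zero_hom P N"
  shows "(wc (C_complex P) \<otimes>\<^bsub>H\<^esub> wc W) \<gamma>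
    = (\<Sum>g\<in>lmod_hom R P M. wc (ext_complex (C_complex P) W (inl P g)) \<gamma>)
      / of_nat (card (lmod_hom R P M) * card (lmod_hom R P N))"
proof -
  note LP = fd_module_finite(1)[OF projective_fd[OF P]]
  have "(\<Sum>g\<in>lmod_hom R P M. wc (ext_complex (C_complex P) W (inl P g)) \<gamma>)
      = (\<Sum>c\<in>cocycles R (C_complex P) W. wc (ext_complex (C_complex P) W c) \<gamma>)"
    by (rule sum.reindex_bij_betw[OF cocycles_into_W[OF P zero]])
  then show ?thesis
    by (simp add: weighted_class_mult[OF projective_complex_C[OF P] pc_W] fst_C_complex fst_W
        card_lmod_hom_direct_sum_codomain[OF LP LM LN])
qed

lemma mult_from_W:
  assumes P: "projective_module R P"
    and zero: "\<forall>h\<in>lmod_hom R M P. (\<forall>x\<in>carrier N. h (f x) = \<zero>\<^bsub>P\<^esub>) \<longrightarrow> h = zero_hom M P"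
  shows "(wc W \<otimes>\<^bsub>H\<^esub> wc (C_complex P)) \<gamma>
    = (\<Sum>g\<in>lmod_hom R N P. wc (ext_complex W (C_complex P) (on_snd g)) \<gamma>)
      / of_nat (card (lmod_hom R M P) * card (lmod_hom R N P))"
proof -
  note LP = fd_module_finite(1)[OF projective_fd[OF P]]
  have "(\<Sum>g\<in>lmod_hom R N P. wc (ext_complex W (C_complex P) (on_snd g)) \<gamma>)
      = (\<Sum>c\<in>cocycles R W (C_complex P). wc (ext_complex W (C_complex P) c) \<gamma>)"
    by (rule sum.reindex_bij_betw[OF cocycles_from_W[OF P zero]])
  then show ?thesis
    by (simp add: weighted_class_mult[OF pc_W projective_complex_C[OF P]] fst_C_complex fst_W
        card_lmod_hom_direct_sum_domain[OF LP LM LN])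
qed

text \<open>Each cocycle \<open>(g, 0)\<close> with \<open>g = f b\<close> is the coboundary of
  \<open>(0, b)\<close>. So all \<open>q\<close> extensions split, and the denominator
  \<open>q * q\<close> leaves \<open>1 / q\<close>.\<close>

lemma mult_Y_W:
  "(wc Y \<otimes>\<^bsub>H\<^esub> wc W) \<gamma> = wc (ext_complex W Y (zero_hom (direct_sum M N) N)) \<gamma> / of_nat q"
proof -
  let ?V = "ext_complex Y W (zero_hom N (direct_sum M N))"
  note pc = pc_ext_inl[OF N pre_zero]
  have Z: "zero_hom N M \<in> lmod_hom R N M"
    by (rule lmod_hom_const_zero[OF LN LM])
  have "wc (ext_complex Y W (inl N g)) = wc ?V" if g: "g \<in> lmod_hom R N M" for g
  proof (rule weighted_class_cong[OF pc(2)[OF g]])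
    show "projective_complex R ?V"
      using pc(2)[OF Z] by (simp only: zero_hom_inl)
    obtain b where b: "b \<in> lmod_hom R N N" "\<And>x. x \<in> carrier N \<Longrightarrow> g x = f (b x)"
      using f_pre[OF g] by blast
    have h: "restrict (\<lambda>x. (\<zero>\<^bsub>M\<^esub>, b x)) (carrier N) \<in> lmod_hom R (fst Y) (fst W)"
      using lmod_hom_comp[OF b(1) direct_sum_homs(4)[OF LM LN] LN] lmod_hom_closed[OF b(1)]
      by (simp add: compose_def fst_C_complex fst_W cong: restrict_cong)
    show "C1_isos R (ext_complex Y W (inl N g)) ?V \<noteq> {}"
    proof (rule ext_complex_shear[OF pc_Y pc_W _ pc(1)[OF g] h])
      show "zero_hom N (direct_sum M N) \<in> cocycles R Y W"
        using pc(1)[OF Z] by (simp only: zero_hom_inl)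
    qed (simp add: fst_C_complex fst_W snd_C_complex snd_W direct_sum_simps b(2) lmod_hom_closed[OF b(1)]
        lmod_hom_closed[OF f(1)] lmod_hom_zero[OF LN LN b(1)])
  qed
  then show ?thesis
    using q_pos by (simp add: mult_into_W[OF N pre_zero] card_hom_NM card_end ext_W_swap[OF N])
qed

text \<open>As there are no nonzero homomorphisms from \<open>M\<close> to \<open>N\<close>, the
  direct sum of \<open>X\<close> and \<open>K_complex N\<close> is itself a product. In this form it
  lies in the ideal.\<close>

lemma mult_X_K: "wc X \<otimes>\<^bsub>H\<^esub> wc (K_complex N) = wc (ext_complex X (K_complex N) (zero_hom M (direct_sum N N)))"
  using weighted_class_mult_trivial[OF pc_X projective_complex_K[OF N]]
    lmod_hom_direct_sum_codomain_trivial[OF LM LN LN hom_MN hom_MN]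
  by (simp only: fst_C_complex fst_K_complex)

lemma mult_K_Y: "wc (K_complex M) \<otimes>\<^bsub>H\<^esub> wc Y = wc (ext_complex (K_complex M) Y (zero_hom (direct_sum M M) N))"
  using weighted_class_mult_trivial[OF projective_complex_K[OF M] pc_Y]
    lmod_hom_direct_sum_domain_trivial[OF LN LM LM hom_MN hom_MN]
  by (simp only: fst_C_complex fst_K_complex)

text \<open>The cocycles are the endomorphisms \<open>b\<close> of \<open>N\<close>. A nonzero
  \<open>b\<close> is invertible, so the differential identifies the copy of \<open>N\<close> in
  \<open>W\<close> with that of \<open>Y\<close>: a summand \<open>K_complex N\<close> splits off,
  with complement \<open>X\<close>. The denominator is only \<open>q\<close>, since the
  homomorphisms from \<open>M\<close> to \<open>N\<close> contribute a factor 1.\<close>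

lemma mult_W_Y:
  "(wc W \<otimes>\<^bsub>H\<^esub> wc Y) \<gamma> = (wc (ext_complex W Y (zero_hom (direct_sum M N) N)) \<gamma>
      + (of_nat q - 1) * (wc X \<otimes>\<^bsub>H\<^esub> wc (K_complex N)) \<gamma>) / of_nat q"
proof -
  let ?T = "ext_complex X (K_complex N) (zero_hom M (direct_sum N N))"
  note pc = pc_ext_on_snd[OF N MN_zero(2)]
  note pc_K = projective_complex_K[OF N]
  have pc_T: "projective_complex R ?T"
    using projective_complex_ext[OF pc_X pc_K zero_hom_cocycle[OF pc_X pc_K]]
    by (simp only: fst_C_complex fst_K_complex)
  have Z: "zero_hom N N \<in> lmod_hom R N N"
    by (rule lmod_hom_const_zero[OF LN LN])
  have T: "wc (ext_complex W Y (on_snd b)) = wc ?T" if b: "b \<in> lmod_hom R N N" "b \<noteq> zero_hom N N" for b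
  proof (rule weighted_class_cong[OF pc(2)[OF b(1)] pc_T], rule C1_isos_sym[OF pc_T pc(2)[OF b(1)]],
      rule C1_isosI_inj[OF pc_T pc(2)[OF b(1)]])
    note bij = end_bij(2)[OF b]
    note cl = lmod_hom_closed[OF b(1)] lmod_hom_closed[OF f(1)]
    let ?S = "direct_sum (direct_sum N N) M"
    \<comment> \<open>The second copy of \<open>N\<close> goes into \<open>W\<close>. Its
      differential \<open>(b y, (f y, 0))\<close> dictates the image of the first copy, and
      \<open>M\<close> is included unchanged.\<close>
    let ?t = "restrict (\<lambda>((x, y), m). (b x, (m \<oplus>\<^bsub>M\<^esub> f x, y))) (carrier ?S)"
    show "?t \<in> lmod_hom R (fst ?T) (fst (ext_complex W Y (on_snd b)))"
      unfolding fst_W fst_ext_complex fst_C_complex fst_K_complex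
      by (rule lmod_homI) (auto simp: direct_sum_simps cl lmod_hom_add[OF b(1)] lmod_hom_smult[OF b(1)]
          lmod_hom_add[OF f(1)] lmod_hom_smult[OF f(1)] M.smult_closed N.smult_closed M.smult_r_distr M.M.a_ac)
    show "?t (snd ?T p) = snd (ext_complex W Y (on_snd b)) (?t p)" if "p \<in> carrier (fst ?T)" for p
      using that by (auto simp: fst_W snd_W direct_sum_simps ext_complex_simps fst_C_complex snd_C_complex
          fst_K_complex snd_K_complex cl)
    show "inj_on ?t (carrier (fst ?T))"
    proof (rule inj_onI)
      fix p p' assume "p \<in> carrier (fst ?T)" "p' \<in> carrier (fst ?T)" and eq: "?t p = ?t p'"
      then obtain x y m x' y' m' where p: "p = ((x, y), m)" "x \<in> carrier N" "y \<in> carrier N" "m \<in> carrier M"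
        and p': "p' = ((x', y'), m')" "x' \<in> carrier N" "y' \<in> carrier N" "m' \<in> carrier M"
        by (auto simp: ext_complex_simps fst_C_complex fst_K_complex)
      have e: "b x = b x'" "m \<oplus>\<^bsub>M\<^esub> f x = m' \<oplus>\<^bsub>M\<^esub> f x'" "y = y'"
        using eq p p' by (simp_all add: direct_sum_simps)
      then have "x = x'"
        using bij p p' by (auto simp: bij_betw_def dest: inj_onD)
      with e p p' show "p = p'"
        by (simp add: cl)
    qed
    show "card (carrier (fst ?T)) = card (carrier (fst (ext_complex W Y (on_snd b))))"
      by (simp add: fst_W ext_complex_simps fst_C_complex fst_K_complex card_cartesian_product)
  qed
  have "(\<Sum>b\<in>lmod_hom R N N. wc (ext_complex W Y (on_snd b)) \<gamma>)
      = wc (ext_complex W Y (on_snd (zero_hom N N))) \<gamma> + (of_nat q - 1) * wc ?T \<gamma>"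
    by (rule sum_zero_nonzero[OF finite_lmod_hom[OF finN finN] Z card_end(2)]) (rule fun_cong[OF T])
  then show ?thesis
    by (simp only: mult_from_W[OF N MN_zero(2)] mult_X_K card_end card_hom_MN zero_hom_on_snd mult_1)
qed

text \<open>Dual to \<open>mult_Y_W\<close>: with \<open>g = a f\<close> the cocycle is, up to sign,
  the coboundary of \<open>a\<close> on the summand \<open>M\<close> of \<open>W\<close>, so all
  \<open>q\<close> extensions split.\<close>

lemma mult_W_X:
  "(wc W \<otimes>\<^bsub>H\<^esub> wc X) \<gamma> = wc (ext_complex W X (zero_hom (direct_sum M N) M)) \<gamma> / of_nat q"
proof -
  let ?V = "ext_complex W X (zero_hom (direct_sum M N) M)"
  note pc = pc_ext_on_snd[OF M post_zero]
  have Z: "zero_hom N M \<in> lmod_hom R N M"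
    by (rule lmod_hom_const_zero[OF LN LM])
  have "wc ?V = wc (ext_complex W X (on_snd g))" if g: "g \<in> lmod_hom R N M" for g
  proof (rule weighted_class_cong[OF _ pc(2)[OF g]])
    show "projective_complex R ?V"
      using pc(2)[OF Z] by (simp only: zero_hom_on_snd)
    obtain a where a: "a \<in> lmod_hom R M M" "\<And>x. x \<in> carrier N \<Longrightarrow> g x = a (f x)"
      using f_post[OF g] by blast
    have "compose (carrier (direct_sum M N)) a (restrict fst (carrier (direct_sum M N)))
        = restrict (\<lambda>(m, x). a m) (carrier (direct_sum M N))"
      by (auto simp: compose_def fun_eq_iff)
    then have h: "restrict (\<lambda>(m, x). a m) (carrier (direct_sum M N)) \<in> lmod_hom R (fst W) (fst X)"
      using lmod_hom_comp[OF direct_sum_homs(1)[OF LM LN] a(1) left_module_direct_sum[OF LM LN]]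
      by (simp only: fst_W fst_C_complex)
    show "C1_isos R ?V (ext_complex W X (on_snd g)) \<noteq> {}"
    proof (rule ext_complex_shear[OF pc_W pc_X pc(1)[OF g] _ h])
      show "zero_hom (direct_sum M N) M \<in> cocycles R W X"
        using pc(1)[OF Z] by (simp only: zero_hom_on_snd)
    qed (auto simp: fst_C_complex fst_W snd_C_complex snd_W direct_sum_simps a(2) lmod_hom_closed[OF a(1)]
        lmod_hom_closed[OF f(1)])
  qed
  then have "wc (ext_complex W X (on_snd g)) = wc ?V" if "g \<in> lmod_hom R N M" for g
    using that by simp
  then show ?thesis
    using q_pos by (simp add: mult_from_W[OF M post_zero] card_hom_NM card_end)
qed

text \<open>Dual to \<open>mult_W_Y\<close>: an invertible \<open>a\<close> joins the two copies of
  \<open>M\<close> to a summand \<open>K_complex M\<close>, with complement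
  \<open>Y\<close>.\<close>

lemma mult_X_W:
  "(wc X \<otimes>\<^bsub>H\<^esub> wc W) \<gamma> = (wc (ext_complex W X (zero_hom (direct_sum M N) M)) \<gamma>
      + (of_nat q - 1) * (wc (K_complex M) \<otimes>\<^bsub>H\<^esub> wc Y) \<gamma>) / of_nat q"
proof -
  let ?T = "ext_complex (K_complex M) Y (zero_hom (direct_sum M M) N)"
  note pc = pc_ext_inl[OF M MN_zero(1)]
  note pc_K = projective_complex_K[OF M]
  have pc_T: "projective_complex R ?T"
    using projective_complex_ext[OF pc_K pc_Y zero_hom_cocycle[OF pc_K pc_Y]]
    by (simp only: fst_C_complex fst_K_complex)
  have Z: "zero_hom M M \<in> lmod_hom R M M"
    by (rule lmod_hom_const_zero[OF LM LM])
  have T: "wc (ext_complex X W (inl M a)) = wc ?T" if a: "a \<in> lmod_hom R M M" "a \<noteq> zero_hom M M" for a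
  proof (rule weighted_class_cong[OF pc(2)[OF a(1)] pc_T], rule C1_isosI_inj[OF pc(2)[OF a(1)] pc_T])
    note bij = end_bij(1)[OF a]
    note cl = lmod_hom_closed[OF a(1)] lmod_hom_closed[OF f(1)]
    let ?S = "direct_sum (direct_sum M N) M"
    let ?E = "ext_complex X W (inl M a)"
    \<comment> \<open>The differential of \<open>?E\<close> has the single entry
      \<open>f x + a m'\<close>. Taking it as the second coordinate in \<open>K_complex M\<close>
      turns it into the standard differential, and invertibility of \<open>a\<close> allows
      \<open>m'\<close> to be recovered.\<close>
    let ?t = "restrict (\<lambda>((m, x), m'). (x, (m, f x \<oplus>\<^bsub>M\<^esub> a m'))) (carrier ?S)"
    show "?t \<in> lmod_hom R (fst ?E) (fst ?T)"
      unfolding fst_ext_complex fst_W fst_C_complex fst_K_complex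
      by (rule lmod_homI) (auto simp: direct_sum_simps cl lmod_hom_add[OF a(1)] lmod_hom_smult[OF a(1)]
          lmod_hom_add[OF f(1)] lmod_hom_smult[OF f(1)] M.smult_closed N.smult_closed M.smult_r_distr M.M.a_ac)
    show "?t (snd ?E p) = snd ?T (?t p)" if p: "p \<in> carrier (fst ?E)" for p
    proof -
      obtain m x m' where p: "p = ((m, x), m')" "m \<in> carrier M" "x \<in> carrier N" "m' \<in> carrier M"
        using p by (auto simp: ext_complex_simps fst_C_complex fst_W)
      have "snd ?E p = ((f x \<oplus>\<^bsub>M\<^esub> a m', \<zero>\<^bsub>N\<^esub>), \<zero>\<^bsub>M\<^esub>)"
        using p snd_ext_complex[of "(m, x)" W m' X "inl M a"]
        by (simp add: fst_W snd_W fst_C_complex snd_C_complex direct_sum_simps)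
      then show ?thesis
        using p by (simp add: direct_sum_simps ext_complex_simps fst_C_complex snd_C_complex
          fst_K_complex snd_K_complex cl lmod_hom_zero[OF LN LM f(1)] lmod_hom_zero[OF LM LM a(1)])
    qed
    show "inj_on ?t (carrier (fst ?E))"
    proof (rule inj_onI)
      fix p p' assume "p \<in> carrier (fst ?E)" "p' \<in> carrier (fst ?E)" and eq: "?t p = ?t p'"
      then obtain x m n x' m' n' where p: "p = ((m, x), n)" "m \<in> carrier M" "x \<in> carrier N" "n \<in> carrier M"
        and p': "p' = ((m', x'), n')" "m' \<in> carrier M" "x' \<in> carrier N" "n' \<in> carrier M"
        by (auto simp: ext_complex_simps fst_C_complex fst_W)
      have e: "f x \<oplus>\<^bsub>M\<^esub> a n = f x' \<oplus>\<^bsub>M\<^esub> a n'" "m = m'" "x = x'"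
        using eq p p' by (auto simp: direct_sum_simps)
      then have "a n = a n'"
        using p p' by (simp add: cl)
      then have "n = n'"
        using bij p p' by (auto simp: bij_betw_def dest: inj_onD)
      with e p p' show "p = p'"
        by simp
    qed
    show "card (carrier (fst ?E)) = card (carrier (fst ?T))"
      by (simp add: fst_W ext_complex_simps fst_C_complex fst_K_complex card_cartesian_product)
  qed
  have "(\<Sum>a\<in>lmod_hom R M M. wc (ext_complex X W (inl M a)) \<gamma>)
      = wc (ext_complex X W (inl M (zero_hom M M))) \<gamma> + (of_nat q - 1) * wc ?T \<gamma>"
    by (rule sum_zero_nonzero[OF finite_lmod_hom[OF finM finM] Z card_end(1)]) (rule fun_cong[OF T])
  then show ?thesis
    by (simp only: mult_into_W[OF M MN_zero(1)] mult_K_Y card_end card_hom_MN zero_hom_inl mult_1_right ext_W_swap[OF M])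
qed

end

section \<open>Scalars in the Hall algebra and in its quotients\<close>

lemma hall_algebra_simps:
  "(f \<oplus>\<^bsub>hall_algebra R\<^esub> g) = (\<lambda>\<gamma>. f \<gamma> + g \<gamma>)"
  "(c \<odot>\<^bsub>hall_algebra R\<^esub> f) = (\<lambda>\<gamma>. c * f \<gamma>)"
  "\<zero>\<^bsub>hall_algebra R\<^esub> = (\<lambda>\<gamma>. 0)"
  by (simp_all add: hall_algebra_def)

lemma hall_smult_closed:
  assumes "f \<in> carrier (hall_algebra R)"
  shows "c \<odot>\<^bsub>hall_algebra R\<^esub> f \<in> carrier (hall_algebra R)"
proof -
  have "{\<alpha>. c * f \<alpha> \<noteq> 0} \<subseteq> {\<alpha>. f \<alpha> \<noteq> 0}"
    by auto
  then show ?thesis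
    using assms by (auto simp: hall_algebra_def intro: finite_subset)
qed

lemma hall_smult_mult:
  "(c \<odot>\<^bsub>hall_algebra R\<^esub> f) \<otimes>\<^bsub>hall_algebra R\<^esub> g = c \<odot>\<^bsub>hall_algebra R\<^esub> (f \<otimes>\<^bsub>hall_algebra R\<^esub> g)"
  "f \<otimes>\<^bsub>hall_algebra R\<^esub> (c \<odot>\<^bsub>hall_algebra R\<^esub> g) = c \<odot>\<^bsub>hall_algebra R\<^esub> (f \<otimes>\<^bsub>hall_algebra R\<^esub> g)"
  \<comment> \<open>The sums in the product run over supports; scaling preserves the support for
    nonzero \<open>c\<close> and empties it for \<open>c = 0\<close>.\<close>
  by (cases "c = 0"; auto simp: hall_algebra_def sum_distrib_left mult_ac fun_eq_iff)+

lemma hall_smult_smult: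
  "c \<odot>\<^bsub>hall_algebra R\<^esub> (c' \<odot>\<^bsub>hall_algebra R\<^esub> f) = (c * c') \<odot>\<^bsub>hall_algebra R\<^esub> f"
  by (simp add: hall_algebra_simps mult.assoc)

locale hall_ideal = ideal I "hall_algebra R" for R :: "('k::{field,finite}, 'a) module" and I
begin

abbreviation "H \<equiv> hall_algebra R"

abbreviation hall_mult (infixl \<open>\<star>\<close> 70) where
  "a \<star> b \<equiv> a \<otimes>\<^bsub>H\<^esub> b"

lemma uminus_apply: "b \<in> carrier H \<Longrightarrow> \<ominus>\<^bsub>H\<^esub> b = (\<lambda>\<gamma>. - b \<gamma>)"
  using r_neg[of b] by (auto simp: hall_algebra_simps fun_eq_iff add_eq_0_iff)

lemma minus_apply: "b \<in> carrier H \<Longrightarrow> a \<ominus>\<^bsub>H\<^esub> b = (\<lambda>\<gamma>. a \<gamma> - b \<gamma>)"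
  by (simp add: a_minus_def uminus_apply hall_algebra_simps)

text \<open>An ideal is closed under multiplication by ring elements; complex scalars reach it as
  multiples of the unit.\<close>

lemma smult_ideal:
  assumes "a \<in> I"
  shows "c \<odot>\<^bsub>H\<^esub> a \<in> I"
proof -
  have "c \<odot>\<^bsub>H\<^esub> a = (c \<odot>\<^bsub>H\<^esub> \<one>\<^bsub>H\<^esub>) \<otimes>\<^bsub>H\<^esub> a"
    using Icarr[OF assms] by (simp add: hall_smult_mult)
  then show ?thesis
    using I_l_closed[OF assms] hall_smult_closed[OF one_closed] by simp
qed

abbreviation "A \<equiv> quotient_algebra H I"
abbreviation cl where "cl a \<equiv> I +>\<^bsub>H\<^esub> a"

lemma quotient_algebra_simps:
  "carrier A = carrier (H Quot I)" "mult A = mult (H Quot I)" "one A = one (H Quot I)"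
  "zero A = zero (H Quot I)" "add A = add (H Quot I)" "a_inv A a = a_inv (H Quot I) a"
  by (simp_all add: quotient_algebra_def ring.defs a_inv_def m_inv_def)

lemma cl_mult: "\<lbrakk>a \<in> carrier H; b \<in> carrier H\<rbrakk> \<Longrightarrow> cl a \<otimes>\<^bsub>A\<^esub> cl b = cl (a \<otimes>\<^bsub>H\<^esub> b)"
  by (simp add: quotient_algebra_simps FactRing_def rcoset_mult_add)

lemma cl_add: "\<lbrakk>a \<in> carrier H; b \<in> carrier H\<rbrakk> \<Longrightarrow> cl a \<oplus>\<^bsub>A\<^esub> cl b = cl (a \<oplus>\<^bsub>H\<^esub> b)"
  by (simp add: quotient_algebra_simps FactRing_def a_rcos_sum)

lemma cl_minus:
  assumes a: "a \<in> carrier H" and b: "b \<in> carrier H"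
  shows "cl a \<ominus>\<^bsub>A\<^esub> cl b = cl (a \<ominus>\<^bsub>H\<^esub> b)"
proof -
  interpret Q: ring "H Quot I"
    by (rule quotient_is_ring)
  have "cl (\<ominus>\<^bsub>H\<^esub> b) \<oplus>\<^bsub>A\<^esub> cl b = cl \<zero>\<^bsub>H\<^esub>"
    using b by (simp add: cl_add l_neg)
  also have "\<dots> = \<zero>\<^bsub>A\<^esub>"
    by (simp add: quotient_algebra_simps FactRing_def a_rcos_const)
  finally have "\<ominus>\<^bsub>A\<^esub> cl b = cl (\<ominus>\<^bsub>H\<^esub> b)"
    using b ring_hom_closed[OF rcos_ring_hom] unfolding quotient_algebra_simps
    by (intro Q.minus_equality) simp_all
  then show ?thesis
    using a b by (simp add: a_minus_def cl_add)
qed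

lemma cl_square:
  assumes "a \<in> carrier H"
  shows "cl a [^]\<^bsub>A\<^esub> (2::nat) = cl (a \<otimes>\<^bsub>H\<^esub> a)"
proof -
  have "\<one>\<^bsub>A\<^esub> = cl \<one>\<^bsub>H\<^esub>"
    by (simp add: quotient_algebra_simps FactRing_def)
  then show ?thesis
    using assms by (simp add: nat_pow_def numeral_2_eq_2 cl_mult)
qed

text \<open>The quotient takes the union over all representatives. They all contribute the same
  coset, because \<open>I\<close> is closed under scalars.\<close>

lemma cl_smult:
  assumes a: "a \<in> carrier H"
  shows "c \<odot>\<^bsub>A\<^esub> cl a = cl (c \<odot>\<^bsub>H\<^esub> a)"
proof -
  have "cl (c \<odot>\<^bsub>H\<^esub> x) = cl (c \<odot>\<^bsub>H\<^esub> a)" if "x \<in> cl a" for x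
  proof -
    have "\<exists>i\<in>I. x = i \<oplus>\<^bsub>H\<^esub> a"
      using that unfolding a_r_coset_def' by blast
    then obtain i where i: "i \<in> I" "x = i \<oplus>\<^bsub>H\<^esub> a"
      by blast
    have "c \<odot>\<^bsub>H\<^esub> x = (c \<odot>\<^bsub>H\<^esub> i) \<oplus>\<^bsub>H\<^esub> (c \<odot>\<^bsub>H\<^esub> a)"
      by (simp add: i(2) hall_algebra_simps distrib_left)
    then have "c \<odot>\<^bsub>H\<^esub> x \<in> cl (c \<odot>\<^bsub>H\<^esub> a)"
      using smult_ideal[OF i(1)] by (auto simp: a_r_coset_def')
    then show ?thesis
      using a_repr_independence[OF _ hall_smult_closed[OF a]] a_subgroup by metis
  qed
  then have "(\<Union>x\<in>cl a. cl (c \<odot>\<^bsub>H\<^esub> x)) = (\<Union>x\<in>cl a. cl (c \<odot>\<^bsub>H\<^esub> a))"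
    by (intro SUP_cong refl)
  also have "\<dots> = cl (c \<odot>\<^bsub>H\<^esub> a)"
    using a_rcos_self[OF a] by (intro UN_constant_eq) blast+
  finally show ?thesis
    by (simp add: quotient_algebra_def ring.defs)
qed

lemma cl_eq_zero: "a \<in> I \<Longrightarrow> cl a = \<zero>\<^bsub>A\<^esub>"
  by (simp add: quotient_algebra_simps FactRing_def a_rcos_const)

text \<open>The brackets follow the squares in the quotient, each of which \<open>cl_square\<close>
  turns into a single product.\<close>

abbreviation serre1 where
  "serre1 (q :: nat) x y \<equiv> x \<star> (y \<star> y) \<ominus>\<^bsub>H\<^esub> of_nat (q + 1) \<odot>\<^bsub>H\<^esub> (y \<star> x \<star> y)
        \<oplus>\<^bsub>H\<^esub> of_nat q \<odot>\<^bsub>H\<^esub> ((y \<star> y) \<star> x)"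

abbreviation serre2 where
  "serre2 (q :: nat) x y \<equiv> of_nat q \<odot>\<^bsub>H\<^esub> (y \<star> (x \<star> x)) \<ominus>\<^bsub>H\<^esub> of_nat (q + 1) \<odot>\<^bsub>H\<^esub> (x \<star> y \<star> x)
        \<oplus>\<^bsub>H\<^esub> (x \<star> x) \<star> y"

text \<open>The two relations say that \<open>w\<close>, essentially a \<open>q\<close>-commutator of \<open>y\<close> and \<open>x\<close>, commutes with \<open>y\<close>
  and with \<open>x\<close> modulo \<open>I\<close>.\<close>

lemma serre_in_ideal:
  fixes q :: nat
  assumes x: "x \<in> carrier H" and y: "y \<in> carrier H" and w: "w \<in> carrier H" and q: "q > 0"
    and yx: "\<And>\<gamma>. (y \<star> x) \<gamma> = ((x \<star> y) \<gamma> + (of_nat q - 1) * w \<gamma>) / of_nat q"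
    and t: "t \<in> I" "\<And>\<gamma>. (w \<star> y) \<gamma> = (y \<star> w) \<gamma> + (of_nat q - 1) / of_nat q * t \<gamma>"
    and s: "s \<in> I" "\<And>\<gamma>. (x \<star> w) \<gamma> = (w \<star> x) \<gamma> + (of_nat q - 1) / of_nat q * s \<gamma>"
  shows "serre1 q x y \<in> I"
    and "serre2 q x y \<in> I"
proof -
  let ?q = "of_nat q :: complex"
  have "y \<star> x = (1 / ?q) \<odot>\<^bsub>H\<^esub> (x \<star> y \<oplus>\<^bsub>H\<^esub> (?q - 1) \<odot>\<^bsub>H\<^esub> w)"
    by (simp add: yx hall_algebra_simps fun_eq_iff)
  then have yx': "?q \<odot>\<^bsub>H\<^esub> (y \<star> x) = x \<star> y \<oplus>\<^bsub>H\<^esub> (?q - 1) \<odot>\<^bsub>H\<^esub> w"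
    using q by (simp add: hall_algebra_simps fun_eq_iff)
  have cw: "(?q - 1) \<odot>\<^bsub>H\<^esub> w \<in> carrier H"
    by (rule hall_smult_closed[OF w])
  have right: "?q * (y \<star> x \<star> z) \<gamma> = (x \<star> y \<star> z) \<gamma> + (?q - 1) * (w \<star> z) \<gamma>"
    if z: "z \<in> carrier H" for z \<gamma>
  proof -
    have "?q \<odot>\<^bsub>H\<^esub> (y \<star> x \<star> z) = (x \<star> y \<oplus>\<^bsub>H\<^esub> (?q - 1) \<odot>\<^bsub>H\<^esub> w) \<star> z"
      by (simp only: hall_smult_mult(1)[where c = ?q and f = "y \<star> x" and g = z, symmetric] yx')
    also have "\<dots> = x \<star> y \<star> z \<oplus>\<^bsub>H\<^esub> (?q - 1) \<odot>\<^bsub>H\<^esub> (w \<star> z)"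
      using x y z cw by (simp add: l_distr hall_smult_mult(1))
    finally show ?thesis
      by (simp add: hall_algebra_simps fun_eq_iff)
  qed
  have left: "?q * (z \<star> (y \<star> x)) \<gamma> = (z \<star> (x \<star> y)) \<gamma> + (?q - 1) * (z \<star> w) \<gamma>"
    if z: "z \<in> carrier H" for z \<gamma>
  proof -
    have "?q \<odot>\<^bsub>H\<^esub> (z \<star> (y \<star> x)) = z \<star> (x \<star> y \<oplus>\<^bsub>H\<^esub> (?q - 1) \<odot>\<^bsub>H\<^esub> w)"
      by (simp only: hall_smult_mult(2)[where c = ?q and f = z and g = "y \<star> x", symmetric] yx')
    also have "\<dots> = z \<star> (x \<star> y) \<oplus>\<^bsub>H\<^esub> (?q - 1) \<odot>\<^bsub>H\<^esub> (z \<star> w)"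
      using x y z cw by (simp add: r_distr hall_smult_mult(2))
    finally show ?thesis
      by (simp add: hall_algebra_simps fun_eq_iff)
  qed
  \<comment> \<open>One factor \<open>q - 1\<close> comes from
    \<open>(q - 1) w = q y x - x y\<close>, the other factor \<open>(q - 1) / q\<close> from the
    commutator of \<open>w\<close>.\<close>
  let ?c = "- ((?q - 1)^2 / ?q)"
  have q0: "?q \<noteq> 0"
    using q by simp
  \<comment> \<open>Serves both relations. \<open>a1\<close>, \<open>a2\<close>, \<open>a3\<close>
    are the coefficients of the monomials ordered by how often \<open>y\<close> has been moved past
    \<open>x\<close>, and \<open>v\<close>, \<open>v'\<close> those of \<open>w\<close> times the
    remaining letter in the two orders. The second relation is obtained by reading its terms
    backwards.\<close>
  have arith: "a1 - of_nat (q + 1) * a2 + ?q * a3 = ?c * u"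
    if a3: "?q * a3 = a2 + (?q - 1) * v" and a2: "?q * a2 = a1 + (?q - 1) * v'"
      and v': "v' = v + (?q - 1) / ?q * u" for a1 a2 a3 v v' u
  proof -
    have "a1 = ?q * a2 - (?q - 1) * v'"
      by (simp add: a2)
    then have "a1 - of_nat (q + 1) * a2 + ?q * a3 = (?q - 1) * (v - v')"
      unfolding a3 by (simp add: algebra_simps)
    also have "\<dots> = ?c * u"
      using q0 unfolding v' by (simp add: field_simps power2_eq_square)
    finally show ?thesis .
  qed
  have c1: "of_nat (q + 1) \<odot>\<^bsub>H\<^esub> (y \<star> x \<star> y) \<in> carrier H"
    and c2: "of_nat (q + 1) \<odot>\<^bsub>H\<^esub> (x \<star> y \<star> x) \<in> carrier H"
    using x y by (auto intro!: hall_smult_closed m_closed)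
  have "(x \<star> (y \<star> y)) \<gamma> - of_nat (q + 1) * (y \<star> x \<star> y) \<gamma>
      + ?q * ((y \<star> y) \<star> x) \<gamma> = ?c * t \<gamma>" for \<gamma>
  proof -
    have "?q * ((y \<star> y) \<star> x) \<gamma> = (y \<star> x \<star> y) \<gamma> + (?q - 1) * (y \<star> w) \<gamma>"
      using left[OF y, of \<gamma>] x y by (simp add: m_assoc)
    moreover have "?q * (y \<star> x \<star> y) \<gamma> = (x \<star> (y \<star> y)) \<gamma> + (?q - 1) * (w \<star> y) \<gamma>"
      using right[OF y, of \<gamma>] x y by (simp add: m_assoc)
    ultimately show ?thesis
      by (rule arith) (rule t(2))
  qed
  then have "serre1 q x y = ?c \<odot>\<^bsub>H\<^esub> t"
    unfolding minus_apply[OF c1] unfolding hall_algebra_simps by (intro ext)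
  then show "serre1 q x y \<in> I"
    using smult_ideal[OF t(1)] by simp
  have "?q * (y \<star> (x \<star> x)) \<gamma> - of_nat (q + 1) * (x \<star> y \<star> x) \<gamma>
      + ((x \<star> x) \<star> y) \<gamma> = ?c * s \<gamma>" for \<gamma>
  proof -
    have "?q * (y \<star> (x \<star> x)) \<gamma> = (x \<star> y \<star> x) \<gamma> + (?q - 1) * (w \<star> x) \<gamma>"
      using right[OF x, of \<gamma>] x y by (simp add: m_assoc)
    moreover have "?q * (x \<star> y \<star> x) \<gamma> = ((x \<star> x) \<star> y) \<gamma> + (?q - 1) * (x \<star> w) \<gamma>"
      using left[OF x, of \<gamma>] x y by (simp add: m_assoc)
    ultimately have "((x \<star> x) \<star> y) \<gamma> - of_nat (q + 1) * (x \<star> y \<star> x) \<gamma>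
        + ?q * (y \<star> (x \<star> x)) \<gamma> = ?c * s \<gamma>"
      by (rule arith) (rule s(2))
    then show ?thesis
      by (simp add: algebra_simps)
  qed
  then have "serre2 q x y = ?c \<odot>\<^bsub>H\<^esub> s"
    unfolding minus_apply[OF c2] unfolding hall_algebra_simps by (intro ext)
  then show "serre2 q x y \<in> I"
    using smult_ideal[OF s(1)] by simp
qed

end

section \<open>Multiplication in the path algebra\<close>

locale dynkin_path_algebra = ring A
  for Q :: "('v, 'e) pre_digraph"
    and A :: "('k::{field,finite}, ('v, 'e) qpath \<Rightarrow> 'k) module" (structure) +
  assumes dynkin: "dynkin_quiver Q" and finite_verts: "finite (verts Q)" and A_eq: "A = path_algebra Q"
begin

lemma qpaths_Nil_iff: "(u, [], v) \<in> qpaths Q \<longleftrightarrow> u \<in> verts Q \<and> v = u"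
  by (auto simp: qpaths_def pre_digraph.awalk_def pre_digraph.cas.simps)

lemma qpaths_unique: "\<lbrakk>(u, p, v) \<in> qpaths Q; (u, p', v) \<in> qpaths Q\<rbrakk> \<Longrightarrow> p = p'"
  using dynkin_awalk_unique[OF dynkin] by (simp add: qpaths_def)

lemma qpaths_verts: "(u, p, v) \<in> qpaths Q \<Longrightarrow> u \<in> verts Q \<and> v \<in> verts Q"
proof -
  interpret wf_digraph Q
    using dynkin by (simp add: dynkin_quiver_def)
  show "(u, p, v) \<in> qpaths Q \<Longrightarrow> u \<in> verts Q \<and> v \<in> verts Q"
    by (auto simp: qpaths_def dest: awalk_hd_in_verts awalk_last_in_verts)
qed

lemma carrier_A: "a \<in> carrier A \<longleftrightarrow> (\<forall>x. x \<notin> qpaths Q \<longrightarrow> a x = 0)"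
proof -
  have "finite {x. a x \<noteq> 0}" if "{x. a x \<noteq> 0} \<subseteq> qpaths Q" for a :: "('v, 'e) qpath \<Rightarrow> 'k"
    using that finite_qpaths[OF dynkin finite_verts] finite_subset by blast
  moreover have "a \<in> carrier A \<longleftrightarrow> finite {x. a x \<noteq> 0} \<and> {x. a x \<noteq> 0} \<subseteq> qpaths Q"
    by (simp add: A_eq path_algebra_def)
  moreover have "{x. a x \<noteq> 0} \<subseteq> qpaths Q \<longleftrightarrow> (\<forall>x. x \<notin> qpaths Q \<longrightarrow> a x = 0)"
    by blast
  ultimately show ?thesis
    by blast
qed

lemma finite_carrier_A: "finite (carrier A)"
proof -
  let ?P = "qpaths Q"
  have sub: "carrier A \<subseteq> (\<lambda>f x. if x \<in> ?P then f x else 0) ` (?P \<rightarrow>\<^sub>E UNIV)"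
  proof
    fix a assume "a \<in> carrier A"
    then have "a = (\<lambda>x. if x \<in> ?P then restrict a ?P x else 0)"
      by (auto simp: carrier_A)
    moreover have "restrict a ?P \<in> ?P \<rightarrow>\<^sub>E UNIV"
      by simp
    ultimately show "a \<in> (\<lambda>f x. if x \<in> ?P then f x else 0) ` (?P \<rightarrow>\<^sub>E UNIV)"
      by (rule image_eqI)
  qed
  have "finite (?P \<rightarrow>\<^sub>E (UNIV :: 'k set))"
    by (rule finite_PiE) (simp_all add: finite_qpaths[OF dynkin finite_verts])
  then show ?thesis
    by (rule finite_subset[OF sub finite_imageI])
qed

lemma A_simps: "\<zero> = (\<lambda>x. 0)" "a \<oplus> b = (\<lambda>x. a x + b x)" "c \<odot> a = (\<lambda>x. c * a x)"
  by (simp_all add: A_eq path_algebra_def)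

definition splits :: "'v \<Rightarrow> 'e list \<Rightarrow> 'v \<Rightarrow> ('v \<times> 'e list \<times> 'e list) set" where
  "splits u p w = {(v, p1, p2). (u, p1, v) \<in> qpaths Q \<and> (v, p2, w) \<in> qpaths Q \<and> p = p1 @ p2}"

lemma mult_A: "(a \<otimes> b) (u, p, w) = (\<Sum>(v, p1, p2)\<in>splits u p w. a (v, p2, w) * b (u, p1, v))"
  by (simp add: A_eq path_algebra_def splits_def)

lemma finite_splits: "finite (splits u p w)"
proof (rule finite_subset)
  show "splits u p w \<subseteq> verts Q \<times> (\<lambda>k. take k p) ` {..length p} \<times> (\<lambda>k. drop k p) ` {..length p}"
  proof
    fix x assume "x \<in> splits u p w"
    then obtain v p1 p2 where "x = (v, p1, p2)" "(u, p1, v) \<in> qpaths Q" "p = p1 @ p2"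
      by (auto simp: splits_def)
    then show "x \<in> verts Q \<times> (\<lambda>k. take k p) ` {..length p} \<times> (\<lambda>k. drop k p) ` {..length p}"
      using qpaths_verts by (auto intro!: image_eqI[of _ _ "length p1"])
  qed
qed (use finite_verts in simp)

text \<open>The identity, the idempotents at the vertices and the scalars are all diagonal.\<close>

definition diag :: "('v \<Rightarrow> 'k) \<Rightarrow> ('v, 'e) qpath \<Rightarrow> 'k" where
  "diag t = (\<lambda>(u, p, w). if u \<in> verts Q \<and> p = [] \<and> w = u then t u else 0)"

lemma diag_closed: "diag t \<in> carrier A"
  by (auto simp: carrier_A diag_def qpaths_Nil_iff)

text \<open>Of all factorizations of a path only the one with trivial first segment contributes; in
  \<open>diag_mult\<close> it is the one with trivial second segment.\<close>

lemma mult_diag: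
  assumes a: "a \<in> carrier A"
  shows "(a \<otimes> diag t) (u, p, w) = a (u, p, w) * t u"
proof -
  have "(a \<otimes> diag t) (u, p, w)
      = (\<Sum>x\<in>splits u p w. if x = (u, [], p) then a (u, p, w) * t u else 0)"
    unfolding mult_A by (intro sum.cong refl) (auto simp: splits_def diag_def qpaths_Nil_iff split: if_splits)
  also have "\<dots> = (if (u, [], p) \<in> splits u p w then a (u, p, w) * t u else 0)"
    by (simp add: finite_splits)
  also have "\<dots> = a (u, p, w) * t u"
    using a qpaths_verts[of u p w] by (auto simp: splits_def qpaths_Nil_iff carrier_A)
  finally show ?thesis .
qed

lemma diag_mult:
  assumes a: "a \<in> carrier A"
  shows "(diag t \<otimes> a) (u, p, w) = t w * a (u, p, w)"
proof -
  have "(diag t \<otimes> a) (u, p, w)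
      = (\<Sum>x\<in>splits u p w. if x = (w, p, []) then t w * a (u, p, w) else 0)"
    unfolding mult_A by (intro sum.cong refl) (auto simp: splits_def diag_def qpaths_Nil_iff split: if_splits)
  also have "\<dots> = (if (w, p, []) \<in> splits u p w then t w * a (u, p, w) else 0)"
    by (simp add: finite_splits)
  also have "\<dots> = t w * a (u, p, w)"
    using a qpaths_verts[of u p w] by (auto simp: splits_def qpaths_Nil_iff carrier_A)
  finally show ?thesis .
qed

lemma scalar_eq_diag: "c \<odot> \<one> = diag (\<lambda>u. c)"
  by (auto simp: A_eq path_algebra_def diag_def fun_eq_iff)

sublocale scalar_algebra A
proof
  show "c \<odot> \<one> \<in> carrier A" for c
    unfolding scalar_eq_diag by (rule diag_closed)
  show "0 \<odot> \<one> = \<zero>" "1 \<odot> \<one> = \<one>"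
    by (simp_all add: A_simps)
qed

section \<open>Idempotents, scalars and corners of the path algebra\<close>

abbreviation e :: "'v \<Rightarrow> ('v, 'e) qpath \<Rightarrow> 'k" where
  "e i \<equiv> diag (\<lambda>u. if u = i then 1 else 0)"

definition path_elem :: "('v, 'e) qpath \<Rightarrow> ('v, 'e) qpath \<Rightarrow> 'k" where
  "path_elem r = (\<lambda>x. if x = r then 1 else 0)"

lemma path_elem_closed: "r \<in> qpaths Q \<Longrightarrow> path_elem r \<in> carrier A"
  by (auto simp: carrier_A path_elem_def)

lemma e_mult_e: "e i \<otimes> e i = e i"
proof
  fix x :: "('v, 'e) qpath"
  obtain u s w where x: "x = (u, s, w)"
    by (metis prod_cases3)
  show "(e i \<otimes> e i) x = e i x"
    unfolding x mult_diag[OF diag_closed] by (simp add: diag_def)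
qed

lemma e_eq_path_elem: "i \<in> verts Q \<Longrightarrow> e i = path_elem (i, [], i)"
  by (auto simp: diag_def path_elem_def fun_eq_iff)

lemma scalar_central: "a \<in> carrier A \<Longrightarrow> (c \<odot> \<one>) \<otimes> a = a \<otimes> (c \<odot> \<one>)"
  by (auto simp: scalar_eq_diag fun_eq_iff mult_diag diag_mult)

lemma scalar_mult:
  assumes a: "a \<in> carrier A"
  shows "(c \<odot> \<one>) \<otimes> a = c \<odot> a"
proof
  fix x :: "('v, 'e) qpath"
  obtain u s w where x: "x = (u, s, w)"
    by (metis prod_cases3)
  show "((c \<odot> \<one>) \<otimes> a) x = (c \<odot> a) x"
    unfolding scalar_eq_diag x diag_mult[OF a] unfolding A_simps ..
qed

lemma scalar_scalar: "(c \<odot> \<one>) \<otimes> (d \<odot> \<one>) = (c * d) \<odot> \<one>"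
  by (simp add: scalar_mult scalar_closed) (simp add: A_simps mult.assoc)

text \<open>The two idempotents keep exactly the coefficients at paths from \<open>i\<close> to
  \<open>j\<close>, and there is just one such path.\<close>

lemma corner:
  assumes a: "a \<in> carrier A" and r: "(i, p, j) \<in> qpaths Q"
  shows "e j \<otimes> a \<otimes> e i = (a (i, p, j) \<odot> \<one>) \<otimes> path_elem (i, p, j)"
proof
  fix x :: "('v, 'e) qpath"
  obtain u s w where x: "x = (u, s, w)"
    by (metis prod_cases3)
  have "a (i, s, j) = 0" if "s \<noteq> p"
    using that a r qpaths_unique[of i s j p] by (auto simp: carrier_A)
  then show "(e j \<otimes> a \<otimes> e i) x = ((a (i, p, j) \<odot> \<one>) \<otimes> path_elem (i, p, j)) x"
    unfolding x mult_diag[OF m_closed[OF diag_closed a]] diag_mult[OF a]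
      scalar_mult[OF path_elem_closed[OF r]] unfolding A_simps(3)
    by (auto simp: path_elem_def)
qed

lemma corner_zero:
  assumes a: "a \<in> carrier A" and "\<And>p. (i, p, j) \<notin> qpaths Q"
  shows "e j \<otimes> a \<otimes> e i = \<zero>"
proof
  fix x :: "('v, 'e) qpath"
  obtain u s w where x: "x = (u, s, w)"
    by (metis prod_cases3)
  show "(e j \<otimes> a \<otimes> e i) x = \<zero> x"
    using a assms(2)[of s] unfolding x
    by (auto simp: mult_diag diag_mult diag_closed m_closed A_simps carrier_A)
qed

lemma path_elem_e:
  assumes r: "(i, p, j) \<in> qpaths Q"
  shows "path_elem (i, p, j) \<otimes> e i = path_elem (i, p, j)" "e j \<otimes> path_elem (i, p, j) = path_elem (i, p, j)"
proof -
  have "(path_elem (i, p, j) \<otimes> e i) (u, s, w) = path_elem (i, p, j) (u, s, w)"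
    "(e j \<otimes> path_elem (i, p, j)) (u, s, w) = path_elem (i, p, j) (u, s, w)" for u s w
    unfolding mult_diag[OF path_elem_closed[OF r]] diag_mult[OF path_elem_closed[OF r]]
    by (simp_all add: path_elem_def)
  then show "path_elem (i, p, j) \<otimes> e i = path_elem (i, p, j)" "e j \<otimes> path_elem (i, p, j) = path_elem (i, p, j)"
    by (simp_all add: fun_eq_iff)
qed

section \<open>The regular module\<close>

text \<open>In \<open>A\<close> itself the field \<open>smult\<close> is multiplication by elements
  of the ground field; here it is the product of the algebra.\<close>

definition regular_module :: "(('v, 'e) qpath \<Rightarrow> 'k, ('v, 'e) qpath \<Rightarrow> 'k) module" where
  "regular_module = \<lparr>carrier = carrier A, mult = mult A, one = one A, zero = zero A, add = add A, smult = mult A\<rparr>"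

lemma regular_simps:
  "carrier regular_module = carrier A" "\<zero>\<^bsub>regular_module\<^esub> = \<zero>" "x \<oplus>\<^bsub>regular_module\<^esub> y = x \<oplus> y"
  "a \<odot>\<^bsub>regular_module\<^esub> x = a \<otimes> x"
  by (simp_all add: regular_module_def)

lemma left_module_regular: "left_module A regular_module"
proof -
  have "abelian_group regular_module"
    by (rule abelian_groupI) (auto simp: regular_simps a_ac intro: bexI[of _ "\<ominus> _"] l_neg)
  then show ?thesis
    by (intro left_module.intro left_module_axioms.intro ring_axioms)
      (auto simp: regular_simps l_distr r_distr m_assoc)
qed

lemma lmod_hom_orbit:
  assumes L: "left_module A L" and m: "m \<in> carrier L"
  shows "restrict (\<lambda>a. a \<odot>\<^bsub>L\<^esub> m) (carrier A) \<in> lmod_hom A regular_module L"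
proof -
  interpret L: left_module A L by (rule L)
  show ?thesis
    using m by (intro lmod_homI) (auto simp: regular_simps L.smult_closed L.smult_l_distr L.smult_assoc)
qed

lemma lmod_hom_scalar:
  assumes L: "left_module A L"
  shows "restrict (\<lambda>y. (c \<odot> \<one>) \<odot>\<^bsub>L\<^esub> y) (carrier L) \<in> lmod_hom A L L"
proof -
  interpret L: left_module A L by (rule L)
  show ?thesis
    by (intro lmod_homI) (auto simp: L.smult_closed L.smult_r_distr scalar_closed L.smult_assoc[symmetric]
        scalar_central)
qed

section \<open>Projective covers of the simple modules\<close>

lemma simple_module_simps:
  "carrier (simple_module i :: (('v, 'e) qpath \<Rightarrow> 'k, 'k) module) = UNIV"
  "\<zero>\<^bsub>simple_module i :: (('v, 'e) qpath \<Rightarrow> 'k, 'k) module\<^esub> = 0"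
  "x \<oplus>\<^bsub>simple_module i :: (('v, 'e) qpath \<Rightarrow> 'k, 'k) module\<^esub> y = x + y"
  "a \<odot>\<^bsub>simple_module i :: (('v, 'e) qpath \<Rightarrow> 'k, 'k) module\<^esub> x = a (i, [], i) * x"
  by (simp_all add: simple_module_def)

lemma projective_cover_generator:
  fixes P :: "(('v, 'e) qpath \<Rightarrow> 'k, 'm) module"
  assumes cover: "is_projective_cover A P (simple_module l)" and l: "l \<in> verts Q"
  obtains x \<pi> where "x \<in> carrier P" "e l \<odot>\<^bsub>P\<^esub> x = x" "\<forall>y\<in>carrier P. \<exists>a\<in>carrier A. y = a \<odot>\<^bsub>P\<^esub> x"
    "\<pi> \<in> lmod_hom A P (simple_module l)" "\<pi> x = 1"
proof -
  let ?S = "simple_module l :: (('v, 'e) qpath \<Rightarrow> 'k, 'k) module"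
  have P: "projective_module A P"
    using cover by (simp add: is_projective_cover_def)
  note LP = fd_module_finite[OF projective_fd[OF P]]
  interpret P: left_module A P by (rule LP)
  obtain \<pi> where \<pi>: "\<pi> \<in> lmod_hom A P ?S" "\<pi> ` carrier P = carrier ?S"
    and small: "\<And>N. \<lbrakk>submodule N A P; N <+>\<^bsub>P\<^esub> {x \<in> carrier P. \<pi> x = \<zero>\<^bsub>?S\<^esub>} = carrier P\<rbrakk> \<Longrightarrow> N = carrier P"
    using cover unfolding is_projective_cover_def by blast
  have "1 \<in> \<pi> ` carrier P"
    by (simp add: \<pi>(2) simple_module_simps)
  then obtain x0 where x0: "x0 \<in> carrier P" "\<pi> x0 = 1"
    by auto
  \<comment> \<open>Projection to weight \<open>l\<close> does not disturb the image, since
    \<open>e l\<close> acts as the identity on the simple module.\<close>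
  define x where "x = e l \<odot>\<^bsub>P\<^esub> x0"
  have x: "x \<in> carrier P"
    unfolding x_def by (intro P.smult_closed diag_closed x0)
  have ex: "e l \<odot>\<^bsub>P\<^esub> x = x"
    unfolding x_def by (simp add: P.smult_assoc[symmetric] diag_closed x0 e_mult_e)
  have "\<pi> x = e l \<odot>\<^bsub>?S\<^esub> \<pi> x0"
    unfolding x_def by (rule lmod_hom_smult[OF \<pi>(1) diag_closed x0(1)])
  then have \<pi>x: "\<pi> x = 1"
    using l x0(2) by (simp add: simple_module_simps diag_def)
  let ?N = "(\<lambda>a. a \<odot>\<^bsub>P\<^esub> x) ` carrier A"
  have cl: "a \<odot>\<^bsub>P\<^esub> x \<in> carrier P" if "a \<in> carrier A" for a
    by (rule P.smult_closed[OF that x])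
  have "submodule ?N A P"
  proof (intro submodule.intro submodule_axioms.intro P.M.add.subgroupI)
    show "?N \<subseteq> carrier P" "?N \<noteq> {}"
      using cl by auto
    fix u assume "u \<in> ?N"
    then obtain a where a: "a \<in> carrier A" "u = a \<odot>\<^bsub>P\<^esub> x"
      by blast
    have "(\<ominus> a) \<odot>\<^bsub>P\<^esub> x \<oplus>\<^bsub>P\<^esub> u = \<zero>\<^bsub>P\<^esub>"
      using a x P.smult_l_distr[of "\<ominus> a" a x] by (simp add: l_neg P.smult_R_zero)
    then have "\<ominus>\<^bsub>P\<^esub> u = (\<ominus> a) \<odot>\<^bsub>P\<^esub> x"
      using a cl by (intro P.M.minus_equality) simp_all
    then show "\<ominus>\<^bsub>P\<^esub> u \<in> ?N"
      using a by blast
    show "b \<odot>\<^bsub>P\<^esub> u \<in> ?N" if "b \<in> carrier A" for b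
      using that a x by (auto simp: P.smult_assoc[symmetric])
    fix v assume "v \<in> ?N"
    then obtain b where b: "b \<in> carrier A" "v = b \<odot>\<^bsub>P\<^esub> x"
      by blast
    show "u \<oplus>\<^bsub>P\<^esub> v \<in> ?N"
      using a b x by (auto simp: P.smult_l_distr[symmetric])
  qed
  moreover have "?N <+>\<^bsub>P\<^esub> {x \<in> carrier P. \<pi> x = \<zero>\<^bsub>?S\<^esub>} = carrier P"
  proof (intro equalityI subsetI)
    fix y assume "y \<in> ?N <+>\<^bsub>P\<^esub> {x \<in> carrier P. \<pi> x = \<zero>\<^bsub>?S\<^esub>}"
    then show "y \<in> carrier P"
      using cl by (auto simp: set_add_def')
  next
    fix y assume y: "y \<in> carrier P"
    \<comment> \<open>As \<open>\<pi> x = 1\<close>, this scalar multiple of \<open>x\<close> has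
      the same image as \<open>y\<close>, and the difference lies in the kernel.\<close>
    let ?u = "(\<pi> y \<odot> \<one>) \<odot>\<^bsub>P\<^esub> x"
    have u: "?u \<in> ?N" "?u \<in> carrier P"
      using scalar_closed cl by blast+
    have "\<pi> ?u = (\<pi> y \<odot> \<one>) \<odot>\<^bsub>?S\<^esub> \<pi> x"
      by (rule lmod_hom_smult[OF \<pi>(1) scalar_closed x])
    also have "\<dots> = \<pi> y"
      using l by (simp add: \<pi>x simple_module_simps scalar_eq_diag diag_def)
    finally have "\<pi> ?u = \<pi> y" .
    moreover have "\<pi> (y \<ominus>\<^bsub>P\<^esub> ?u) + \<pi> ?u = \<pi> y"
    proof -
      have "\<pi> (y \<ominus>\<^bsub>P\<^esub> ?u) + \<pi> ?u = \<pi> (y \<ominus>\<^bsub>P\<^esub> ?u \<oplus>\<^bsub>P\<^esub> ?u)"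
        using lmod_hom_add[OF \<pi>(1), of "y \<ominus>\<^bsub>P\<^esub> ?u" ?u] y u(2) by (simp add: simple_module_simps)
      also have "y \<ominus>\<^bsub>P\<^esub> ?u \<oplus>\<^bsub>P\<^esub> ?u = y"
        using y u(2) by (simp add: a_minus_def P.M.a_assoc P.M.l_neg)
      finally show ?thesis .
    qed
    ultimately have "y \<ominus>\<^bsub>P\<^esub> ?u \<in> {x \<in> carrier P. \<pi> x = \<zero>\<^bsub>?S\<^esub>}"
      using y u(2) by (simp add: simple_module_simps)
    moreover have "y = ?u \<oplus>\<^bsub>P\<^esub> (y \<ominus>\<^bsub>P\<^esub> ?u)"
      using y u(2) P.M.a_lcomm[of ?u y "\<ominus>\<^bsub>P\<^esub> ?u"] by (simp add: a_minus_def P.M.r_neg)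
    ultimately show "y \<in> ?N <+>\<^bsub>P\<^esub> {x \<in> carrier P. \<pi> x = \<zero>\<^bsub>?S\<^esub>}"
      using u(1) unfolding set_add_def' by blast
  qed
  ultimately have "?N = carrier P"
    by (rule small)
  then have "\<forall>y\<in>carrier P. \<exists>a\<in>carrier A. y = a \<odot>\<^bsub>P\<^esub> x"
    by blast
  then show thesis
    using that[OF x ex _ \<pi>(1) \<pi>x] by blast
qed

text \<open>The splitting of the epimorphism \<open>A \<rightarrow> P, a \<mapsto> a x\<close> maps \<open>x\<close> to \<open>e l\<close> after right multiplication with
  \<open>e l\<close>, since \<open>e l A e l\<close> consists of scalars only. Hence \<open>P\<close> is free on the generator \<open>x\<close> of weight \<open>l\<close>.\<close>

lemma projective_cover_free:
  fixes P :: "(('v, 'e) qpath \<Rightarrow> 'k, 'm) module"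
  assumes cover: "is_projective_cover A P (simple_module l)" and l: "l \<in> verts Q"
  obtains x where "x \<in> carrier P" "e l \<odot>\<^bsub>P\<^esub> x = x" "\<forall>y\<in>carrier P. \<exists>a\<in>carrier A. y = a \<odot>\<^bsub>P\<^esub> x"
    "\<exists>s\<in>lmod_hom A P regular_module. s x = e l"
proof -
  let ?S = "simple_module l :: (('v, 'e) qpath \<Rightarrow> 'k, 'k) module"
  obtain x \<pi> where x: "x \<in> carrier P" "e l \<odot>\<^bsub>P\<^esub> x = x" "\<forall>y\<in>carrier P. \<exists>a\<in>carrier A. y = a \<odot>\<^bsub>P\<^esub> x"
    and \<pi>: "\<pi> \<in> lmod_hom A P ?S" "\<pi> x = 1"
    using projective_cover_generator[OF cover l] by blast
  have P: "projective_module A P"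
    using cover by (simp add: is_projective_cover_def)
  note LP = fd_module_finite[OF projective_fd[OF P]]
  interpret P: left_module A P by (rule LP)
  note reg = left_module_regular
  \<comment> \<open>\<open>projective_section\<close> splits epimorphisms from modules on
    \<open>nat\<close>, so \<open>A\<close> is replaced by a copy.\<close>
  have "finite (carrier regular_module)"
    using finite_carrier_A by (simp add: regular_simps)
  then obtain M' :: "(('v, 'e) qpath \<Rightarrow> 'k, nat) module" and h
    where M': "left_module A M'" "finite (carrier M')"
      and h: "h \<in> lmod_hom A regular_module M'" "bij_betw h (carrier regular_module) (carrier M')"
    using nat_copy[OF reg] by blast
  let ?h' = "restrict (inv_into (carrier regular_module) h) (carrier M')"
  let ?o = "restrict (\<lambda>a. a \<odot>\<^bsub>P\<^esub> x) (carrier A)"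
  note h' = lmod_hom_inverse[OF h reg M'(1)]
  note orb = lmod_hom_orbit[OF LP(1) x(1)]
  have g: "compose (carrier M') ?o ?h' \<in> lmod_hom A M' P"
    by (rule lmod_hom_comp[OF h' orb M'(1)])
  have "?h' ` carrier M' = carrier A"
    using bij_betw_inv_into[OF h(2)] by (simp add: bij_betw_def regular_simps)
  moreover have "compose (carrier M') f f' ` carrier M' = f ` (f' ` carrier M')"
    for f :: "(('v, 'e) qpath \<Rightarrow> 'k) \<Rightarrow> 'm" and f'
    by (auto simp: compose_def)
  ultimately have "compose (carrier M') ?o ?h' ` carrier M' = ?o ` carrier A"
    by (simp only:)
  also have "\<dots> = carrier P"
    using x(3) P.smult_closed[OF _ x(1)] by (auto simp: image_def)
  finally obtain s where s: "s \<in> lmod_hom A P M'"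
    "\<And>y. y \<in> carrier P \<Longrightarrow> compose (carrier M') ?o ?h' (s y) = y"
    using projective_section[OF P fd_moduleI[OF M'] g] by blast
  define s' where "s' = compose (carrier P) ?h' s"
  have s': "s' \<in> lmod_hom A P regular_module"
    unfolding s'_def by (rule lmod_hom_comp[OF s(1) h' LP(1)])
  define b where "b = s' x"
  have b: "b \<in> carrier A"
    using lmod_hom_closed[OF s' x(1)] by (simp add: b_def regular_simps)
  have bx: "b \<odot>\<^bsub>P\<^esub> x = x"
    using s(2)[OF x(1)] x(1) lmod_hom_closed[OF s(1) x(1)] b
    by (simp add: b_def s'_def compose_def)
  have eb: "e l \<otimes> b = b"
    using lmod_hom_smult[OF s' diag_closed x(1), of "\<lambda>u. if u = l then 1 else 0"]
    by (simp add: x(2) b_def regular_simps)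
  let ?c = "b (l, [], l)"
  have loop: "(l, [], l) \<in> qpaths Q"
    using l by (simp add: qpaths_Nil_iff)
  have be: "b \<otimes> e l = (?c \<odot> \<one>) \<otimes> e l"
    using corner[OF b loop] by (simp only: eb e_eq_path_elem[OF l, symmetric])
  \<comment> \<open>Both \<open>b\<close> and \<open>e l\<close> fix \<open>x\<close>, so the scalar
    \<open>?c\<close> fixes it too; applying \<open>\<pi>\<close> gives
    \<open>?c = 1\<close>.\<close>
  have "(?c \<odot> \<one>) \<odot>\<^bsub>P\<^esub> x = ((?c \<odot> \<one>) \<otimes> e l) \<odot>\<^bsub>P\<^esub> x"
    by (simp add: P.smult_assoc scalar_closed diag_closed x(1,2))
  also have "\<dots> = x"
    unfolding be[symmetric] by (simp add: P.smult_assoc b diag_closed x(1,2) bx)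
  finally have "(?c \<odot> \<one>) \<odot>\<^bsub>?S\<^esub> \<pi> x = \<pi> x"
    by (simp only: lmod_hom_smult[OF \<pi>(1) scalar_closed x(1), symmetric])
  then have "?c = 1"
    using l by (simp add: \<pi>(2) simple_module_simps scalar_eq_diag diag_def)
  then have be1: "b \<otimes> e l = e l"
    using be by (simp add: scalar_1 diag_closed)
  have e_reg: "e l \<in> carrier regular_module"
    by (simp add: regular_simps diag_closed)
  let ?s = "compose (carrier P) (restrict (\<lambda>a. a \<odot>\<^bsub>regular_module\<^esub> e l) (carrier A)) s'"
  have "?s \<in> lmod_hom A P regular_module"
    by (rule lmod_hom_comp[OF s' lmod_hom_orbit[OF reg e_reg] LP(1)])
  moreover have "?s x = e l"
    using x(1) b be1 by (simp add: compose_def b_def[symmetric] regular_simps)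
  ultimately show thesis
    using that[OF x] by blast
qed

text \<open>Homomorphisms from \<open>P\<^sub>j\<close> to \<open>P\<^sub>i\<close> correspond to \<open>e\<^sub>j A e\<^sub>i\<close>, which is spanned by the at most one path
  from \<open>i\<close> to \<open>j\<close>.\<close>

lemma projective_cover_hom_zero:
  fixes P P' :: "(('v, 'e) qpath \<Rightarrow> 'k, 'm) module"
  assumes P: "is_projective_cover A P (simple_module i)" and P': "is_projective_cover A P' (simple_module j)"
    and i: "i \<in> verts Q" and j: "j \<in> verts Q" and no_path: "\<And>p. (i, p, j) \<notin> qpaths Q"
  shows "lmod_hom A P' P = {zero_hom P' P}"
proof -
  have LP: "left_module A P" and LP': "left_module A P'"
    using P P' by (auto simp: is_projective_cover_def intro: fd_module_finite projective_fd)
  interpret P: left_module A P by (rule LP)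
  interpret P': left_module A P' by (rule LP')
  obtain x where x: "x \<in> carrier P" "e i \<odot>\<^bsub>P\<^esub> x = x" "\<forall>y\<in>carrier P. \<exists>a\<in>carrier A. y = a \<odot>\<^bsub>P\<^esub> x"
    "\<exists>s\<in>lmod_hom A P regular_module. s x = e i"
    by (rule projective_cover_free[OF P i])
  obtain x' where x': "x' \<in> carrier P'" "e j \<odot>\<^bsub>P'\<^esub> x' = x'" "\<forall>y\<in>carrier P'. \<exists>a\<in>carrier A. y = a \<odot>\<^bsub>P'\<^esub> x'"
    "\<exists>s\<in>lmod_hom A P' regular_module. s x' = e j"
    by (rule projective_cover_free[OF P' j])
  have "g = zero_hom P' P" if g: "g \<in> lmod_hom A P' P" for g
  proof (rule lmod_hom_eqI[OF g lmod_hom_const_zero[OF LP' LP]])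
    obtain a where a: "a \<in> carrier A" "g x' = a \<odot>\<^bsub>P\<^esub> x"
      using bspec[OF x(3) lmod_hom_closed[OF g x'(1)]] by blast
    have "g x' = g (e j \<odot>\<^bsub>P'\<^esub> x')"
      by (simp only: x'(2))
    also have "\<dots> = e j \<odot>\<^bsub>P\<^esub> (a \<odot>\<^bsub>P\<^esub> (e i \<odot>\<^bsub>P\<^esub> x))"
      by (simp only: lmod_hom_smult[OF g diag_closed x'(1)] a(2) x(2))
    also have "\<dots> = (e j \<otimes> a \<otimes> e i) \<odot>\<^bsub>P\<^esub> x"
      using a x(1) by (simp add: P.smult_assoc diag_closed P.smult_closed)
    finally have gx: "g x' = \<zero>\<^bsub>P\<^esub>"
      using corner_zero[OF a(1) no_path] x(1) by (simp add: P.smult_R_zero)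
    fix y assume y: "y \<in> carrier P'"
    then obtain b where "b \<in> carrier A" "y = b \<odot>\<^bsub>P'\<^esub> x'"
      using x'(3) by blast
    then show "g y = zero_hom P' P y"
      using y x'(1) by (simp add: lmod_hom_smult[OF g] gx P.smult_M_zero)
  qed
  then show ?thesis
    using lmod_hom_const_zero[OF LP' LP] by blast
qed

abbreviation scalar_hom :: "(('v, 'e) qpath \<Rightarrow> 'k, 'm) module \<Rightarrow> 'k \<Rightarrow> 'm \<Rightarrow> 'm" where
  "scalar_hom L c \<equiv> restrict (\<lambda>y. (c \<odot> \<one>) \<odot>\<^bsub>L\<^esub> y) (carrier L)"

text \<open>Freeness of \<open>P'\<close> yields a homomorphism \<open>f\<close> that sends the
  generator \<open>x'\<close> to the path times \<open>x\<close>. Freeness of \<open>P\<close>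
  yields \<open>s\<close>, which shows that the scalar multiples of \<open>f\<close> are distinct;
  by \<open>corner\<close> there are no other homomorphisms.\<close>

lemma projective_cover_hom_path:
  fixes P P' :: "(('v, 'e) qpath \<Rightarrow> 'k, 'm) module"
  assumes P: "is_projective_cover A P (simple_module i)" and P': "is_projective_cover A P' (simple_module j)"
    and i: "i \<in> verts Q" and j: "j \<in> verts Q" and r: "(i, p, j) \<in> qpaths Q"
  obtains f where "bij_betw (\<lambda>c. compose (carrier P') (scalar_hom P c) f) UNIV (lmod_hom A P' P)"
    "f \<in> lmod_hom A P' P" "f \<noteq> zero_hom P' P"
proof -
  have LP: "left_module A P" and LP': "left_module A P'"
    using P P' by (auto simp: is_projective_cover_def intro: fd_module_finite projective_fd)
  interpret P: left_module A P by (rule LP)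
  interpret P': left_module A P' by (rule LP')
  note reg = left_module_regular
  obtain x where x: "x \<in> carrier P" "e i \<odot>\<^bsub>P\<^esub> x = x" "\<forall>y\<in>carrier P. \<exists>a\<in>carrier A. y = a \<odot>\<^bsub>P\<^esub> x"
    "\<exists>s\<in>lmod_hom A P regular_module. s x = e i"
    by (rule projective_cover_free[OF P i])
  obtain s where s: "s \<in> lmod_hom A P regular_module" "s x = e i"
    using x(4) by blast
  obtain x' where x': "x' \<in> carrier P'" "e j \<odot>\<^bsub>P'\<^esub> x' = x'" "\<forall>y\<in>carrier P'. \<exists>a\<in>carrier A. y = a \<odot>\<^bsub>P'\<^esub> x'"
    "\<exists>s\<in>lmod_hom A P' regular_module. s x' = e j"
    by (rule projective_cover_free[OF P' j])
  obtain s' where s': "s' \<in> lmod_hom A P' regular_module" "s' x' = e j"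
    using x'(4) by blast
  let ?p = "path_elem (i, p, j)"
  note p = path_elem_closed[OF r]
  let ?m = "?p \<odot>\<^bsub>P\<^esub> x"
  have m: "?m \<in> carrier P"
    by (rule P.smult_closed[OF p x(1)])
  define f where "f = compose (carrier P') (restrict (\<lambda>a. a \<odot>\<^bsub>P\<^esub> ?m) (carrier A)) s'"
  have f: "f \<in> lmod_hom A P' P"
    unfolding f_def by (rule lmod_hom_comp[OF s'(1) lmod_hom_orbit[OF LP m] LP'])
  have fx: "f x' = ?m"
  proof -
    have "f x' = e j \<odot>\<^bsub>P\<^esub> ?m"
      using x'(1) by (simp add: f_def compose_def s'(2) diag_closed)
    also have "\<dots> = (e j \<otimes> ?p) \<odot>\<^bsub>P\<^esub> x"
      by (rule P.smult_assoc[OF diag_closed p x(1), symmetric])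
    finally show ?thesis
      by (simp only: path_elem_e(2)[OF r])
  qed
  have sm: "s ?m = ?p"
    using path_elem_e(1)[OF r] by (simp add: lmod_hom_smult[OF s(1) p x(1)] s(2) regular_simps)
  have eqI: "g = g'" if g: "g \<in> lmod_hom A P' P" and g': "g' \<in> lmod_hom A P' P" and eq: "g x' = g' x'" for g g'
  proof (rule lmod_hom_eqI[OF g g'])
    fix y assume "y \<in> carrier P'"
    then obtain b where "b \<in> carrier A" "y = b \<odot>\<^bsub>P'\<^esub> x'"
      using x'(3) by blast
    then show "g y = g' y"
      by (simp add: lmod_hom_smult[OF g _ x'(1)] lmod_hom_smult[OF g' _ x'(1)] eq)
  qed
  let ?F = "\<lambda>c. compose (carrier P') (scalar_hom P c) f"
  have F: "?F c \<in> lmod_hom A P' P" for c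
    by (rule lmod_hom_comp[OF f lmod_hom_scalar[OF LP] LP'])
  have Fx: "?F c x' = (c \<odot> \<one>) \<odot>\<^bsub>P\<^esub> ?m" for c
    using x'(1) m by (simp add: compose_def fx)
  \<comment> \<open>The scalar reappears as a coefficient in the regular module, which gives
    injectivity.\<close>
  have sF: "s (?F c x') (i, p, j) = c" for c
    unfolding Fx lmod_hom_smult[OF s(1) scalar_closed m] sm
    by (simp add: regular_simps scalar_mult[OF p]) (simp add: A_simps path_elem_def)
  have "bij_betw ?F UNIV (lmod_hom A P' P)"
    unfolding bij_betw_def
  proof (intro conjI inj_onI equalityI subsetI)
    show "c = c'" if eq: "?F c = ?F c'" for c c'
      using sF[of c] sF[of c'] unfolding eq by (rule trans[OF sym])
    show "g \<in> lmod_hom A P' P" if "g \<in> range ?F" for g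
      using that F by blast
    fix g assume g: "g \<in> lmod_hom A P' P"
    obtain a where a: "a \<in> carrier A" "g x' = a \<odot>\<^bsub>P\<^esub> x"
      using bspec[OF x(3) lmod_hom_closed[OF g x'(1)]] by blast
    have "g x' = g (e j \<odot>\<^bsub>P'\<^esub> x')"
      by (simp only: x'(2))
    also have "\<dots> = e j \<odot>\<^bsub>P\<^esub> (a \<odot>\<^bsub>P\<^esub> (e i \<odot>\<^bsub>P\<^esub> x))"
      by (simp only: lmod_hom_smult[OF g diag_closed x'(1)] a(2) x(2))
    also have "\<dots> = (e j \<otimes> a \<otimes> e i) \<odot>\<^bsub>P\<^esub> x"
      using a x(1) by (simp add: P.smult_assoc diag_closed P.smult_closed)
    also have "\<dots> = (a (i, p, j) \<odot> \<one>) \<odot>\<^bsub>P\<^esub> ?m"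
      unfolding corner[OF a(1) r] by (rule P.smult_assoc[OF scalar_closed p x(1)])
    finally have "g x' = ?F (a (i, p, j)) x'"
      unfolding Fx .
    then have "g = ?F (a (i, p, j))"
      by (rule eqI[OF g F])
    then show "g \<in> range ?F"
      by (rule range_eqI)
  qed
  moreover have "f \<noteq> zero_hom P' P"
  proof
    assume "f = zero_hom P' P"
    then have "?m = \<zero>\<^bsub>P\<^esub>"
      using fx x'(1) by simp
    then have "?p = \<zero>"
      using sm lmod_hom_zero[OF LP reg s(1)] by (simp add: regular_simps)
    from fun_cong[OF this, of "(i, p, j)"] show False
      by (simp add: A_simps path_elem_def)
  qed
  ultimately show thesis
    using that f by blast
qed

text \<open>The case of the trivial path at \<open>i\<close>: all endomorphisms are scalars, so
  nonzero ones have an inverse.\<close>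

lemma projective_cover_endo:
  fixes P :: "(('v, 'e) qpath \<Rightarrow> 'k, 'm) module"
  assumes P: "is_projective_cover A P (simple_module i)" and i: "i \<in> verts Q"
  shows "card (lmod_hom A P P) = card (UNIV :: 'k set)"
    and "\<lbrakk>b \<in> lmod_hom A P P; b \<noteq> zero_hom P P\<rbrakk> \<Longrightarrow> bij_betw b (carrier P) (carrier P)"
proof -
  have LP: "left_module A P"
    using P by (auto simp: is_projective_cover_def intro: fd_module_finite projective_fd)
  interpret P: left_module A P by (rule LP)
  have loop: "(i, [], i) \<in> qpaths Q"
    using i by (simp add: qpaths_Nil_iff)
  obtain f where f: "bij_betw (\<lambda>c. compose (carrier P) (scalar_hom P c) f) UNIV (lmod_hom A P P)"
    "f \<in> lmod_hom A P P" "f \<noteq> zero_hom P P"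
    by (rule projective_cover_hom_path[OF P P i i loop])
  show "card (lmod_hom A P P) = card (UNIV :: 'k set)"
    using bij_betw_same_card[OF f(1)] by simp
  have sc: "(c \<odot> \<one>) \<odot>\<^bsub>P\<^esub> ((d \<odot> \<one>) \<odot>\<^bsub>P\<^esub> y) = ((c * d) \<odot> \<one>) \<odot>\<^bsub>P\<^esub> y" if "y \<in> carrier P" for c d y
    using that by (simp add: P.smult_assoc[symmetric] scalar_closed scalar_scalar)
  have cl: "(c \<odot> \<one>) \<odot>\<^bsub>P\<^esub> y \<in> carrier P" if "y \<in> carrier P" for c y
    using that by (intro P.smult_closed scalar_closed)
  \<comment> \<open>The spanning endomorphism \<open>f\<close> is not known to be the identity. The
    identity is some multiple \<open>d f\<close>, hence \<open>f\<close> is the scalar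
    \<open>inverse d\<close>.\<close>
  have "restrict (\<lambda>y. y) (carrier P) \<in> range (\<lambda>c. compose (carrier P) (scalar_hom P c) f)"
    using f(1) lmod_hom_id[OF LP] by (simp add: bij_betw_def)
  then obtain d where d: "restrict (\<lambda>y. y) (carrier P) = compose (carrier P) (scalar_hom P d) f"
    by blast
  have fd: "(d \<odot> \<one>) \<odot>\<^bsub>P\<^esub> f y = y" if "y \<in> carrier P" for y
    using fun_cong[OF d, of y] that lmod_hom_closed[OF f(2) that] by (simp add: compose_def)
  have d0: "d \<noteq> 0"
  proof
    assume "d = 0"
    then have z: "y = \<zero>\<^bsub>P\<^esub>" if "y \<in> carrier P" for y
      using fd[OF that] lmod_hom_closed[OF f(2) that] by (simp add: scalar_0 P.smult_R_zero)
    have "f y = zero_hom P P y" if y: "y \<in> carrier P" for y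
      using z[OF lmod_hom_closed[OF f(2) y]] y by simp
    then have "f = zero_hom P P"
      by (rule lmod_hom_eqI[OF f(2) lmod_hom_const_zero[OF LP LP]])
    with f(3) show False ..
  qed
  have f_eq: "f y = (inverse d \<odot> \<one>) \<odot>\<^bsub>P\<^esub> y" if y: "y \<in> carrier P" for y
  proof -
    have "(inverse d \<odot> \<one>) \<odot>\<^bsub>P\<^esub> y = (inverse d \<odot> \<one>) \<odot>\<^bsub>P\<^esub> ((d \<odot> \<one>) \<odot>\<^bsub>P\<^esub> f y)"
      by (simp only: fd[OF y])
    also have "\<dots> = f y"
      unfolding sc[OF lmod_hom_closed[OF f(2) y]] using d0 lmod_hom_closed[OF f(2) y]
      by (simp add: scalar_1 P.smult_one)
    finally show ?thesis by (rule sym)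
  qed
  assume b: "b \<in> lmod_hom A P P" "b \<noteq> zero_hom P P"
  then have "b \<in> range (\<lambda>c. compose (carrier P) (scalar_hom P c) f)"
    using f(1) by (simp add: bij_betw_def)
  then obtain c' where c': "b = compose (carrier P) (scalar_hom P c') f"
    by blast
  define c where "c = c' * inverse d"
  have c: "b y = (c \<odot> \<one>) \<odot>\<^bsub>P\<^esub> y" if y: "y \<in> carrier P" for y
    using y cl[OF y] by (simp add: c' compose_def f_eq sc c_def)
  have c0: "c \<noteq> 0"
  proof
    assume "c = 0"
    then have "b = zero_hom P P"
      by (intro lmod_hom_eqI[OF b(1) lmod_hom_const_zero[OF LP LP]]) (simp add: c scalar_0 P.smult_R_zero)
    with b(2) show False ..
  qed
  show "bij_betw b (carrier P) (carrier P)"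
  proof (rule bij_betwI[where g = "\<lambda>y. (inverse c \<odot> \<one>) \<odot>\<^bsub>P\<^esub> y"])
    show "b \<in> carrier P \<rightarrow> carrier P" "(\<lambda>y. (inverse c \<odot> \<one>) \<odot>\<^bsub>P\<^esub> y) \<in> carrier P \<rightarrow> carrier P"
      using lmod_hom_closed[OF b(1)] cl by auto
    show "(inverse c \<odot> \<one>) \<odot>\<^bsub>P\<^esub> b y = y" "b ((inverse c \<odot> \<one>) \<odot>\<^bsub>P\<^esub> y) = y" if "y \<in> carrier P" for y
      using that c0 by (simp_all add: c cl sc scalar_1 P.smult_one)
  qed
qed

lemma linked_projectives_covers:
  fixes P P' :: "(('v, 'e) qpath \<Rightarrow> 'k, 'm) module"
  assumes P: "is_projective_cover A P (simple_module i)" and P': "is_projective_cover A P' (simple_module j)"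
    and i: "i \<in> verts Q" and j: "j \<in> verts Q" and r: "(i, p, j) \<in> qpaths Q" and ij: "i \<noteq> j"
  obtains f where "linked_projectives A P P' f (card (UNIV :: 'k set))"
proof -
  have pP: "projective_module A P" and pP': "projective_module A P'"
    using P P' by (auto simp: is_projective_cover_def)
  note LP = fd_module_finite(1)[OF projective_fd[OF pP]] and LP' = fd_module_finite(1)[OF projective_fd[OF pP']]
  interpret P: left_module A P by (rule LP)
  \<comment> \<open>A path back would close up to a walk from \<open>i\<close> to \<open>i\<close>,
    which by uniqueness is the trivial one, against \<open>i \<noteq> j\<close>.\<close>
  have no_path: "(j, p', i) \<notin> qpaths Q" for p'
  proof
    assume "(j, p', i) \<in> qpaths Q"
    interpret wf_digraph Q
      using dynkin by (simp add: dynkin_quiver_def)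
    have "awalk i (p @ p') i"
      using r \<open>(j, p', i) \<in> qpaths Q\<close> by (auto simp: qpaths_def)
    then have "p @ p' = []"
      using qpaths_unique[of i "p @ p'" i "[]"] i by (simp add: qpaths_def awalk_Nil_iff)
    then show False
      using r ij by (auto simp: qpaths_Nil_iff)
  qed
  obtain f where f: "bij_betw (\<lambda>c. compose (carrier P') (scalar_hom P c) f) UNIV (lmod_hom A P' P)"
    "f \<in> lmod_hom A P' P" "f \<noteq> zero_hom P' P"
    by (rule projective_cover_hom_path[OF P P' i j r])
  have "linked_projectives A P P' f (card (UNIV :: 'k set))"
  proof
    show "projective_module A P" "projective_module A P'" "f \<in> lmod_hom A P' P" "f \<noteq> zero_hom P' P"
      by fact+
    show "lmod_hom A P P' = {zero_hom P P'}"
      by (rule projective_cover_hom_zero[OF P' P j i no_path])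
    show "card (lmod_hom A P' P) = card (UNIV :: 'k set)"
      using bij_betw_same_card[OF f(1)] by simp
    show "card (lmod_hom A P P) = card (UNIV :: 'k set)" "card (lmod_hom A P' P') = card (UNIV :: 'k set)"
      by (rule projective_cover_endo(1)[OF P i]) (rule projective_cover_endo(1)[OF P' j])
    show "bij_betw a (carrier P) (carrier P)" if "a \<in> lmod_hom A P P" "a \<noteq> zero_hom P P" for a
      by (rule projective_cover_endo(2)[OF P i that])
    show "bij_betw b (carrier P') (carrier P')" if "b \<in> lmod_hom A P' P'" "b \<noteq> zero_hom P' P'" for b
      by (rule projective_cover_endo(2)[OF P' j that])
    fix g assume "g \<in> lmod_hom A P' P"
    then have "g \<in> range (\<lambda>c. compose (carrier P') (scalar_hom P c) f)"
      using f(1) by (simp add: bij_betw_def)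
    then obtain c where c: "g = compose (carrier P') (scalar_hom P c) f"
      by blast
    have "\<forall>x\<in>carrier P'. g x = scalar_hom P c (f x)"
      by (simp add: c compose_def)
    then show "\<exists>a\<in>lmod_hom A P P. \<forall>x\<in>carrier P'. g x = a (f x)"
      using lmod_hom_scalar[OF LP] by blast
    have "\<forall>x\<in>carrier P'. g x = f (scalar_hom P' c x)"
      using lmod_hom_closed[OF f(2)] by (simp add: c compose_def lmod_hom_smult[OF f(2) scalar_closed])
    then show "\<exists>b\<in>lmod_hom A P' P'. \<forall>x\<in>carrier P'. g x = f (b x)"
      using lmod_hom_scalar[OF LP'] by blast
  qed
  then show thesis by (rule that)
qed

end

section \<open>The relations\<close>

lemma (in scalar_algebra) weighted_class_eq_smult:
  "weighted_class R X = of_nat (card (C1_isos R X X)) \<odot>\<^bsub>hall_algebra R\<^esub> hall_basis R X"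
  by (simp add: weighted_class_def hall_algebra_simps)

lemma (in scalar_algebra) hall_basis_eq_smult:
  assumes "projective_complex R X"
  shows "hall_basis R X = (1 / of_nat (card (C1_isos R X X))) \<odot>\<^bsub>hall_algebra R\<^esub> weighted_class R X"
  using card_C1_isos_pos[OF assms] by (simp add: weighted_class_def hall_algebra_simps)

text \<open>Transfers the relations from the weighted classes to the basis vectors and then to the
  quotient.\<close>

lemma (in linked_projectives) serre_relations:
  assumes I: "hall_ideal R I" and K: "hall_basis R (K_complex M) \<in> I" "hall_basis R (K_complex N) \<in> I"
  defines "B \<equiv> quotient_algebra (hall_algebra R) I"
    and "x \<equiv> I +>\<^bsub>hall_algebra R\<^esub> hall_basis R (C_complex M)"
    and "y \<equiv> I +>\<^bsub>hall_algebra R\<^esub> hall_basis R (C_complex N)"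
  shows "x \<otimes>\<^bsub>B\<^esub> y [^]\<^bsub>B\<^esub> (2::nat) \<ominus>\<^bsub>B\<^esub> of_nat (q + 1) \<odot>\<^bsub>B\<^esub> (y \<otimes>\<^bsub>B\<^esub> x \<otimes>\<^bsub>B\<^esub> y)
        \<oplus>\<^bsub>B\<^esub> of_nat q \<odot>\<^bsub>B\<^esub> (y [^]\<^bsub>B\<^esub> (2::nat) \<otimes>\<^bsub>B\<^esub> x) = \<zero>\<^bsub>B\<^esub>"
    and "of_nat q \<odot>\<^bsub>B\<^esub> (y \<otimes>\<^bsub>B\<^esub> x [^]\<^bsub>B\<^esub> (2::nat)) \<ominus>\<^bsub>B\<^esub> of_nat (q + 1) \<odot>\<^bsub>B\<^esub> (x \<otimes>\<^bsub>B\<^esub> y \<otimes>\<^bsub>B\<^esub> x)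
        \<oplus>\<^bsub>B\<^esub> x [^]\<^bsub>B\<^esub> (2::nat) \<otimes>\<^bsub>B\<^esub> y = \<zero>\<^bsub>B\<^esub>"
proof -
  interpret I: hall_ideal R I by (rule I)
  let ?H = "hall_algebra R"
  let ?x = "hall_basis R X" and ?y = "hall_basis R Y"
  define \<alpha> where "\<alpha> = 1 / (of_nat (card (C1_isos R X X)) :: complex)"
  define \<beta> where "\<beta> = 1 / (of_nat (card (C1_isos R Y Y)) :: complex)"
  have bx: "?x = \<alpha> \<odot>\<^bsub>?H\<^esub> wc X" and by': "?y = \<beta> \<odot>\<^bsub>?H\<^esub> wc Y"
    unfolding \<alpha>_def \<beta>_def by (rule hall_basis_eq_smult[OF pc_X], rule hall_basis_eq_smult[OF pc_Y])
  note cX = weighted_class_closed[OF pc_X] and cY = weighted_class_closed[OF pc_Y]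
    and cW = weighted_class_closed[OF pc_W]
  have cx: "?x \<in> carrier ?H" and cy: "?y \<in> carrier ?H"
    unfolding bx by' by (rule hall_smult_closed[OF cX], rule hall_smult_closed[OF cY])
  \<comment> \<open>The surplus terms of the two commutators have their \<open>K\<close> factor on
    different sides, so the ideal is used as a left ideal here and as a right ideal for
    \<open>s\<close>.\<close>
  have t: "wc X \<otimes>\<^bsub>?H\<^esub> wc (K_complex N) \<in> I"
    unfolding weighted_class_eq_smult[of "K_complex N"] by (rule I.I_l_closed[OF I.smult_ideal[OF K(2)] cX])
  have s: "wc (K_complex M) \<otimes>\<^bsub>?H\<^esub> wc Y \<in> I"
    unfolding weighted_class_eq_smult[of "K_complex M"] by (rule I.I_r_closed[OF I.smult_ideal[OF K(1)] cY])
  have t': "(wc W \<otimes>\<^bsub>?H\<^esub> wc Y) \<gamma> = (wc Y \<otimes>\<^bsub>?H\<^esub> wc W) \<gamma>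
      + (of_nat q - 1) / of_nat q * (wc X \<otimes>\<^bsub>?H\<^esub> wc (K_complex N)) \<gamma>" for \<gamma>
    by (simp add: mult_W_Y mult_Y_W add_divide_distrib)
  have s': "(wc X \<otimes>\<^bsub>?H\<^esub> wc W) \<gamma> = (wc W \<otimes>\<^bsub>?H\<^esub> wc X) \<gamma>
      + (of_nat q - 1) / of_nat q * (wc (K_complex M) \<otimes>\<^bsub>?H\<^esub> wc Y) \<gamma>" for \<gamma>
    by (simp add: mult_X_W mult_W_X add_divide_distrib)
  note S = I.serre_in_ideal[OF cX cY cW q_pos fun_cong[OF mult_Y_X] t t' s s']
  \<comment> \<open>Each relation is homogeneous in \<open>x\<close> and in \<open>y\<close>, so
    rescaling multiplies it by one constant.\<close>
  have E1: "I.serre1 q ?x ?y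
      = (\<alpha> * \<beta> * \<beta>) \<odot>\<^bsub>?H\<^esub> I.serre1 q (wc X) (wc Y)"
    unfolding I.minus_apply[OF hall_smult_closed[OF I.m_closed[OF I.m_closed[OF cy cx] cy]]]
      I.minus_apply[OF hall_smult_closed[OF I.m_closed[OF I.m_closed[OF cY cX] cY]]]
    unfolding bx by' hall_smult_mult hall_smult_smult
    unfolding hall_algebra_simps by (intro ext) (simp add: algebra_simps)
  have E2: "I.serre2 q ?x ?y
      = (\<alpha> * \<alpha> * \<beta>) \<odot>\<^bsub>?H\<^esub> I.serre2 q (wc X) (wc Y)"
    unfolding I.minus_apply[OF hall_smult_closed[OF I.m_closed[OF I.m_closed[OF cx cy] cx]]]
      I.minus_apply[OF hall_smult_closed[OF I.m_closed[OF I.m_closed[OF cX cY] cX]]]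
    unfolding bx by' hall_smult_mult hall_smult_smult
    unfolding hall_algebra_simps by (intro ext) (simp add: algebra_simps)
  note cl = I.cl_mult I.cl_add I.cl_minus I.cl_square I.cl_smult hall_smult_closed I.m_closed
    I.minus_closed cx cy
  show "x \<otimes>\<^bsub>B\<^esub> y [^]\<^bsub>B\<^esub> (2::nat) \<ominus>\<^bsub>B\<^esub> of_nat (q + 1) \<odot>\<^bsub>B\<^esub> (y \<otimes>\<^bsub>B\<^esub> x \<otimes>\<^bsub>B\<^esub> y)
        \<oplus>\<^bsub>B\<^esub> of_nat q \<odot>\<^bsub>B\<^esub> (y [^]\<^bsub>B\<^esub> (2::nat) \<otimes>\<^bsub>B\<^esub> x) = \<zero>\<^bsub>B\<^esub>"
    unfolding B_def x_def y_def
    using I.cl_eq_zero[OF I.smult_ideal[OF S(1), of "\<alpha> * \<beta> * \<beta>", folded E1]] by (simp only: cl)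
  show "of_nat q \<odot>\<^bsub>B\<^esub> (y \<otimes>\<^bsub>B\<^esub> x [^]\<^bsub>B\<^esub> (2::nat)) \<ominus>\<^bsub>B\<^esub> of_nat (q + 1) \<odot>\<^bsub>B\<^esub> (x \<otimes>\<^bsub>B\<^esub> y \<otimes>\<^bsub>B\<^esub> x)
        \<oplus>\<^bsub>B\<^esub> x [^]\<^bsub>B\<^esub> (2::nat) \<otimes>\<^bsub>B\<^esub> y = \<zero>\<^bsub>B\<^esub>"
    unfolding B_def x_def y_def
    using I.cl_eq_zero[OF I.smult_ideal[OF S(2), of "\<alpha> * \<alpha> * \<beta>", folded E2]] by (simp only: cl)
qed

text \<open>Without homomorphisms in either direction both products are the class of the same direct
  sum.\<close>

lemma (in scalar_algebra) commuting_classes: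
  assumes P: "projective_module R P" and P': "projective_module R P'"
    and hom: "lmod_hom R P P' = {zero_hom P P'}" "lmod_hom R P' P = {zero_hom P' P}"
  shows "hall_basis R (C_complex P) \<otimes>\<^bsub>hall_algebra R\<^esub> hall_basis R (C_complex P')
    = hall_basis R (C_complex P') \<otimes>\<^bsub>hall_algebra R\<^esub> hall_basis R (C_complex P)"
proof -
  note pc = projective_complex_C[OF P] and pc' = projective_complex_C[OF P']
  have "weighted_class R (C_complex P) \<otimes>\<^bsub>hall_algebra R\<^esub> weighted_class R (C_complex P')
      = weighted_class R (C_complex P') \<otimes>\<^bsub>hall_algebra R\<^esub> weighted_class R (C_complex P)"
    using weighted_class_mult_trivial[OF pc pc'] weighted_class_mult_trivial[OF pc' pc] hom
      weighted_class_cong[OF projective_complex_ext[OF pc pc' zero_hom_cocycle[OF pc pc']]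
        projective_complex_ext[OF pc' pc zero_hom_cocycle[OF pc' pc]] ext_complex_swap[OF pc pc']]
    by (simp only: fst_C_complex)
  then show ?thesis
    by (simp add: hall_basis_eq_smult[OF pc] hall_basis_eq_smult[OF pc'] hall_smult_mult hall_smult_smult mult.commute)
qed

text \<open>\<open>genideal\<close> is an intersection of ideals, and the locale \<open>ideal\<close> includes the axioms of a ring. So
  either the Hall algebra is a ring, or \<open>K_ideal\<close> is an empty intersection, that is \<open>UNIV\<close>, and the
  relations hold trivially. Hence the associativity of the Hall algebra need not be proved here.\<close>

lemma K_ideal_cases:
  obtains "hall_ideal R (K_ideal R P S)" "\<And>l. l \<in> S \<Longrightarrow> hall_basis R (K_complex (P l)) \<in> K_ideal R P S"
  | "K_ideal R P S = UNIV"
proof (cases "\<exists>J. ideal J (hall_algebra R) \<and> (\<lambda>l. hall_basis R (K_complex (P l))) ` S \<subseteq> J")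
  case True
  then obtain J where J: "ideal J (hall_algebra R)" "(\<lambda>l. hall_basis R (K_complex (P l))) ` S \<subseteq> J"
    by blast
  interpret J: ideal J "hall_algebra R" by (rule J(1))
  have sub: "(\<lambda>l. hall_basis R (K_complex (P l))) ` S \<subseteq> carrier (hall_algebra R)"
    using J(2) J.a_subset by blast
  have "hall_ideal R (K_ideal R P S)"
    unfolding K_ideal_def by (intro hall_ideal.intro J.genideal_ideal[OF sub])
  moreover have "hall_basis R (K_complex (P l)) \<in> K_ideal R P S" if "l \<in> S" for l
    using J.genideal_self[OF sub] that unfolding K_ideal_def by blast
  ultimately show thesis
    using that(1) by blast
next
  case False
  then have "K_ideal R P S = UNIV"
    unfolding K_ideal_def genideal_def by blast
  then show thesis
    by (rule that(2))
qed

text \<open>Covers the degenerate case in which the generated ideal is \<open>UNIV\<close>. No ring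
  axioms are at hand there, so each operation is computed from its definition on the single
  coset.\<close>

lemma trivial_quotient:
  fixes R :: "('k::{field,finite}, 'a) module"
  defines "H \<equiv> quotient_algebra (hall_algebra R) UNIV"
  shows "UNIV +>\<^bsub>hall_algebra R\<^esub> h = UNIV" "UNIV \<otimes>\<^bsub>H\<^esub> UNIV = UNIV" "UNIV \<oplus>\<^bsub>H\<^esub> UNIV = UNIV"
    "UNIV \<ominus>\<^bsub>H\<^esub> UNIV = UNIV" "c \<odot>\<^bsub>H\<^esub> UNIV = UNIV" "UNIV [^]\<^bsub>H\<^esub> (2::nat) = UNIV" "\<zero>\<^bsub>H\<^esub> = UNIV"
proof -
  let ?A = "hall_algebra R"
  show coset: "UNIV +>\<^bsub>?A\<^esub> h = UNIV" for h
  proof -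
    have "g = (\<lambda>\<gamma>. g \<gamma> - h \<gamma>) \<oplus>\<^bsub>?A\<^esub> h" for g
      by (simp add: hall_algebra_simps)
    then show ?thesis
      unfolding a_r_coset_def' by blast
  qed
  show mult: "UNIV \<otimes>\<^bsub>H\<^esub> UNIV = UNIV"
    by (simp add: H_def quotient_algebra_def ring.defs FactRing_def rcoset_mult_def coset)
  show add: "UNIV \<oplus>\<^bsub>H\<^esub> UNIV = UNIV"
  proof -
    have "g = (\<lambda>\<gamma>. 0) \<oplus>\<^bsub>?A\<^esub> g" for g
      by (simp add: hall_algebra_simps)
    then show ?thesis
      unfolding H_def quotient_algebra_def ring.defs FactRing_def set_add_def' by auto
  qed
  show zero: "\<zero>\<^bsub>H\<^esub> = UNIV"
    by (simp add: H_def quotient_algebra_def ring.defs FactRing_def)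
  \<comment> \<open>A coset exists only if the Hall algebra has an element. The additive inverse is
    a definite description over the carrier of \<open>H\<close>, which is why the carrier is
    determined.\<close>
  have "(\<lambda>\<gamma>. 0) \<in> carrier ?A"
    by (simp add: hall_algebra_def)
  then have carrier: "carrier H = {UNIV}"
    by (auto simp: H_def quotient_algebra_def ring.defs FactRing_def A_RCOSETS_def' coset)
  have "\<ominus>\<^bsub>H\<^esub> UNIV = UNIV"
    unfolding a_inv_def m_inv_def by (rule the_equality) (auto simp: carrier add zero)
  then show "UNIV \<ominus>\<^bsub>H\<^esub> UNIV = UNIV"
    by (simp add: a_minus_def add)
  show "c \<odot>\<^bsub>H\<^esub> UNIV = UNIV"
    by (simp add: H_def quotient_algebra_def ring.defs coset)
  have "\<one>\<^bsub>H\<^esub> = UNIV"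
    by (simp add: H_def quotient_algebra_def ring.defs FactRing_def coset)
  then show "UNIV [^]\<^bsub>H\<^esub> (2::nat) = UNIV"
    by (simp add: nat_pow_def numeral_2_eq_2 mult)
qed

theorem proposition6p3:
  fixes Q :: "(nat, 'e) pre_digraph"
    and n q i j :: nat
    and A :: "('k::{field,finite}, (nat, 'e) qpath \<Rightarrow> 'k) module"
    and P :: "nat \<Rightarrow> ((nat, 'e) qpath \<Rightarrow> 'k, nat) module"
    and H (structure)
    and C :: "nat \<Rightarrow> ((nat, 'e) qpath \<Rightarrow> 'k) hall_vector set"
  assumes "dynkin_quiver Q" and "verts Q = {1..n}"
    and "q = card (UNIV :: 'k set)"
    and "A = path_algebra Q"
    and "\<And>l. l \<in> {1..n} \<Longrightarrow> is_projective_cover A (P l) (simple_module l)"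
    and "H = reduced_hall_algebra A P {1..n}"
    and "C = reduced_C A P {1..n}"
    and "i \<in> {1..n}" and "j \<in> {1..n}" and "i \<noteq> j"
  shows "(path_matrix Q i j = 0 \<longrightarrow> C i \<otimes> C j = C j \<otimes> C i) \<and>
    (path_matrix Q i j = 1 \<longrightarrow>
      C i \<otimes> C j [^] (2::nat)
        \<ominus> of_nat (q + 1) \<odot> (C j \<otimes> C i \<otimes> C j)
        \<oplus> of_nat q \<odot> (C j [^] (2::nat) \<otimes> C i) = \<zero> \<and>
      of_nat q \<odot> (C j \<otimes> C i [^] (2::nat))
        \<ominus> of_nat (q + 1) \<odot> (C i \<otimes> C j \<otimes> C i)
        \<oplus> C i [^] (2::nat) \<otimes> C j = \<zero>)"
proof -
  let ?K = "K_ideal A P {1..n}"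
  have H: "H = quotient_algebra (hall_algebra A) ?K"
    using assms(6) by (simp add: reduced_hall_algebra_def)
  have C: "C l = ?K +>\<^bsub>hall_algebra A\<^esub> hall_basis A (C_complex (P l))" for l
    using assms(7) by (simp add: reduced_C_def)
  note Pi = assms(5)[OF assms(8)] and Pj = assms(5)[OF assms(9)]
  have i: "i \<in> verts Q" and j: "j \<in> verts Q"
    using assms(2,8,9) by simp_all
  \<comment> \<open>That the path algebra is a ring is read off from a module over it, as
    \<open>left_module\<close> includes the ring axioms of the base.\<close>
  have "left_module A (P i)"
    using Pi by (simp add: is_projective_cover_def projective_module_def fd_module_def)
  then interpret dynkin_path_algebra Q A
    using assms(1,2,4) by (intro dynkin_path_algebra.intro dynkin_path_algebra_axioms.intro left_module.axioms(1)) simp_all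
  have path: "has_path Q u v \<longleftrightarrow> (\<exists>p. (u, p, v) \<in> qpaths Q)" for u v
    by (simp add: has_path_def qpaths_def)
  show ?thesis
  proof (rule K_ideal_cases[of A P "{1..n}"])
    assume "?K = UNIV"
    then show ?thesis
      unfolding H C by (simp only: trivial_quotient simp_thms)
  next
    assume I: "hall_ideal A ?K" and K: "\<And>l. l \<in> {1..n} \<Longrightarrow> hall_basis A (K_complex (P l)) \<in> ?K"
    interpret I: hall_ideal A ?K by (rule I)
    show ?thesis
    proof (intro conjI impI)
      assume "path_matrix Q i j = 0"
      then have "\<not> has_path Q i j" "\<not> has_path Q j i"
        using assms(10) by (auto simp: path_matrix_def split: if_splits)
      then have "lmod_hom A (P j) (P i) = {zero_hom (P j) (P i)}" "lmod_hom A (P i) (P j) = {zero_hom (P i) (P j)}"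
        using projective_cover_hom_zero[OF Pi Pj i j] projective_cover_hom_zero[OF Pj Pi j i] by (auto simp: path)
      moreover have pi: "projective_module A (P i)" and pj: "projective_module A (P j)"
        using Pi Pj by (simp_all add: is_projective_cover_def)
      ultimately have "hall_basis A (C_complex (P i)) \<otimes>\<^bsub>hall_algebra A\<^esub> hall_basis A (C_complex (P j))
          = hall_basis A (C_complex (P j)) \<otimes>\<^bsub>hall_algebra A\<^esub> hall_basis A (C_complex (P i))"
        by (intro commuting_classes)
      moreover have closed: "hall_basis A (C_complex (P l)) \<in> carrier (hall_algebra A)"
        if "projective_module A (P l)" for l
        unfolding hall_basis_eq_smult[OF projective_complex_C[OF that]]
        by (rule hall_smult_closed[OF weighted_class_closed[OF projective_complex_C[OF that]]])
      ultimately show "C i \<otimes> C j = C j \<otimes> C i"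
        unfolding H C I.cl_mult[OF closed[OF pi] closed[OF pj]] I.cl_mult[OF closed[OF pj] closed[OF pi]]
        by (simp only:)
    next
      assume "path_matrix Q i j = 1"
      then have "has_path Q i j"
        by (auto simp: path_matrix_def split: if_splits)
      then obtain p where "(i, p, j) \<in> qpaths Q"
        by (auto simp: path)
      then obtain f where "linked_projectives A (P i) (P j) f (card (UNIV :: 'k set))"
        by (rule linked_projectives_covers[OF Pi Pj i j _ assms(10)])
      then interpret linked_projectives A "P i" "P j" f q
        by (simp only: assms(3))
      note S = serre_relations[OF I K[OF assms(8)] K[OF assms(9)]]
      show "C i \<otimes> C j [^] (2::nat) \<ominus> of_nat (q + 1) \<odot> (C j \<otimes> C i \<otimes> C j)
          \<oplus> of_nat q \<odot> (C j [^] (2::nat) \<otimes> C i) = \<zero>"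
        unfolding H C by (rule S(1))
      show "of_nat q \<odot> (C j \<otimes> C i [^] (2::nat)) \<ominus> of_nat (q + 1) \<odot> (C i \<otimes> C j \<otimes> C i)
          \<oplus> C i [^] (2::nat) \<otimes> C j = \<zero>"
        unfolding H C by (rule S(2))
    qed
  qed
qed

end
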